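(* Suppose that $X$ is the core of a cubelike graph, and let $Y$ be a connected component of an orbital graph of $X$ with valency $d$. Then the following hold: 1. $Y$ is homomorphically equivalent to a cubelike graph. In particular, $\omega(Y)\neq 3$ and $\chi(Y)\ne 3$. 2. $Y$ is generously transitive. 3. There is a covering map from the $d$-cube $Q_d$ to $Y$. Thus $Y$ has at most $2^d$ vertices. 4. If $Y$ is a core other than $K_2$, then $|V(Y)|\le 2^{d-1}$, with equality if and only if $d$ is odd and $Y$ is the folded cube of order $d$. 5. The eigenvalues of $Y$ are a sub-multiset of the eigenvalues of $Q_d$ and are thus integers. 6. If $\alpha(Y)\omega(Y)=|V(Y)|$, then the core of $Y$ must be complete. 7. $Y$ is hom-idempotent. If $Y$ is a core, then this is equivalent to $Y$ being a subgraph of its shift graph $\mathrm{Sh}(Y)$. 8. For any graph $W$, if $W\to Y$ then $\mathbb{Z}_2[W]\to Y$. 9. If $Y$ has odd girth $g$, then $Y$ contains the folded cube of order $g$ as an induced subgraph.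
   Context: All graphs are finite, undirected and simple, and graphs are identified up to isomorphism. Write $X\to Y$ if there is a homomorphism (adjacency-preserving map) from $X$ to $Y$; $X,Y$ are homomorphically equivalent if $X\to Y$ and $Y\to X$. A graph is a core if all its endomorphisms are bijective; every graph $X$ is homomorphically equivalent to a unique (up to isomorphism) core, called the core of $X$, which is an induced subgraph of $X$. A cubelike graph is a Cayley graph $\mathrm{Cay}(\mathbb{Z}_2^n,C)$, $0\notin C$ (vertex set $\mathbb{Z}_2^n$, $a\sim b$ iff $a+b\in C$), for some $n$. The orbitals of $\operatorname{Aut}(X)$ are its orbits on $V(X)\times V(X)$; an orbital is diagonal if it consists of pairs $(x,x)$. An orbital digraph of $X$ is a digraph with vertex set $V(X)$ whose arc set is a union of non-diagonal orbitals of $\operatorname{Aut}(X)$; if this arc set is symmetric it is regarded as an undirected graph and called an orbital graph of $X$. (The core of a cubelike graph is vertex transitive, so its orbital graphs are regular; the valency is the common vertex degree.) A graph is generously transitive if for any two vertices $u,v$ there is an automorphism swapping $u$ and $v$. A covering map from $X$ to $Y$ is a surjective homomorphism $\varphi$ such that for each vertex $u$ of $X$, $\varphi$ restricts to a bijection from the neighbours of $u$ to the neighbours of $\varphi(u)$. $Q_d=\mathrm{Cay}(\mathbb{Z}_2^d,\{e_1,\dots,e_d\})$ with $e_i$ the standard basis vectors. The folded cube of order $n$ (an integer $n>1$) is $\mathrm{Cay}(\mathbb{Z}_2^{n-1},\{e_1,\dots,e_{n-1},e_1+\dots+e_{n-1}\})$. $\omega,\chi,\alpha$ denote clique number, chromatic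 number and independence number. Eigenvalues of a graph are those of its adjacency matrix. The odd girth is the length of a shortest odd cycle (defined to be $\infty$ for bipartite graphs). A graph $Y$ is hom-idempotent if $Y\mathbin{\square}Y\to Y$, where $\square$ is the Cartesian product. A shift of $Y$ is an automorphism $\sigma$ of $Y$ with $\sigma(x)\sim x$ for all $x\in V(Y)$; the shift graph $\mathrm{Sh}(Y)$ is the Cayley graph $\mathrm{Cay}(\operatorname{Aut}(Y),S)$, where $S$ is the set of shifts of $Y$ (in $\mathrm{Cay}(\Gamma,C)$, $a\sim b$ iff $ba^{-1}\in C$). The cubelike hull $\mathbb{Z}_2[W]$ of a graph $W$ has as vertices the even weight vectors of $\mathbb{Z}_2^{V(W)}$, two being adjacent iff their sum is $e_u+e_v$ for some edge $uv$ of $W$.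
   Formalization: Item 4 is stated only for valency d > 0; for d = 0 the component Y is K_1, a core other than K_2, and the bound |V(Y)| ≤ 2^{d-1} fails (1 > 1/2). *)

theory Defs
  imports
    "Graph_Theory.Graph_Theory"
    "Jordan_Normal_Form.Char_Poly"
    "HOL-Algebra.Bij"
    "HOL-Algebra.Group_Action"
    "HOL-Library.Z2"
    "HOL-Library.Extended_Nat"
begin

text \<open>
  Finite simple undirected graphs are the \<^typ>\<open>'a pair_pre_digraph\<close>s in the locale
  \<^locale>\<open>pair_graph\<close>: an edge \<open>uv\<close> is represented by the two arcs \<open>(u,v)\<close> and \<open>(v,u)\<close>.
  Isomorphism is \<^const>\<open>digraph_iso\<close>.
\<close>

section \<open>Homomorphisms and cores\<close>

definition graph_hom :: "('a \<Rightarrow> 'b) \<Rightarrow> 'a pair_pre_digraph \<Rightarrow> 'b pair_pre_digraph \<Rightarrow> bool" where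
  "graph_hom f G H \<longleftrightarrow> f \<in> pverts G \<rightarrow> pverts H \<and> (\<forall>(u,v)\<in>parcs G. (f u, f v) \<in> parcs H)"

definition homomorphic :: "'a pair_pre_digraph \<Rightarrow> 'b pair_pre_digraph \<Rightarrow> bool" where
  "homomorphic G H \<longleftrightarrow> (\<exists>f. graph_hom f G H)"

definition hom_equivalent :: "'a pair_pre_digraph \<Rightarrow> 'b pair_pre_digraph \<Rightarrow> bool" where
  "hom_equivalent G H \<longleftrightarrow> homomorphic G H \<and> homomorphic H G"

definition is_core :: "'a pair_pre_digraph \<Rightarrow> bool" where
  "is_core G \<longleftrightarrow> (\<forall>f. graph_hom f G G \<longrightarrow> bij_betw f (pverts G) (pverts G))"

text \<open>
  The core of a graph is unique only up to isomorphism, so it is a relation here; its vertices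
  need not be vertices of \<open>G\<close>.
\<close>
definition core_of :: "'a pair_pre_digraph \<Rightarrow> 'b pair_pre_digraph \<Rightarrow> bool" where
  "core_of K G \<longleftrightarrow> pair_graph K \<and> is_core K \<and> hom_equivalent K G"

section \<open>Cayley graphs and cubelike graphs\<close>

definition cayley_graph :: "('a, 'b) monoid_scheme \<Rightarrow> 'a set \<Rightarrow> 'a pair_pre_digraph" where
  "cayley_graph \<Gamma> C = \<lparr> pverts = carrier \<Gamma>,
     parcs = {(a, b). a \<in> carrier \<Gamma> \<and> b \<in> carrier \<Gamma> \<and> b \<otimes>\<^bsub>\<Gamma>\<^esub> inv\<^bsub>\<Gamma>\<^esub> a \<in> C} \<rparr>"

abbreviation Z2_group :: "nat \<Rightarrow> bit vec monoid" where
  "Z2_group n \<equiv> monoid_vec TYPE(bit) n"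

definition cubelike :: "bit vec pair_pre_digraph \<Rightarrow> bool" where
  "cubelike Z \<longleftrightarrow>
     (\<exists>n C. C \<subseteq> carrier (Z2_group n) \<and> \<one>\<^bsub>Z2_group n\<^esub> \<notin> C \<and> Z = cayley_graph (Z2_group n) C)"

definition cube :: "nat \<Rightarrow> bit vec pair_pre_digraph" where
  "cube d = cayley_graph (Z2_group d) {unit_vec d i | i. i < d}"

text \<open>
  Only meaningful for \<open>n > 1\<close>. The all-ones vector is the sum of the standard basis vectors.
\<close>
definition folded_cube :: "nat \<Rightarrow> bit vec pair_pre_digraph" where
  "folded_cube n = cayley_graph (Z2_group (n - 1))
     (insert (vec (n - 1) (\<lambda>_. 1)) {unit_vec (n - 1) i | i. i < n - 1})"

lemma bit_vec_add_self:
  fixes a b :: "bit vec"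
  assumes "a \<in> carrier_vec n" "b \<in> carrier_vec n"
  shows "b + a = 0\<^sub>v n \<longleftrightarrow> b = a"
proof -
  have *: "x + y = 0 \<longleftrightarrow> x = y" for x y :: bit by (cases x; cases y) auto
  show ?thesis using assms by (auto simp: vec_eq_iff *)
qed

lemma inv_Z2_group:
  assumes "a \<in> carrier_vec n"
  shows "inv\<^bsub>Z2_group n\<^esub> a = a"
  using assms bit_vec_add_self
  unfolding m_inv_def by (auto simp: monoid_vec_simps intro!: the_equality)

lemma parcs_cayley_graph_Z2_group:
  "parcs (cayley_graph (Z2_group n) C) =
     {(a, b). a \<in> carrier_vec n \<and> b \<in> carrier_vec n \<and> a + b \<in> C}"
proof -
  have "a + b = b + a" if "a \<in> carrier_vec n" "b \<in> carrier_vec n" for a b :: "bit vec"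
    using that comm_add_vec by blast
  then show ?thesis
    by (auto simp: cayley_graph_def monoid_vec_simps inv_Z2_group)
qed

lemma folded_cube_sum_vec:
  "vec m (\<lambda>_. 1 :: bit) = finsum_vec TYPE(bit) m (unit_vec m) {..<m}"
proof (rule eq_vecI)
  fix i assume "i < dim_vec (finsum_vec TYPE(bit) m (unit_vec m) {..<m})"
  then have i: "i < m" by (simp add: finsum_vec_closed[THEN carrier_vecD])
  then show "vec m (\<lambda>_. 1 :: bit) $ i = finsum_vec TYPE(bit) m (unit_vec m) {..<m} $ i"
    by (subst index_finsum_vec) (auto simp: sum.delta)
qed (simp add: finsum_vec_closed[THEN carrier_vecD])

section \<open>Automorphisms, orbitals and coverings\<close>

definition Aut :: "'a pair_pre_digraph \<Rightarrow> ('a \<Rightarrow> 'a) monoid" where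
  "Aut G = BijGroup (pverts G)
     \<lparr> carrier := {\<sigma> \<in> Bij (pverts G).
         \<forall>u\<in>pverts G. \<forall>v\<in>pverts G. (\<sigma> u, \<sigma> v) \<in> parcs G \<longleftrightarrow> (u, v) \<in> parcs G} \<rparr>"

definition orbitals :: "'a pair_pre_digraph \<Rightarrow> ('a \<times> 'a) set set" where
  "orbitals G = orbits (Aut G) (pverts G \<times> pverts G)
     (\<lambda>\<sigma>. \<lambda>(u, v)\<in>pverts G \<times> pverts G. (\<sigma> u, \<sigma> v))"

definition orbital_digraph :: "'a pair_pre_digraph \<Rightarrow> 'a pair_pre_digraph \<Rightarrow> bool" where
  "orbital_digraph X D \<longleftrightarrow> pverts D = pverts X \<and>
     (\<exists>R. R \<subseteq> {A \<in> orbitals X. \<not> A \<subseteq> Id} \<and> parcs D = \<Union> R)"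

definition orbital_graph :: "'a pair_pre_digraph \<Rightarrow> 'a pair_pre_digraph \<Rightarrow> bool" where
  "orbital_graph X D \<longleftrightarrow> orbital_digraph X D \<and> sym (parcs D)"

definition has_valency :: "'a pair_pre_digraph \<Rightarrow> nat \<Rightarrow> bool" where
  "has_valency G d \<longleftrightarrow> (\<forall>v\<in>pverts G. out_degree (with_proj G) v = d)"

text \<open>A connected component is a maximal connected subgraph.\<close>
definition connected_component_of :: "'a pair_pre_digraph \<Rightarrow> 'a pair_pre_digraph \<Rightarrow> bool" where
  "connected_component_of Y G \<longleftrightarrow>
     pre_digraph.max_subgraph (with_proj G) Digraph_Component.connected (with_proj Y)"

definition generously_transitive :: "'a pair_pre_digraph \<Rightarrow> bool" where
  "generously_transitive G \<longleftrightarrow>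
     (\<forall>u\<in>pverts G. \<forall>v\<in>pverts G. \<exists>\<sigma>\<in>carrier (Aut G). \<sigma> u = v \<and> \<sigma> v = u)"

definition covering_map :: "('a \<Rightarrow> 'b) \<Rightarrow> 'a pair_pre_digraph \<Rightarrow> 'b pair_pre_digraph \<Rightarrow> bool" where
  "covering_map \<phi> G H \<longleftrightarrow> graph_hom \<phi> G H \<and> \<phi> ` pverts G = pverts H \<and>
     (\<forall>u\<in>pverts G. bij_betw \<phi> {v. (u, v) \<in> parcs G} {w. (\<phi> u, w) \<in> parcs H})"

section \<open>Graph parameters\<close>

definition is_clique :: "'a pair_pre_digraph \<Rightarrow> 'a set \<Rightarrow> bool" where
  "is_clique G S \<longleftrightarrow> S \<subseteq> pverts G \<and> (\<forall>u\<in>S. \<forall>v\<in>S. u \<noteq> v \<longrightarrow> (u, v) \<in> parcs G)"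

definition is_independent :: "'a pair_pre_digraph \<Rightarrow> 'a set \<Rightarrow> bool" where
  "is_independent G S \<longleftrightarrow> S \<subseteq> pverts G \<and> (\<forall>u\<in>S. \<forall>v\<in>S. (u, v) \<notin> parcs G)"

definition clique_number :: "'a pair_pre_digraph \<Rightarrow> nat" where
  "clique_number G = Max (card ` {S. is_clique G S})"

definition independence_number :: "'a pair_pre_digraph \<Rightarrow> nat" where
  "independence_number G = Max (card ` {S. is_independent G S})"

definition colourable :: "'a pair_pre_digraph \<Rightarrow> nat \<Rightarrow> bool" where
  "colourable G k \<longleftrightarrow>
     (\<exists>c. c \<in> pverts G \<rightarrow> {..<k} \<and> (\<forall>(u, v)\<in>parcs G. c u \<noteq> c v))"

definition chromatic_number :: "'a pair_pre_digraph \<Rightarrow> nat" where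
  "chromatic_number G = (LEAST k. colourable G k)"

text \<open>
  The cycles of \<^theory>\<open>Graph_Theory.Arc_Walk\<close> include \<open>u \<rightarrow> v \<rightarrow> u\<close>, but for
  loop-free graphs the ones of odd length are exactly the odd cycles in the usual sense. The infimum
  of the empty set is \<open>\<infinity>\<close>.
\<close>
definition odd_girth :: "'a pair_pre_digraph \<Rightarrow> enat" where
  "odd_girth G = (INF p\<in>{p. pre_digraph.cycle (with_proj G) p \<and> odd (length p)}. enat (length p))"

definition adj_matrix :: "'a pair_pre_digraph \<Rightarrow> 'a list \<Rightarrow> complex mat" where
  "adj_matrix G vs =
     mat (length vs) (length vs) (\<lambda>(i, j). if (vs ! i, vs ! j) \<in> parcs G then 1 else 0)"

text \<open>
  The eigenvalues with multiplicity; they do not depend on the chosen vertex order.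
\<close>
definition eigenvalues :: "'a pair_pre_digraph \<Rightarrow> complex multiset" where
  "eigenvalues G =
     proots (char_poly (adj_matrix G (SOME vs. distinct vs \<and> set vs = pverts G)))"

section \<open>Subgraphs up to isomorphism\<close>

definition is_subgraph :: "'a pair_pre_digraph \<Rightarrow> 'b pair_pre_digraph \<Rightarrow> bool" where
  "is_subgraph G H \<longleftrightarrow> (\<exists>H'. subgraph H' (with_proj H) \<and> digraph_iso (with_proj G) H')"

definition is_induced_subgraph :: "'a pair_pre_digraph \<Rightarrow> 'b pair_pre_digraph \<Rightarrow> bool" where
  "is_induced_subgraph G H \<longleftrightarrow>
     (\<exists>H'. induced_subgraph H' (with_proj H) \<and> digraph_iso (with_proj G) H')"

section \<open>Hom-idempotence, shift graph and cubelike hull\<close>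

definition cartesian_product ::
    "'a pair_pre_digraph \<Rightarrow> 'b pair_pre_digraph \<Rightarrow> ('a \<times> 'b) pair_pre_digraph" where
  "cartesian_product G H = \<lparr> pverts = pverts G \<times> pverts H,
     parcs = {((u, x), (v, y)). u = v \<and> u \<in> pverts G \<and> (x, y) \<in> parcs H \<or>
                                (u, v) \<in> parcs G \<and> x = y \<and> x \<in> pverts H} \<rparr>"

definition hom_idempotent :: "'a pair_pre_digraph \<Rightarrow> bool" where
  "hom_idempotent G \<longleftrightarrow> homomorphic (cartesian_product G G) G"

definition shifts :: "'a pair_pre_digraph \<Rightarrow> ('a \<Rightarrow> 'a) set" where
  "shifts G = {\<sigma> \<in> carrier (Aut G). \<forall>x\<in>pverts G. (\<sigma> x, x) \<in> parcs G}"

definition shift_graph :: "'a pair_pre_digraph \<Rightarrow> ('a \<Rightarrow> 'a) pair_pre_digraph" where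
  "shift_graph G = cayley_graph (Aut G) (shifts G)"

text \<open>
  A vector of \<open>\<int>\<^sub>2\<^bsup>V(W)\<^esup>\<close> is a function into \<^typ>\<open>bit\<close> that vanishes outside \<open>V(W)\<close>.
\<close>
definition even_weight_vectors :: "'a set \<Rightarrow> ('a \<Rightarrow> bit) set" where
  "even_weight_vectors V = {x. (\<forall>w. w \<notin> V \<longrightarrow> x w = 0) \<and> even (card {w \<in> V. x w \<noteq> 0})}"

definition std_basis :: "'a \<Rightarrow> 'a \<Rightarrow> bit" where
  "std_basis u = (\<lambda>w. if w = u then 1 else 0)"

definition cubelike_hull :: "'a pair_pre_digraph \<Rightarrow> ('a \<Rightarrow> bit) pair_pre_digraph" where
  "cubelike_hull W = \<lparr> pverts = even_weight_vectors (pverts W),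
     parcs = {(x, y). x \<in> even_weight_vectors (pverts W) \<and> y \<in> even_weight_vectors (pverts W) \<and>
       (\<exists>(u, v)\<in>parcs W. \<forall>w. x w + y w = std_basis u w + std_basis v w)} \<rparr>"

end

theory Submission
  imports Defs "HOL-Library.Function_Algebras"
begin

text \<open>
  Let \<open>i : X \<rightarrow> Z\<close> and \<open>r : Z \<rightarrow> X\<close> be homomorphisms between the core \<open>X\<close> and the cubelike graph
  \<open>Z = Cay(\<int>\<^sub>2\<^sup>n, C)\<close>, normalised so that \<open>r \<circ> i\<close> is the identity. For each \<open>z\<close> the map
  \<open>\<sigma>\<^sub>z : u \<mapsto> r(z + i(u))\<close> is an endomorphism of \<open>X\<close>, hence an automorphism, because \<open>X\<close> is a core. So
  \<open>\<sigma>\<^sub>z\<close> preserves every orbital, and the pair \<open>(i, r)\<close> serves every orbital graph of \<open>X\<close> just as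
  well as \<open>X\<close> itself. After a correction that moves every coset of the span of the vectors
  \<open>i(u) + i(v)\<close>, with \<open>uv\<close> an edge, to one fixed coset, it also serves a single connected component
  \<open>Y\<close>. The locale \<open>cubelike_retract\<close> records what survives: \<open>r(i(u)) = u\<close>, and every
  \<open>\<sigma>\<^sub>z\<close> is an injective endomorphism. The rest follows from these properties and connectedness.

  The vectors \<open>i(u) + i(v)\<close> of edges \<open>uv\<close> form a connection set for which both \<open>i\<close> and \<open>r\<close> are
  homomorphisms. Linear extension followed by \<open>r\<close> therefore produces homomorphisms into \<open>Y\<close>: from
  cubelike hulls, from \<open>Y \<box> Y\<close>, and from a cube, if the basis vectors are sent to the edges at one
  vertex. Since \<open>\<sigma>\<^sub>z\<close> carries the neighbours of that vertex to the neighbours of its image, the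
  last map is a covering. Functions on \<open>Y\<close> pulled back along it form a subspace invariant under the
  adjacency operator of the cube, which yields the eigenvalues. If instead the basis vectors are sent
  to the edges of a shortest odd cycle, then one obtains an induced folded cube: two subsets of the cycle
  edges are joined by two routes whose lengths add up to the odd girth, so that unwanted
  coincidences or adjacencies would create a shorter odd closed walk.

  A 3-colouring gives every walk an integral winding number, which vanishes on squares. As the group is
  abelian, rearranging the steps of a walk does not change it. A closed walk and its reversal
  are rearrangements of each other in characteristic 2, so its winding number is zero; but the
  winding number has the parity of the length. Hence 3-colourable retracts are bipartite.

  If \<open>Y\<close> is a core other than \<open>K\<^sub>2\<close>, then it is not bipartite, and lifting an odd closed walk shows
  that every fibre of the covering contains vertices of both parities. This gives the bound
  \<open>2\<^bsup>d-1\<^esup>\<close>. In the case of equality the nontrivial deck transformation is an automorphism of the cube that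
  moves all vertices by the same distance, hence a translation. If it fixed some coordinate, then
  this coordinate could be folded onto another one, contradicting that \<open>Y\<close> is a core. So it is the
  antipodal map, and \<open>Y\<close> is the folded cube.
\<close>


section \<open>Symmetric differences and supports of bit vectors\<close>

lemma sym_diff_cancel [simp]: "sym_diff (sym_diff A B) B = A"
  by blast

lemma sym_diff_cancel_left [simp]: "sym_diff A (sym_diff A B) = B"
  by blast

lemma sym_diff_assoc: "sym_diff (sym_diff A B) C = sym_diff A (sym_diff B C)"
  by blast

lemma sym_diff_insert: "j \<notin> S \<Longrightarrow> sym_diff A (insert j S) = sym_diff (sym_diff A S) {j}"
  by blast

lemma sym_diff_subset: "A \<subseteq> D \<Longrightarrow> B \<subseteq> D \<Longrightarrow> sym_diff A B \<subseteq> D"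
  by blast

lemma sym_diff_twice: "sym_diff (sym_diff (sym_diff (sym_diff R J) A) J) B = sym_diff R (sym_diff A B)"
  by blast

lemma sym_diff_empty_iff: "sym_diff A B = {} \<longleftrightarrow> A = B"
  by blast

lemma sym_diff_interchange: "sym_diff (sym_diff A B) (sym_diff C D) = sym_diff (sym_diff A C) (sym_diff B D)"
  by blast

lemma sym_diff_cancel_common:
  assumes "sym_diff (sym_diff (sym_diff (sym_diff R J) A) M) B = sym_diff (sym_diff (sym_diff (sym_diff R M) C) J) E"
  shows "sym_diff A B = sym_diff C E"
proof -
  have "sym_diff (sym_diff (sym_diff R J) M) (sym_diff A B) = sym_diff (sym_diff (sym_diff (sym_diff R J) A) M) B"
    by blast
  moreover have "sym_diff (sym_diff (sym_diff R J) M) (sym_diff C E) = sym_diff (sym_diff (sym_diff (sym_diff R M) C) J) E"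
    by blast
  ultimately have "sym_diff (sym_diff (sym_diff R J) M) (sym_diff A B) = sym_diff (sym_diff (sym_diff R J) M) (sym_diff C E)"
    using assms by (simp only:)
  then show ?thesis by (metis sym_diff_cancel_left)
qed

text \<open>
  In characteristic 2 the contributions of \<open>A \<inter> B\<close> cancel. Summation is thus linear on subsets,
  which is how linear maps on \<open>\<int>\<^sub>2\<^sup>n\<close> are written below.
\<close>

lemma sum_sym_diff:
  fixes f :: "'b \<Rightarrow> 'v::ab_group_add"
  assumes char2: "\<And>x :: 'v. x + x = 0" and "finite A" "finite B"
  shows "sum f (sym_diff A B) = sum f A + sum f B"
proof -
  have "sum f A = sum f (A \<inter> B) + sum f (A - B)" "sum f B = sum f (B \<inter> A) + sum f (B - A)"
    using assms(2,3) by (simp_all add: sum.Int_Diff)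
  moreover have "sum f (sym_diff A B) = sum f (A - B) + sum f (B - A)"
    using assms(2,3) by (intro sum.union_disjoint) auto
  moreover have "z + x + (z + y) = x + y" for x y z :: 'v
    using char2[of z] by (simp add: algebra_simps)
  ultimately show ?thesis by (simp add: Int_commute)
qed

lemma card_sym_diff:
  assumes "finite A" "finite B"
  shows "card (sym_diff A B) + 2 * card (A \<inter> B) = card A + card B"
proof -
  have "card (sym_diff A B) = card (A - B) + card (B - A)"
    using assms by (intro card_Un_disjoint) auto
  moreover have "card A = card (A - B) + card (A \<inter> B)" "card B = card (B - A) + card (A \<inter> B)"
    using assms card_Int_Diff[of A B] card_Int_Diff[of B A] by (simp_all add: Int_commute)
  ultimately show ?thesis by simp
qed

lemma even_card_sym_diff:
  assumes "finite A" "finite B"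
  shows "even (card (sym_diff A B)) \<longleftrightarrow> (even (card A) \<longleftrightarrow> even (card B))"
  using card_sym_diff[OF assms] by presburger

lemma card_even_subsets:
  assumes "d > 0"
  shows "card {A. A \<subseteq> {..<d} \<and> even (card A)} = 2 ^ (d - 1)"
    and "card {A. A \<subseteq> {..<d} \<and> odd (card A)} = 2 ^ (d - 1)"
proof -
  let ?E = "{A. A \<subseteq> {..<d} \<and> even (card A)}" and ?O = "{A. A \<subseteq> {..<d} \<and> odd (card A)}"
  have fin: "finite A" if "A \<subseteq> {..<d}" for A using that finite_subset by blast
  have flip: "even (card (sym_diff A {0})) \<longleftrightarrow> odd (card A)" if "A \<subseteq> {..<d}" for A
    using even_card_sym_diff[OF fin[OF that], of "{0}"] by simp
  have "sym_diff A {0} \<subseteq> {..<d}" if "A \<subseteq> {..<d}" for A using that assms by auto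
  with flip have "bij_betw (\<lambda>A. sym_diff A {0}) ?E ?O"
    by (intro bij_betwI[where g = "\<lambda>A. sym_diff A {0}"]) (simp_all add: Pi_iff)
  then have eq: "card ?E = card ?O" by (rule bij_betw_same_card)
  have "finite ?E" "finite ?O"
    by (rule finite_subset[of _ "Pow {..<d}"]; auto)+
  moreover have "?E \<inter> ?O = {}" "?E \<union> ?O = Pow {..<d}" by auto
  ultimately have "card ?E + card ?O = card (Pow {..<d})"
    using card_Un_disjoint[of ?E ?O] by simp
  then have "card ?E + card ?O = 2 ^ d" by (simp add: card_Pow)
  also have "(2::nat) ^ d = 2 * 2 ^ (d - 1)" using assms by (cases d) auto
  finally show "card ?E = 2 ^ (d - 1)" "card ?O = 2 ^ (d - 1)" using eq by auto
qed

text \<open>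
  Identifies \<open>\<int>\<^sub>2\<^sup>n\<close> with the subsets of \<open>{..<n}\<close>, so that addition becomes symmetric difference.
\<close>

definition supp :: "bit vec \<Rightarrow> nat set" where
  "supp x = {j. j < dim_vec x \<and> x $ j = 1}"

lemma supp_subset: "x \<in> carrier_vec n \<Longrightarrow> supp x \<subseteq> {..<n}"
  by (auto simp: supp_def)

lemma finite_supp [simp]: "finite (supp x)"
  by (simp add: supp_def)

lemma supp_inject:
  assumes "x \<in> carrier_vec n" "y \<in> carrier_vec n"
  shows "supp x = supp y \<longleftrightarrow> x = y"
proof
  assume eq: "supp x = supp y"
  show "x = y"
  proof (rule eq_vecI)
    show d: "dim_vec x = dim_vec y" using assms by simp
    fix j assume "j < dim_vec y"
    then have "x $ j = 1 \<longleftrightarrow> y $ j = 1" using eq d by (auto simp: supp_def)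
    then show "x $ j = y $ j" by (cases "x $ j"; cases "y $ j") auto
  qed
qed simp

lemma bij_betw_supp: "bij_betw supp (carrier_vec n) (Pow {..<n})"
proof (rule bij_betwI')
  show "supp x = supp y \<longleftrightarrow> x = y" if "x \<in> carrier_vec n" "y \<in> carrier_vec n" for x y
    using that by (rule supp_inject)
  show "supp x \<in> Pow {..<n}" if "x \<in> carrier_vec n" for x
    using supp_subset[OF that] by simp
  show "\<exists>x\<in>carrier_vec n. A = supp x" if "A \<in> Pow {..<n}" for A
  proof
    show "A = supp (vec n (\<lambda>j. of_bool (j \<in> A)))" using that by (auto simp: supp_def)
  qed simp
qed

lemma supp_add:
  assumes "x \<in> carrier_vec n" "y \<in> carrier_vec n"
  shows "supp (x + y) = sym_diff (supp x) (supp y)"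
proof -
  have *: "a + b = 1 \<longleftrightarrow> (a = 1 \<longleftrightarrow> b \<noteq> 1)" for a b :: bit by (cases a; cases b) auto
  show ?thesis using assms by (auto simp: supp_def *)
qed

lemma supp_unit_vec: "j < n \<Longrightarrow> supp (unit_vec n j) = {j}"
  by (auto simp: supp_def unit_vec_def split: if_splits)

lemma supp_ones: "supp (vec n (\<lambda>_. 1)) = {..<n}"
  by (auto simp: supp_def)

lemma arcs_cayley_supp:
  assumes C: "\<And>z. z \<in> carrier_vec n \<Longrightarrow> z \<in> C \<longleftrightarrow> supp z \<in> S"
    and "x \<in> carrier_vec n" "y \<in> carrier_vec n"
  shows "(x, y) \<in> parcs (cayley_graph (Z2_group n) C) \<longleftrightarrow> sym_diff (supp x) (supp y) \<in> S"
  using assms C[of "x + y"] by (simp add: parcs_cayley_graph_Z2_group supp_add)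

lemma pverts_cayley_Z2 [simp]: "pverts (cayley_graph (Z2_group n) C) = carrier_vec n"
  by (simp add: cayley_graph_def monoid_vec_simps)

lemma pverts_cube [simp]: "pverts (cube d) = carrier_vec d"
  by (simp add: cube_def)

lemma pverts_folded_cube [simp]: "pverts (folded_cube n) = carrier_vec (n - 1)"
  by (simp add: folded_cube_def)

lemma arcs_cube:
  assumes "x \<in> carrier_vec d" "y \<in> carrier_vec d"
  shows "(x, y) \<in> parcs (cube d) \<longleftrightarrow> (\<exists>j<d. sym_diff (supp x) (supp y) = {j})"
proof -
  have "z \<in> {unit_vec d i | i. i < d} \<longleftrightarrow> supp z \<in> {{j} | j. j < d}" if "z \<in> carrier_vec d" for z
    using supp_inject[OF that, of "unit_vec d _"] supp_unit_vec[of _ d] by fastforce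
  from arcs_cayley_supp[OF this assms] show ?thesis by (auto simp: cube_def)
qed

lemma arcs_folded_cube:
  assumes "x \<in> carrier_vec (n - 1)" "y \<in> carrier_vec (n - 1)"
  shows "(x, y) \<in> parcs (folded_cube n) \<longleftrightarrow>
    (\<exists>j<n - 1. sym_diff (supp x) (supp y) = {j}) \<or> sym_diff (supp x) (supp y) = {..<n - 1}"
proof -
  let ?C = "insert (vec (n - 1) (\<lambda>_. 1)) {unit_vec (n - 1) i | i. i < n - 1}"
  let ?S = "insert {..<n - 1} {{j} | j. j < n - 1}"
  have "z \<in> ?C \<longleftrightarrow> supp z \<in> ?S" if z: "z \<in> carrier_vec (n - 1)" for z
  proof -
    have "z = vec (n - 1) (\<lambda>_. 1) \<longleftrightarrow> supp z = {..<n - 1}"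
      using supp_inject[OF z, of "vec (n - 1) (\<lambda>_. 1)"] by (simp add: supp_ones)
    moreover have "z = unit_vec (n - 1) i \<longleftrightarrow> supp z = {i}" if "i < n - 1" for i
      using supp_inject[OF z, of "unit_vec (n - 1) i"] supp_unit_vec[OF that] by simp
    ultimately show ?thesis by blast
  qed
  from arcs_cayley_supp[OF this assms] show ?thesis by (auto simp: folded_cube_def)
qed

lemma arc_cubeE:
  assumes "(x, y) \<in> parcs (cube d)"
  obtains j where "x \<in> carrier_vec d" "y \<in> carrier_vec d" "j < d" "supp y = sym_diff (supp x) {j}"
proof -
  have xy: "x \<in> carrier_vec d" "y \<in> carrier_vec d"
    using assms by (auto simp: cube_def parcs_cayley_graph_Z2_group)
  with assms obtain j where "j < d" "sym_diff (supp x) (supp y) = {j}" by (auto simp: arcs_cube)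
  moreover from this have "supp y = sym_diff (supp x) {j}" by (metis sym_diff_cancel_left)
  ultimately show ?thesis using xy that by blast
qed

section \<open>Homomorphisms, automorphisms and isomorphisms\<close>

text \<open>
  These are the defining properties of \<^locale>\<open>pair_graph\<close> in an elementwise form, which suits orbital
  graphs and components, given by their arc sets.
\<close>

locale simple_graph =
  fixes G :: "'a pair_pre_digraph"
  assumes finite_verts: "finite (pverts G)"
    and arc_verts: "(u, v) \<in> parcs G \<Longrightarrow> u \<in> pverts G \<and> v \<in> pverts G"
    and arcs_sym: "(u, v) \<in> parcs G \<Longrightarrow> (v, u) \<in> parcs G"
    and no_loop: "(u, u) \<notin> parcs G"
begin

lemma arcs_subset: "parcs G \<subseteq> pverts G \<times> pverts G"
  using arc_verts by auto

lemma finite_arcs: "finite (parcs G)"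
  using arcs_subset by (rule finite_subset) (simp add: finite_verts)

lemma sym_parcs: "sym (parcs G)"
  using arcs_sym by (auto simp: sym_def)

lemma wf: "wf_digraph (with_proj G)"
  using arcs_subset by (auto simp: wf_digraph_def)

end

lemma simple_graphI: "pair_graph G \<Longrightarrow> simple_graph G"
proof
  assume "pair_graph G"
  then interpret pair_graph G .
  show "finite (pverts G)" by (rule pair_finite_verts)
  show "u \<in> pverts G \<and> v \<in> pverts G" if "(u, v) \<in> parcs G" for u v
    using in_arcsD1[OF that] in_arcsD2[OF that] ..
  show "(v, u) \<in> parcs G" if "(u, v) \<in> parcs G" for u v
    using pair_sym_arcs that by (simp add: symmetric_def symD)
  show "(u, u) \<notin> parcs G" for u using pair_no_loops[of "(u, u)"] by auto
qed

lemma graph_homI: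
  assumes "\<And>u. u \<in> pverts G \<Longrightarrow> f u \<in> pverts H"
    and "\<And>u v. (u, v) \<in> parcs G \<Longrightarrow> (f u, f v) \<in> parcs H"
  shows "graph_hom f G H"
  using assms by (auto simp: graph_hom_def)

lemma graph_homD:
  assumes "graph_hom f G H"
  shows "u \<in> pverts G \<Longrightarrow> f u \<in> pverts H"
    and "(u, v) \<in> parcs G \<Longrightarrow> (f u, f v) \<in> parcs H"
  using assms by (auto simp: graph_hom_def)

lemma graph_hom_comp:
  "graph_hom f G H \<Longrightarrow> graph_hom g H K \<Longrightarrow> graph_hom (\<lambda>u. g (f u)) G K"
  by (intro graph_homI) (auto dest: graph_homD)

text \<open>
  The endomorphism maps the finite arc set injectively into itself, hence onto itself.
\<close>

lemma bijective_endo_reflects_arcs: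
  assumes "simple_graph G" "graph_hom f G G" "inj_on f (pverts G)"
    and "u \<in> pverts G" "v \<in> pverts G" "(f u, f v) \<in> parcs G"
  shows "(u, v) \<in> parcs G"
proof -
  interpret simple_graph G by fact
  let ?F = "map_prod f f"
  have inj: "inj_on ?F (pverts G \<times> pverts G)" using assms(3) by (auto simp: inj_on_def)
  have "?F ` parcs G \<subseteq> parcs G" using graph_homD(2)[OF assms(2)] by auto
  then have "?F ` parcs G = parcs G"
    using endo_inj_surj[OF finite_arcs] inj_on_subset[OF inj arcs_subset] by blast
  then have "?F (u, v) \<in> ?F ` parcs G" using assms(6) by simp
  then obtain p where p: "p \<in> parcs G" "?F p = ?F (u, v)" by (metis imageE)
  then have "p = (u, v)" using inj_onD[OF inj p(2)] arcs_subset assms(4,5) by auto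
  with p show ?thesis by simp
qed

lemma carrier_Aut:
  "carrier (Aut G) = {\<sigma> \<in> Bij (pverts G).
     \<forall>u\<in>pverts G. \<forall>v\<in>pverts G. (\<sigma> u, \<sigma> v) \<in> parcs G \<longleftrightarrow> (u, v) \<in> parcs G}"
  by (simp add: Aut_def)

lemma mult_Aut:
  assumes "\<sigma> \<in> carrier (Aut G)" "\<tau> \<in> carrier (Aut G)"
  shows "\<sigma> \<otimes>\<^bsub>Aut G\<^esub> \<tau> = compose (pverts G) \<sigma> \<tau>"
  using assms by (simp add: Aut_def BijGroup_def)

lemma one_Aut: "\<one>\<^bsub>Aut G\<^esub> = (\<lambda>x\<in>pverts G. x)"
  by (simp add: Aut_def BijGroup_def)

lemma Aut_in_verts: "\<sigma> \<in> carrier (Aut G) \<Longrightarrow> u \<in> pverts G \<Longrightarrow> \<sigma> u \<in> pverts G"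
  using Bij_imp_funcset by (fastforce simp: carrier_Aut)

lemma compose_Aut:
  assumes "\<sigma> \<in> carrier (Aut G)" "\<tau> \<in> carrier (Aut G)"
  shows "compose (pverts G) \<sigma> \<tau> \<in> carrier (Aut G)"
proof -
  have "\<tau> u \<in> pverts G" if "u \<in> pverts G" for u using assms that by (simp add: Aut_in_verts)
  then show ?thesis using assms compose_Bij by (auto simp: carrier_Aut compose_eq)
qed

lemma inv_Aut:
  assumes "\<sigma> \<in> carrier (Aut G)"
  shows "restrict (inv_into (pverts G) \<sigma>) (pverts G) \<in> carrier (Aut G)"
proof -
  let ?i = "inv_into (pverts G) \<sigma>"
  have B: "\<sigma> \<in> Bij (pverts G)" using assms by (simp add: carrier_Aut)
  have i: "?i u \<in> pverts G" "\<sigma> (?i u) = u" if "u \<in> pverts G" for u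
    using B that by (auto simp: Bij_def bij_betw_def inv_into_into f_inv_into_f)
  have "(\<sigma> u, \<sigma> v) \<in> parcs G \<longleftrightarrow> (u, v) \<in> parcs G" if "u \<in> pverts G" "v \<in> pverts G" for u v
    using assms that by (simp add: carrier_Aut)
  from this[OF i(1) i(1)] have "(?i u, ?i v) \<in> parcs G \<longleftrightarrow> (u, v) \<in> parcs G"
    if "u \<in> pverts G" "v \<in> pverts G" for u v
    using that by (simp add: i(2))
  then show ?thesis using restrict_inv_into_Bij[OF B] by (auto simp: carrier_Aut)
qed

lemma group_Aut: "group (Aut G)"
proof (rule groupI)
  show "x \<otimes>\<^bsub>Aut G\<^esub> y \<in> carrier (Aut G)" if "x \<in> carrier (Aut G)" "y \<in> carrier (Aut G)" for x y
    using that by (simp add: mult_Aut compose_Aut)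
  show one: "\<one>\<^bsub>Aut G\<^esub> \<in> carrier (Aut G)" by (auto simp: one_Aut carrier_Aut id_Bij)
  show "x \<otimes>\<^bsub>Aut G\<^esub> y \<otimes>\<^bsub>Aut G\<^esub> z = x \<otimes>\<^bsub>Aut G\<^esub> (y \<otimes>\<^bsub>Aut G\<^esub> z)"
    if "x \<in> carrier (Aut G)" "y \<in> carrier (Aut G)" "z \<in> carrier (Aut G)" for x y z
    using that by (simp add: mult_Aut compose_Aut)
      (metis (no_types, lifting) Aut_in_verts Pi_I compose_assoc)
  show "\<one>\<^bsub>Aut G\<^esub> \<otimes>\<^bsub>Aut G\<^esub> x = x" if "x \<in> carrier (Aut G)" for x
  proof -
    have "x \<in> pverts G \<rightarrow> pverts G" "x \<in> extensional (pverts G)"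
      using that by (auto simp: Aut_in_verts carrier_Aut Bij_def)
    then show ?thesis using mult_Aut[OF one that] by (simp add: one_Aut Id_compose)
  qed
  show "\<exists>y\<in>carrier (Aut G). y \<otimes>\<^bsub>Aut G\<^esub> x = \<one>\<^bsub>Aut G\<^esub>" if "x \<in> carrier (Aut G)" for x
    using that inv_Aut[OF that]
    by (intro bexI[OF _ inv_Aut[OF that]]) (simp add: mult_Aut one_Aut Bij_compose_restrict_eq carrier_Aut)
qed

lemma restrict_in_Aut:
  assumes "simple_graph G" "graph_hom f G G" "inj_on f (pverts G)"
  shows "restrict f (pverts G) \<in> carrier (Aut G)"
proof -
  interpret simple_graph G by fact
  have "f ` pverts G \<subseteq> pverts G" using graph_homD(1)[OF assms(2)] by auto
  then have "bij_betw f (pverts G) (pverts G)"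
    using assms(3) endo_inj_surj[OF finite_verts] by (auto simp: bij_betw_def)
  then have "restrict f (pverts G) \<in> Bij (pverts G)"
    by (simp add: Bij_def bij_betw_restrict_eq)
  then show ?thesis
    using graph_homD(2)[OF assms(2)] bijective_endo_reflects_arcs[OF assms] by (auto simp: carrier_Aut)
qed

lemma digraph_isoI:
  assumes "wf_digraph (with_proj G)" "inj_on f (pverts G)"
    and V: "pverts H = f ` pverts G" and A: "parcs H = map_prod f f ` parcs G"
  shows "digraph_iso (with_proj G) (with_proj H)"
proof -
  let ?h = "\<lparr>iso_verts = f, iso_arcs = map_prod f f, iso_head = snd, iso_tail = fst\<rparr>"
  have "parcs G \<subseteq> pverts G \<times> pverts G"
    using wf_digraph.tail_in_verts[OF assms(1)] wf_digraph.head_in_verts[OF assms(1)] by fastforce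
  then have "inj_on (map_prod f f) (parcs G)"
    using assms(2) by (intro inj_on_subset[OF map_prod_inj_on])
  then have "pre_digraph.digraph_isomorphism (with_proj G) ?h"
    using assms(1,2) by (auto simp: pre_digraph.digraph_isomorphism_def)
  moreover have "with_proj H = app_iso ?h (with_proj G)"
    by (simp add: with_proj_def app_iso_def V A)
  ultimately show ?thesis by (auto simp: digraph_iso_def)
qed

definition image_graph :: "('a \<Rightarrow> 'b) \<Rightarrow> 'a pair_pre_digraph \<Rightarrow> 'b pair_pre_digraph" where
  "image_graph f G = \<lparr>pverts = f ` pverts G, parcs = map_prod f f ` parcs G\<rparr>"

lemma image_graph_simps [simp]:
  "pverts (image_graph f G) = f ` pverts G" "parcs (image_graph f G) = map_prod f f ` parcs G"
  by (simp_all add: image_graph_def)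

lemma wf_image_graph:
  "wf_digraph (with_proj G) \<Longrightarrow> wf_digraph (with_proj (image_graph f G))"
  by (auto simp: wf_digraph_def)

lemma is_subgraphI:
  assumes "wf_digraph (with_proj G)" "wf_digraph (with_proj H)"
    and "inj_on f (pverts G)" "graph_hom f G H"
  shows "is_subgraph G H"
proof -
  have "subgraph (with_proj (image_graph f G)) (with_proj H)"
    using assms wf_image_graph[OF assms(1), of f] by (auto simp: subgraph_def dest: graph_homD)
  then show ?thesis unfolding is_subgraph_def
    using digraph_isoI[OF assms(1,3), of "image_graph f G"] by auto
qed

lemma is_induced_subgraphI:
  assumes "wf_digraph (with_proj G)" "wf_digraph (with_proj H)"
    and "inj_on f (pverts G)" "f ` pverts G \<subseteq> pverts H"
    and arcs: "\<And>u v. u \<in> pverts G \<Longrightarrow> v \<in> pverts G \<Longrightarrow> (u, v) \<in> parcs G \<longleftrightarrow> (f u, f v) \<in> parcs H"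
  shows "is_induced_subgraph G H"
proof -
  have sub: "u \<in> pverts G" "v \<in> pverts G" if "(u, v) \<in> parcs G" for u v
    using wf_digraph.tail_in_verts[OF assms(1)] wf_digraph.head_in_verts[OF assms(1)] that by fastforce+
  have "parcs (image_graph f G) = {e \<in> parcs H. fst e \<in> f ` pverts G \<and> snd e \<in> f ` pverts G}"
  proof (intro equalityI subsetI)
    fix e assume "e \<in> parcs (image_graph f G)"
    then obtain u v where uv: "(u, v) \<in> parcs G" "e = (f u, f v)" by auto
    with sub[OF uv(1)] arcs[of u v] show "e \<in> {e \<in> parcs H. fst e \<in> f ` pverts G \<and> snd e \<in> f ` pverts G}"
      by simp
  next
    fix e assume "e \<in> {e \<in> parcs H. fst e \<in> f ` pverts G \<and> snd e \<in> f ` pverts G}"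
    then obtain u v where uv: "u \<in> pverts G" "v \<in> pverts G" "e = (f u, f v)" "(f u, f v) \<in> parcs H"
      by (cases e) auto
    then have "(u, v) \<in> parcs G" using arcs[of u v] by simp
    then show "e \<in> parcs (image_graph f G)" using uv(3) by force
  qed
  moreover from this have "subgraph (with_proj (image_graph f G)) (with_proj H)"
    using assms wf_image_graph[OF assms(1), of f] by (auto simp: subgraph_def)
  ultimately have "induced_subgraph (with_proj (image_graph f G)) (with_proj H)"
    by (auto simp: induced_subgraph_def)
  then show ?thesis unfolding is_induced_subgraph_def
    using digraph_isoI[OF assms(1,3), of "image_graph f G"] by auto
qed

lemma wf_cayley_Z2: "wf_digraph (with_proj (cayley_graph (Z2_group n) C))"
  by (auto simp: wf_digraph_def parcs_cayley_graph_Z2_group)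

lemma wf_folded_cube: "wf_digraph (with_proj (folded_cube n))"
  unfolding folded_cube_def by (rule wf_cayley_Z2)

section \<open>Walks and two-colourings\<close>

lemma relpow_hom:
  assumes "\<And>u v. (u, v) \<in> R \<Longrightarrow> (f u, f v) \<in> S" "(u, v) \<in> R ^^ k"
  shows "(f u, f v) \<in> S ^^ k"
  using assms(2)
proof (induction k arbitrary: v)
  case (Suc k)
  then obtain w where "(u, w) \<in> R ^^ k" "(w, v) \<in> R" by auto
  then show ?case using Suc.IH assms(1) by (metis relpow_Suc_I)
qed simp

lemma relpow_sym:
  assumes "sym R" "(u, v) \<in> R ^^ k"
  shows "(v, u) \<in> R ^^ k"
  using assms(2)
proof (induction k arbitrary: v)
  case (Suc k)
  then obtain w where "(u, w) \<in> R ^^ k" "(w, v) \<in> R" by auto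
  then show ?case using Suc.IH assms(1) by (metis relpow_Suc_I2 symD)
qed simp

lemma relpow_trans: "(u, v) \<in> R ^^ k \<Longrightarrow> (v, w) \<in> R ^^ l \<Longrightarrow> (u, w) \<in> R ^^ (k + l)"
  by (auto simp: relpow_add)

text \<open>
  A vertex is coloured by the parity of the walks that lead to it from \<open>u\<close>. Two such walks of different
  parity would close up to an odd closed walk at \<open>u\<close>.
\<close>

lemma bipartition_by_parity:
  assumes sym: "sym R" and reach: "\<And>v. v \<in> V \<Longrightarrow> (u, v) \<in> R\<^sup>*" and sub: "R \<subseteq> V \<times> V"
    and no_odd: "\<And>k. odd k \<Longrightarrow> (u, u) \<notin> R ^^ k"
  shows "\<exists>c :: 'a \<Rightarrow> bool. \<forall>(v, w)\<in>R. c v \<noteq> c w"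
proof (intro exI ballI, clarify)
  let ?c = "\<lambda>v. \<exists>k. even k \<and> (u, v) \<in> R ^^ k"
  fix v w assume vw: "(v, w) \<in> R"
  then obtain k where k: "(u, v) \<in> R ^^ k" using sub reach rtrancl_imp_relpow by blast
  then have kw: "(u, w) \<in> R ^^ Suc k" using vw by auto
  have parity: "even l \<longleftrightarrow> even m" if "(u, x) \<in> R ^^ l" "(u, x) \<in> R ^^ m" for x l m
    using relpow_trans[OF that(1) relpow_sym[OF sym that(2)]] no_odd[of "l + m"] by auto
  have "?c v \<longleftrightarrow> even k" "?c w \<longleftrightarrow> even (Suc k)" using k kw parity by blast+
  moreover assume "?c v \<longleftrightarrow> ?c w"
  ultimately show False by simp
qed

lemma finite_cliques: "finite (pverts G) \<Longrightarrow> finite {S. is_clique G S}"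
  by (rule finite_subset[of _ "Pow (pverts G)"]) (auto simp: is_clique_def)

lemma finite_independents: "finite (pverts G) \<Longrightarrow> finite {S. is_independent G S}"
  by (rule finite_subset[of _ "Pow (pverts G)"]) (auto simp: is_independent_def)

lemma maximum_clique:
  assumes "finite (pverts G)"
  obtains S where "is_clique G S" "card S = clique_number G"
proof -
  have "is_clique G {}" by (simp add: is_clique_def)
  then have "clique_number G \<in> card ` {S. is_clique G S}"
    unfolding clique_number_def using finite_cliques[OF assms] by (intro Max_in) auto
  then show ?thesis using that by auto
qed

lemma card_le_clique_number:
  "finite (pverts G) \<Longrightarrow> is_clique G S \<Longrightarrow> card S \<le> clique_number G"
  unfolding clique_number_def using finite_cliques by (intro Max_ge) auto

lemma maximum_independent:
  assumes "finite (pverts G)"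
  obtains S where "is_independent G S" "card S = independence_number G"
proof -
  have "is_independent G {}" by (simp add: is_independent_def)
  then have "independence_number G \<in> card ` {S. is_independent G S}"
    unfolding independence_number_def using finite_independents[OF assms] by (intro Max_in) auto
  then show ?thesis using that by auto
qed

text \<open>
  The composition \<open>K \<rightarrow> Y \<rightarrow> C \<rightarrow> K\<close> is an endomorphism of a core, hence onto. So all vertices of \<open>K\<close>
  are images of vertices of the clique \<open>C\<close>, and distinct vertices of a clique are adjacent.
\<close>

lemma core_complete_if_hom_to_clique:
  assumes hom: "graph_hom f Y Y" and clique: "is_clique Y C" and img: "f ` pverts Y \<subseteq> C"
    and core: "core_of K Y"
  shows "\<exists>n. complete_digraph n (with_proj K)"
proof -
  have "simple_graph K" and K: "is_core K" and "homomorphic K Y" "homomorphic Y K"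
    using core by (simp_all add: core_of_def hom_equivalent_def simple_graphI)
  then interpret K: simple_graph K by simp
  from \<open>homomorphic K Y\<close> obtain a where a: "graph_hom a K Y" unfolding homomorphic_def ..
  from \<open>homomorphic Y K\<close> obtain b where b: "graph_hom b Y K" unfolding homomorphic_def ..
  let ?e = "\<lambda>x. b (f (a x))"
  have "graph_hom ?e K K" by (intro graph_hom_comp[OF graph_hom_comp[OF a hom] b])
  with K have "bij_betw ?e (pverts K) (pverts K)" unfolding is_core_def by blast
  then have surj: "?e ` pverts K = pverts K" by (rule bij_betw_imp_surj_on)
  have "(x, y) \<in> parcs K" if xy: "x \<in> pverts K" "y \<in> pverts K" "x \<noteq> y" for x y
  proof -
    from xy(1,2) have "x \<in> ?e ` pverts K" "y \<in> ?e ` pverts K" by (simp_all only: surj)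
    then obtain x' y' where x': "x' \<in> pverts K" "x = ?e x'" and y': "y' \<in> pverts K" "y = ?e y'"
      by (elim imageE)
    have "f (a x') \<in> C" "f (a y') \<in> C"
      using img graph_homD(1)[OF a x'(1)] graph_homD(1)[OF a y'(1)] by blast+
    moreover have "f (a x') \<noteq> f (a y')" using xy(3) x'(2) y'(2) by metis
    ultimately have "(f (a x'), f (a y')) \<in> parcs Y" using clique by (simp add: is_clique_def)
    from graph_homD(2)[OF b this] show ?thesis using x'(2) y'(2) by metis
  qed
  moreover have "x \<in> pverts K" "y \<in> pverts K" "x \<noteq> y" if "(x, y) \<in> parcs K" for x y
    using K.arc_verts[OF that] K.no_loop that by auto
  ultimately have "parcs K = {(u, v). (u, v) \<in> pverts K \<times> pverts K \<and> u \<noteq> v}" by blast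
  then show ?thesis by (simp add: complete_digraph_pair_def K.finite_verts)
qed

section \<open>Retracts of Cayley graphs of elementary abelian 2-groups\<close>

text \<open>
  Every translation of the group, restricted to \<open>Y\<close> and composed with the retraction, is required to
  be an automorphism of \<open>Y\<close>; as \<open>Y\<close> is finite, an injective endomorphism is one. For the core of
  a cubelike graph this is the core property. Unlike the core property, it passes to orbital graphs and
  to connected components.
\<close>

locale cubelike_retract = simple_graph Y
  for Y :: "'a pair_pre_digraph" +
  fixes emb :: "'a \<Rightarrow> 'v::ab_group_add" and retr :: "'v \<Rightarrow> 'a"
  assumes char2: "(x :: 'v) + x = 0"
    and retr_in_verts: "retr z \<in> pverts Y"
    and retr_emb: "y \<in> pverts Y \<Longrightarrow> retr (emb y) = y"
    and retr_arc: "(u, v) \<in> parcs Y \<Longrightarrow> (retr (z + emb u), retr (z + emb v)) \<in> parcs Y"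
    and retr_inj: "inj_on (\<lambda>u. retr (z + emb u)) (pverts Y)"
begin

lemma char2_cancel: "x + (x + y) = y" "x + (y + x) = y" for x y :: 'v
proof -
  show *: "x + (x + y) = y" by (simp only: add.assoc[symmetric] char2 add_0)
  show "x + (y + x) = y" by (subst add.commute[of y]) (rule *)
qed

abbreviation translate :: "'v \<Rightarrow> 'a \<Rightarrow> 'a" where
  "translate z u \<equiv> retr (z + emb u)"

lemma graph_hom_translate: "graph_hom (translate z) Y Y"
  by (intro graph_homI retr_in_verts retr_arc)

lemma translate_in_Aut: "restrict (translate z) (pverts Y) \<in> carrier (Aut Y)"
  by (intro restrict_in_Aut graph_hom_translate retr_inj simple_graph_axioms)

lemma translate_surj: "translate z ` pverts Y = pverts Y"
  using retr_inj retr_in_verts by (intro endo_inj_surj finite_verts) auto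

lemma translate_reflects_arcs:
  assumes "u \<in> pverts Y" "v \<in> pverts Y" "(translate z u, translate z v) \<in> parcs Y"
  shows "(u, v) \<in> parcs Y"
  using bijective_endo_reflects_arcs[OF simple_graph_axioms graph_hom_translate retr_inj assms] .

text \<open>
  In characteristic 2, adding \<open>emb u + emb v\<close> exchanges \<open>emb u\<close> and \<open>emb v\<close>.
\<close>

lemma translate_swap:
  assumes "u \<in> pverts Y" "v \<in> pverts Y"
  shows "translate (emb u + emb v) u = v" "translate (emb u + emb v) v = u"
proof -
  have *: "emb u + emb v + emb u = emb v" "emb u + emb v + emb v = emb u"
    by (simp_all add: add.assoc char2_cancel char2)
  show "translate (emb u + emb v) u = v" "translate (emb u + emb v) v = u"
    by (simp_all only: * retr_emb assms)
qed

lemma generously_transitive: "generously_transitive Y"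
  unfolding generously_transitive_def
proof (intro ballI)
  fix u v assume uv: "u \<in> pverts Y" "v \<in> pverts Y"
  then show "\<exists>\<sigma>\<in>carrier (Aut Y). \<sigma> u = v \<and> \<sigma> v = u"
    by (intro bexI[OF _ translate_in_Aut[of "emb u + emb v"]]) (simp add: translate_swap)
qed

subsection \<open>The connection set\<close>

text \<open>
  For the Cayley graph of the group with this connection set, both \<open>emb\<close> and \<open>retr\<close> are homomorphisms.
\<close>

definition conn :: "'v set" where
  "conn = {emb u + emb v | u v. (u, v) \<in> parcs Y}"

lemma connI: "(u, v) \<in> parcs Y \<Longrightarrow> emb u + emb v \<in> conn"
  by (auto simp: conn_def)

lemma retr_conn:
  assumes "c \<in> conn"
  shows "(retr z, retr (z + c)) \<in> parcs Y"
proof -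
  obtain u v where c: "c = emb u + emb v" and uv: "(u, v) \<in> parcs Y" using assms by (auto simp: conn_def)
  \<comment> \<open>The two vertices are the images of \<open>u\<close> and \<open>v\<close> under the translation by \<open>z + emb u\<close>.\<close>
  have "z + emb u + emb u = z" by (simp add: add.assoc char2)
  then show ?thesis using retr_arc[OF uv, of "z + emb u"] by (simp add: c add.assoc)
qed

text \<open>
  The connection vectors along a walk; the intermediate vectors \<open>emb w\<close> cancel in their sum.
\<close>

lemma walk_of_conn_list:
  assumes "(u, v) \<in> parcs Y ^^ k"
  obtains xs where "length xs = k" "set xs \<subseteq> conn" "sum_list xs = emb u + emb v"
  using assms
proof (induction k arbitrary: v thesis)
  case 0
  then show ?case using char2 by force
next
  case (Suc k)
  then obtain w where w: "(u, w) \<in> parcs Y ^^ k" "(w, v) \<in> parcs Y" by auto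
  with Suc.IH obtain xs where xs: "length xs = k" "set xs \<subseteq> conn" "sum_list xs = emb u + emb w"
    by blast
  have "sum_list ((emb w + emb v) # xs) = emb u + emb v"
    by (simp add: xs(3) add_ac char2_cancel char2)
  moreover have "set ((emb w + emb v) # xs) \<subseteq> conn" using xs(2) w(2) by (simp add: connI)
  ultimately show ?case using Suc.prems(1) xs(1) by (metis length_Cons)
qed

text \<open>
  A map \<open>g\<close> on basis vectors, extended linearly and followed by \<open>retr\<close>, respects an edge as soon as
  \<open>g\<close> sends the difference of its ends to a connection vector.
\<close>

lemma arc_between_retr_sums:
  assumes "(u, v) \<in> parcs Y" "finite A" "finite B" "sum g (sym_diff A B) = emb u + emb v"
  shows "(retr (sum g A), retr (sum g B)) \<in> parcs Y"
proof -
  have "sum g B = sum g A + (sum g A + sum g B)" by (simp add: char2_cancel)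
  also have "sum g A + sum g B = emb u + emb v"
    using sum_sym_diff[OF char2 assms(2,3), where f = g] assms(4) by simp
  finally show ?thesis using retr_conn[OF connI[OF assms(1)], of "sum g A"] by simp
qed

text \<open>
  Linear extension of \<open>emb \<circ> f\<close>, followed by the retraction.
\<close>

lemma hom_cubelike_hull:
  assumes W: "pair_graph W" and f: "graph_hom f W Y"
  shows "homomorphic (cubelike_hull W) Y"
proof -
  interpret W: simple_graph W using W by (rule simple_graphI)
  let ?S = "\<lambda>x. {w \<in> pverts W. x w \<noteq> (0 :: bit)}"
  let ?h = "\<lambda>x. retr (\<Sum>w\<in>?S x. emb (f w))"
  have "graph_hom ?h (cubelike_hull W) Y"
  proof (rule graph_homI)
    fix x y assume "(x, y) \<in> parcs (cubelike_hull W)"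
    then obtain u v where uv: "(u, v) \<in> parcs W"
      and xy: "\<And>w. x w + y w = std_basis u w + std_basis v w"
      by (auto simp: cubelike_hull_def)
    have "u \<noteq> v" using W.no_loop uv by auto
    have [simp]: "a + b = 0 \<longleftrightarrow> a = b" for a b :: bit by (cases a; cases b) auto
    have *: "(x w \<noteq> 0) \<noteq> (y w \<noteq> 0) \<longleftrightarrow> w = u \<or> w = v" for w
      using xy[of w] \<open>u \<noteq> v\<close> by (cases "x w"; cases "y w") (auto simp: std_basis_def split: if_splits)
    have "sym_diff (?S x) (?S y) = {w \<in> pverts W. (x w \<noteq> 0) \<noteq> (y w \<noteq> 0)}" by blast
    also have "\<dots> = {u, v}" unfolding * using W.arc_verts[OF uv] by blast
    finally have "sym_diff (?S x) (?S y) = {u, v}" .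
    then show "(?h x, ?h y) \<in> parcs Y"
      using graph_homD(2)[OF f uv] \<open>u \<noteq> v\<close> W.finite_verts
      by (intro arc_between_retr_sums[of "f u" "f v"]) auto
  qed (simp add: retr_in_verts)
  then show ?thesis by (auto simp: homomorphic_def)
qed

text \<open>
  The witness is the space spanned by the vertices of \<open>Y\<close>, with the connection vectors \<open>e\<^sub>u + e\<^sub>v\<close> for
  the edges \<open>uv\<close>. Sending \<open>u\<close> to \<open>e\<^sub>u\<close> is a homomorphism, and linear extension of \<open>emb\<close> leads back.
\<close>

lemma cubelike_equivalent: "\<exists>Z. cubelike Z \<and> hom_equivalent Y Z"
proof -
  let ?m = "card (pverts Y)"
  obtain ix where ix: "bij_betw ix (pverts Y) {..<?m}"
    using ex_bij_betw_finite_nat[OF finite_verts] by (auto simp: atLeast0LessThan)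
  let ?e = "\<lambda>u. unit_vec ?m (ix u) :: bit vec"
  let ?C = "{?e u + ?e v | u v. (u, v) \<in> parcs Y}"
  let ?Z = "cayley_graph (Z2_group ?m) ?C"
  have lt: "ix u < ?m" if "u \<in> pverts Y" for u using ix that by (auto simp: bij_betw_def)
  have supp_e: "supp (?e u) = {ix u}" if "u \<in> pverts Y" for u using lt[OF that] by (rule supp_unit_vec)
  have ix_eq: "ix u = ix v \<longleftrightarrow> u = v" if "u \<in> pverts Y" "v \<in> pverts Y" for u v
    using ix that by (auto simp: bij_betw_def inj_on_def)
  have suppC: "supp (?e u + ?e v) = {ix u, ix v}" if "(u, v) \<in> parcs Y" for u v
    using that arc_verts no_loop by (subst supp_add[where n = ?m]) (auto simp: supp_e ix_eq)
  have "0\<^sub>v ?m \<notin> ?C"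
  proof
    assume "0\<^sub>v ?m \<in> ?C"
    then obtain u v where uv: "(u, v) \<in> parcs Y" "0\<^sub>v ?m = ?e u + ?e v" by auto
    moreover have "supp (0\<^sub>v ?m) = {}" by (auto simp: supp_def)
    ultimately show False using suppC[OF uv(1)] by simp
  qed
  then have "cubelike ?Z"
    unfolding cubelike_def by (intro exI[of _ ?m] exI[of _ ?C]) (auto simp: monoid_vec_simps)
  moreover have "graph_hom ?e Y ?Z"
    using arc_verts by (intro graph_homI) (auto simp: parcs_cayley_graph_Z2_group)
  moreover have "graph_hom (\<lambda>x. retr (\<Sum>j\<in>supp x. emb (inv_into (pverts Y) ix j))) ?Z Y"
  proof (rule graph_homI)
    fix x y assume "(x, y) \<in> parcs ?Z"
    then obtain u v where xy: "x \<in> carrier_vec ?m" "y \<in> carrier_vec ?m" "x + y = ?e u + ?e v"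
      and uv: "(u, v) \<in> parcs Y" by (auto simp: parcs_cayley_graph_Z2_group)
    have V: "u \<in> pverts Y" "v \<in> pverts Y" "u \<noteq> v" using uv arc_verts no_loop by auto
    have "sym_diff (supp x) (supp y) = {ix u, ix v}"
      using supp_add[OF xy(1,2)] xy(3) suppC[OF uv] by simp
    moreover have "inv_into (pverts Y) ix (ix w) = w" if "w \<in> pverts Y" for w
      using ix that by (auto simp: bij_betw_def)
    ultimately show "(retr (\<Sum>j\<in>supp x. emb (inv_into (pverts Y) ix j)),
        retr (\<Sum>j\<in>supp y. emb (inv_into (pverts Y) ix j))) \<in> parcs Y"
      using V ix_eq[of u v] by (intro arc_between_retr_sums[OF uv]) auto
  qed (simp add: retr_in_verts)
  ultimately show ?thesis by (auto simp: hom_equivalent_def homomorphic_def)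
qed

text \<open>
  A triangle \<open>abc\<close> extends by the vertex \<open>retr (emb a + emb b + emb c)\<close>: in the group, its vector differs
  from that of each corner by the connection vector of the opposite edge.
\<close>

lemma clique_number_neq_3: "clique_number Y \<noteq> 3"
proof
  assume "clique_number Y = 3"
  then obtain S where S: "is_clique Y S" "card S = 3"
    using maximum_clique[OF finite_verts] by metis
  then obtain a b c where abc: "S = {a, b, c}" "a \<noteq> b" "b \<noteq> c" "a \<noteq> c"
    by (auto simp: card_3_iff)
  have V: "a \<in> pverts Y" "b \<in> pverts Y" "c \<in> pverts Y"
    and E: "(a, b) \<in> parcs Y" "(b, c) \<in> parcs Y" "(a, c) \<in> parcs Y"
    using S(1) abc by (auto simp: is_clique_def)
  define q where "q = retr (emb a + emb b + emb c)"
  have qa: "(a, q) \<in> parcs Y"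
    using retr_conn[OF connI[OF E(2)], of "emb a"] V by (simp add: q_def retr_emb add_ac)
  have qb: "(b, q) \<in> parcs Y"
    using retr_conn[OF connI[OF E(3)], of "emb b"] V by (simp add: q_def retr_emb add_ac)
  have qc: "(c, q) \<in> parcs Y"
    using retr_conn[OF connI[OF E(1)], of "emb c"] V by (simp add: q_def retr_emb add_ac)
  have "q \<noteq> a" "q \<noteq> b" "q \<noteq> c" using qa qb qc no_loop by auto
  then have "card {a, b, c, q} = 4" using abc by auto
  moreover have "is_clique Y {a, b, c, q}"
    using V E qa qb qc by (auto simp: is_clique_def q_def retr_in_verts intro: arcs_sym)
  ultimately show False
    using card_le_clique_number[OF finite_verts] \<open>clique_number Y = 3\<close> by fastforce
qed

text \<open>
  The map \<open>(u, v) \<mapsto> retr (emb u + emb v)\<close> is a translation in each of its two arguments.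
\<close>

lemma hom_idempotent: "hom_idempotent Y"
proof -
  have "graph_hom (\<lambda>(u, v). retr (emb u + emb v)) (cartesian_product Y Y) Y"
  proof (rule graph_homI)
    fix p q assume pq: "(p, q) \<in> parcs (cartesian_product Y Y)"
    obtain u x v y where p: "p = (u, x)" and q: "q = (v, y)" by (cases p; cases q)
    have "(retr (emb u + emb x), retr (emb v + emb y)) \<in> parcs Y"
      if "u = v \<and> (x, y) \<in> parcs Y \<or> (u, v) \<in> parcs Y \<and> x = y"
      using that
    proof
      assume "u = v \<and> (x, y) \<in> parcs Y"
      then show ?thesis using retr_arc[of x y "emb u"] by simp
    next
      assume *: "(u, v) \<in> parcs Y \<and> x = y"
      then have "(retr (emb x + emb u), retr (emb x + emb v)) \<in> parcs Y" by (intro retr_arc) simp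
      then show ?thesis using * by (simp add: add.commute)
    qed
    then show "(case p of (u, v) \<Rightarrow> retr (emb u + emb v), case q of (u, v) \<Rightarrow> retr (emb u + emb v)) \<in> parcs Y"
      using pq by (auto simp: p q cartesian_product_def)
  qed (auto simp: retr_in_verts)
  then show ?thesis unfolding hom_idempotent_def homomorphic_def by blast
qed

text \<open>
  A vertex \<open>y\<close> is sent to the translation by \<open>emb y\<close>. By commutativity, the translations of two
  adjacent vertices move every vertex to adjacent vertices, so that they differ by a shift.
\<close>

lemma subgraph_shift_graph: "is_subgraph Y (shift_graph Y)"
proof -
  let ?s = "\<lambda>y. restrict (translate (emb y)) (pverts Y)"
  have inj: "inj_on ?s (pverts Y)"
  proof (rule inj_onI)
    fix u v assume uv: "u \<in> pverts Y" "v \<in> pverts Y" "?s u = ?s v"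
    then have "translate (emb u) u = translate (emb v) u" by (metis restrict_apply')
    then have "translate (emb u) u = translate (emb u) v" by (simp add: add.commute)
    then show "u = v" using inj_onD[OF retr_inj] uv by blast
  qed
  have "graph_hom ?s Y (shift_graph Y)"
  proof (rule graph_homI)
    fix u v assume uv: "(u, v) \<in> parcs Y"
    let ?i = "inv\<^bsub>Aut Y\<^esub> (?s u)"
    have i: "?i \<in> carrier (Aut Y)"
      using group.inv_closed[OF group_Aut translate_in_Aut] .
    have m: "?s v \<otimes>\<^bsub>Aut Y\<^esub> ?i \<in> carrier (Aut Y)"
      using i translate_in_Aut by (simp add: mult_Aut compose_Aut)
    have "((?s v \<otimes>\<^bsub>Aut Y\<^esub> ?i) x, x) \<in> parcs Y" if x: "x \<in> pverts Y" for x
    proof -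
      have y: "?i x \<in> pverts Y" using i x by (simp add: Aut_in_verts)
      have "?s u \<otimes>\<^bsub>Aut Y\<^esub> ?i = \<one>\<^bsub>Aut Y\<^esub>"
        using group.r_inv[OF group_Aut translate_in_Aut] .
      then have "?s u (?i x) = x"
        using x i translate_in_Aut by (simp add: mult_Aut one_Aut compose_def fun_eq_iff) metis
      then have "translate (emb u) (?i x) = x" using y by simp
      moreover have "(?s v \<otimes>\<^bsub>Aut Y\<^esub> ?i) x = translate (emb v) (?i x)"
        using i x y translate_in_Aut by (simp add: mult_Aut compose_eq)
      moreover have "(translate (emb v) (?i x), translate (emb u) (?i x)) \<in> parcs Y"
        using retr_arc[OF arcs_sym[OF uv], of "emb (?i x)"] by (simp add: add.commute)
      ultimately show ?thesis by simp
    qed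
    then show "(?s u, ?s v) \<in> parcs (shift_graph Y)"
      using m translate_in_Aut by (simp add: shift_graph_def cayley_graph_def shifts_def)
  qed (use translate_in_Aut in \<open>simp add: shift_graph_def cayley_graph_def\<close>)
  moreover have "wf_digraph (with_proj (shift_graph Y))"
    by (auto simp: wf_digraph_def shift_graph_def cayley_graph_def)
  ultimately show ?thesis
    using inj by (intro is_subgraphI) (auto intro: wf)
qed

text \<open>
  Let \<open>C\<close> be a maximum clique and \<open>S\<close> a maximum independent set, and count the pairs \<open>(y, k)\<close> with
  \<open>k \<in> C\<close> and \<open>translate (emb y) k \<in> S\<close>. Each \<open>y\<close> occurs at most once, because a translate of \<open>C\<close>
  is a clique; each \<open>k\<close> occurs \<open>card S\<close> times, because \<open>translate (emb y) k = translate (emb k) y\<close>.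
  By hypothesis the total is \<open>card (pverts Y)\<close>, so each \<open>y\<close> occurs exactly once. The resulting
  map \<open>y \<mapsto> k\<close> is a homomorphism: neighbours with the same \<open>k\<close> would give adjacent vertices of \<open>S\<close>.
\<close>

lemma hom_to_maximum_clique:
  assumes "independence_number Y * clique_number Y = card (pverts Y)"
  obtains f C where "graph_hom f Y Y" "is_clique Y C" "f ` pverts Y \<subseteq> C"
proof -
  obtain S where S: "is_independent Y S" "card S = independence_number Y"
    using maximum_independent[OF finite_verts] .
  obtain C where C: "is_clique Y C" "card C = clique_number Y"
    using maximum_clique[OF finite_verts] .
  have CV: "C \<subseteq> pverts Y" and SV: "S \<subseteq> pverts Y"
    using S C by (auto simp: is_clique_def is_independent_def)
  have finC: "finite C" using CV finite_verts finite_subset by blast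
  let ?H = "\<lambda>y. {k \<in> C. translate (emb y) k \<in> S}"
  have le1: "card (?H y) \<le> 1" for y
  proof -
    have "k = l" if "k \<in> ?H y" "l \<in> ?H y" for k l
    proof (rule ccontr)
      assume "k \<noteq> l"
      then have "(k, l) \<in> parcs Y" using that C(1) by (simp add: is_clique_def)
      from retr_arc[OF this, of "emb y"] show False using that S(1) by (simp add: is_independent_def)
    qed
    moreover have "finite (?H y)" using finC by simp
    ultimately show ?thesis unfolding One_nat_def by (intro card_le_Suc0_iff_eq[THEN iffD2] ballI)
  qed
  have col: "card {y \<in> pverts Y. translate (emb y) k \<in> S} = card S" if "k \<in> C" for k
  proof -
    have "{y \<in> pverts Y. translate (emb y) k \<in> S} = {y \<in> pverts Y. translate (emb k) y \<in> S}"
      by (simp add: add.commute)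
    moreover have "translate (emb k) ` {y \<in> pverts Y. translate (emb k) y \<in> S} = S"
    proof
      show "S \<subseteq> translate (emb k) ` {y \<in> pverts Y. translate (emb k) y \<in> S}"
      proof
        fix s assume s: "s \<in> S"
        then have "s \<in> translate (emb k) ` pverts Y" using SV translate_surj by blast
        then obtain y where "y \<in> pverts Y" "s = translate (emb k) y" by (elim imageE)
        then show "s \<in> translate (emb k) ` {y \<in> pverts Y. translate (emb k) y \<in> S}" using s by blast
      qed
    qed blast
    moreover have "inj_on (translate (emb k)) {y \<in> pverts Y. translate (emb k) y \<in> S}"
      using retr_inj by (rule inj_on_subset) blast
    ultimately show ?thesis
      using card_image[of "translate (emb k)" "{y \<in> pverts Y. translate (emb k) y \<in> S}"] by simp
  qed
  have "(\<Sum>y\<in>pverts Y. card (?H y)) = card S * card C"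
    using col by (intro sum_multicount finite_verts finC) blast
  also have "\<dots> = card (pverts Y)" using assms C(2) S(2) by simp
  finally have total: "(\<Sum>y\<in>pverts Y. card (?H y)) = (\<Sum>y\<in>pverts Y. 1)" by simp
  have "\<exists>k. k \<in> ?H y" if "y \<in> pverts Y" for y
  proof (rule ccontr)
    assume "\<nexists>k. k \<in> ?H y"
    then have "?H y = {}" by blast
    then have "card (?H y) < 1" by (simp only: card.empty zero_less_one)
    then have "(\<Sum>y\<in>pverts Y. card (?H y)) < (\<Sum>y\<in>pverts Y. 1)"
      using that by (intro sum_strict_mono_ex1 finite_verts ballI le1 bexI[of _ y])
    with total show False by (metis less_irrefl)
  qed
  then have "\<forall>y\<in>pverts Y. \<exists>k. k \<in> ?H y" by blast
  from bchoice[OF this] obtain f where f: "\<forall>y\<in>pverts Y. f y \<in> ?H y" ..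
  have hom: "graph_hom f Y Y"
  proof (rule graph_homI)
    show "f u \<in> pverts Y" if "u \<in> pverts Y" for u using bspec[OF f that] CV by blast
    fix u v assume uv: "(u, v) \<in> parcs Y"
    then have V: "u \<in> pverts Y" "v \<in> pverts Y" using arc_verts by simp_all
    note fu = bspec[OF f V(1)] and fv = bspec[OF f V(2)]
    have "f u \<noteq> f v"
    proof
      assume eq: "f u = f v"
      have "(translate (emb u) (f u), translate (emb v) (f u)) \<in> parcs Y"
        using retr_arc[OF uv, of "emb (f u)"] by (simp add: add.commute)
      then show False using fu fv eq S(1) by (simp add: is_independent_def)
    qed
    then show "(f u, f v) \<in> parcs Y" using fu fv C(1) by (simp add: is_clique_def)
  qed
  have "f ` pverts Y \<subseteq> C"
  proof
    fix x assume "x \<in> f ` pverts Y"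
    then obtain y where "y \<in> pverts Y" "x = f y" by (elim imageE)
    then show "x \<in> C" using bspec[OF f] by simp
  qed
  with hom C(1) show ?thesis by (rule that)
qed

end

section \<open>Three-colourings and odd closed walks\<close>

text \<open>
  The difference \<open>b - a\<close> modulo 3, lifted to \<open>1\<close> or \<open>- 1\<close>, for distinct colours \<open>a\<close> and \<open>b\<close> below 3.
\<close>

definition colour_step :: "nat \<Rightarrow> nat \<Rightarrow> int" where
  "colour_step a b = (if (a, b) \<in> {(0, 1), (1, 2), (2, 0)} then 1 else - 1)"

lemma less_3_cases:
  assumes "(a :: nat) < 3"
  obtains "a = 0" | "a = 1" | "a = 2"
  using assms by linarith

lemma colour_step_antisym:
  assumes "a < 3" "b < 3" "a \<noteq> b"
  shows "colour_step b a = - colour_step a b"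
  by (rule less_3_cases[OF assms(1)]; rule less_3_cases[OF assms(2)])
    (use assms(3) in \<open>simp_all add: colour_step_def\<close>)

text \<open>
  Around a square the lifts add up to a multiple of 3 that is even and at most 4 in absolute
  value, hence to zero.
\<close>

lemma colour_step_square:
  assumes "a < 3" "b < 3" "c < 3" "d < 3" "a \<noteq> b" "b \<noteq> c" "c \<noteq> d" "d \<noteq> a"
  shows "colour_step a b + colour_step b c = colour_step a d + colour_step d c"
  by (rule less_3_cases[OF assms(1)]; rule less_3_cases[OF assms(2)];
      rule less_3_cases[OF assms(3)]; rule less_3_cases[OF assms(4)])
    (use assms(5-8) in \<open>simp_all add: colour_step_def\<close>)

context cubelike_retract begin

context
  fixes col :: "'a \<Rightarrow> nat"
  assumes col_less: "\<And>u. u \<in> pverts Y \<Longrightarrow> col u < 3"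
    and col_neq: "\<And>u v. (u, v) \<in> parcs Y \<Longrightarrow> col u \<noteq> col v"
begin

definition step :: "'v \<Rightarrow> 'v \<Rightarrow> int" where
  "step z c = colour_step (col (retr z)) (col (retr (z + c)))"

text \<open>
  The total colour change along the walk that starts at \<open>z\<close> and uses the listed connection
  vectors as its steps.
\<close>

primrec winding :: "'v \<Rightarrow> 'v list \<Rightarrow> int" where
  "winding z [] = 0"
| "winding z (c # cs) = step z c + winding (z + c) cs"

lemma retr_col: "col (retr z) < 3"
  using col_less retr_in_verts by simp

lemma conn_col: "c \<in> conn \<Longrightarrow> col (retr z) \<noteq> col (retr (z + c))"
  using col_neq[OF retr_conn] .

lemma step_back:
  assumes "c \<in> conn"
  shows "step (z + c) c = - step z c"
proof -
  have "z + c + c = z" by (simp add: add.assoc char2)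
  then show ?thesis
    unfolding step_def using colour_step_antisym[OF retr_col retr_col conn_col[OF assms]] by (simp only:)
qed

lemma step_square:
  assumes "c \<in> conn" "c' \<in> conn"
  shows "step z c + step (z + c) c' = step z c' + step (z + c') c"
proof -
  have eq: "z + c' + c = z + c + c'" by (simp add: add_ac)
  have "col (retr (z + c + c')) \<noteq> col (retr (z + c'))"
    using conn_col[OF assms(1), of "z + c'"] unfolding eq by (rule not_sym)
  moreover have "col (retr (z + c')) \<noteq> col (retr z)"
    using conn_col[OF assms(2)] by (rule not_sym)
  ultimately show ?thesis
    unfolding step_def eq
    by (intro colour_step_square[OF retr_col retr_col retr_col retr_col conn_col conn_col] assms)
qed

lemma winding_append: "winding z (xs @ ys) = winding z xs + winding (z + sum_list xs) ys"
  by (induction xs arbitrary: z) (simp_all add: add.assoc)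

text \<open>
  A walk and its translate by \<open>c\<close> bound a ladder of squares, each of which contributes zero.
\<close>

lemma winding_ladder:
  assumes "c \<in> conn" "set xs \<subseteq> conn"
  shows "step z c + winding (z + c) xs = winding z xs + step (z + sum_list xs) c"
  using assms(2)
proof (induction xs arbitrary: z)
  case (Cons x xs)
  then have x: "x \<in> conn" and xs: "set xs \<subseteq> conn" by simp_all
  have "step z c + winding (z + c) (x # xs) = (step z c + step (z + c) x) + winding (z + c + x) xs"
    by simp
  also have "\<dots> = step z x + (step (z + x) c + winding (z + x + c) xs)"
    using step_square[OF assms(1) x, of z] by (simp add: add.assoc add.commute[of c x])
  also have "\<dots> = winding z (x # xs) + step (z + sum_list (x # xs)) c"
    using Cons.IH[OF xs, of "z + x"] by (simp add: add.assoc)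
  finally show ?case .
qed simp

text \<open>
  Moving the first step to the end of a walk is a special case of the ladder. By induction, the
  steps can be taken in the reverse order.
\<close>

lemma winding_rotate1:
  assumes "c \<in> conn" "set xs \<subseteq> conn"
  shows "winding z (c # xs) = winding z (xs @ [c])"
  using winding_ladder[OF assms] by (simp add: winding_append)

lemma winding_rev:
  assumes "set xs \<subseteq> conn"
  shows "winding z (rev xs) = winding z xs"
  using assms
proof (induction xs arbitrary: z)
  case (Cons c xs)
  then have c: "c \<in> conn" and xs: "set xs \<subseteq> conn" by simp_all
  have "winding z (rev (c # xs)) = winding z (c # rev xs)"
    using winding_rotate1[OF c, of "rev xs" z] xs by simp
  then show ?case using Cons.IH[OF xs] by simp
qed simp

text \<open>
  Every vector is its own inverse, so the steps in reverse order lead back along the same walk.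
\<close>

lemma winding_backwards:
  assumes "set xs \<subseteq> conn"
  shows "winding (z + sum_list xs) (rev xs) = - winding z xs"
  using assms
proof (induction xs arbitrary: z)
  case (Cons c xs)
  then have c: "c \<in> conn" and xs: "set xs \<subseteq> conn" by simp_all
  have "z + (c + sum_list xs) + sum_list xs = z + c" by (simp add: add.assoc char2)
  then have "winding (z + sum_list (c # xs)) (rev (c # xs))
      = winding (z + c + sum_list xs) (rev xs) + step (z + c) c"
    by (simp add: winding_append add.assoc)
  then show ?case using Cons.IH[OF xs, of "z + c"] step_back[OF c, of z] by simp
qed simp

lemma even_winding: "even (winding z xs) \<longleftrightarrow> even (length xs)"
  by (induction xs arbitrary: z) (auto simp: step_def colour_step_def)

text \<open>
  For a closed walk, the steps in reverse order start where the walk starts. The winding number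
  is therefore both preserved and negated by the reversal, so it is zero. But its parity is that of the
  length.
\<close>

lemma no_odd_closed_walk_if_3_colouring:
  assumes "odd k"
  shows "(u, u) \<notin> parcs Y ^^ k"
proof
  assume "(u, u) \<in> parcs Y ^^ k"
  then obtain xs where xs: "length xs = k" "set xs \<subseteq> conn" "sum_list xs = emb u + emb u"
    by (rule walk_of_conn_list)
  then have "winding 0 (rev xs) = - winding 0 xs"
    using winding_backwards[OF xs(2), of 0] by (simp add: char2)
  then have "winding 0 xs = 0" using winding_rev[OF xs(2), of 0] by simp
  then show False using even_winding[of 0 xs] assms xs(1) by simp
qed

end

end

locale connected_cubelike_retract = cubelike_retract +
  assumes reachable: "u \<in> pverts Y \<Longrightarrow> v \<in> pverts Y \<Longrightarrow> (u, v) \<in> (parcs Y)\<^sup>*"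
    and nonempty: "pverts Y \<noteq> {}"
begin

lemma bipartite_if_no_odd_closed_walk:
  assumes "u \<in> pverts Y" "\<And>k. odd k \<Longrightarrow> (u, u) \<notin> parcs Y ^^ k"
  shows "\<exists>c :: 'a \<Rightarrow> bool. \<forall>(v, w)\<in>parcs Y. c v \<noteq> c w"
  using assms by (intro bipartition_by_parity[OF sym_parcs reachable arcs_subset])

lemma colourable_card: "colourable Y (card (pverts Y))"
proof -
  obtain c where c: "bij_betw c (pverts Y) {0..<card (pverts Y)}"
    using ex_bij_betw_finite_nat[OF finite_verts] ..
  have "c u \<noteq> c v" if "(u, v) \<in> parcs Y" for u v
  proof
    assume "c u = c v"
    then have "u = v" using bij_betw_imp_inj_on[OF c] arc_verts[OF that] by (simp add: inj_on_eq_iff)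
    then show False using that no_loop by simp
  qed
  moreover have "c \<in> pverts Y \<rightarrow> {..<card (pverts Y)}" using c by (auto simp: bij_betw_def)
  ultimately show ?thesis unfolding colourable_def by (intro exI[of _ c]) auto
qed

text \<open>
  Without odd closed walks a connected graph has a colouring with two colours, so 3 is never the least
  number of colours.
\<close>

lemma chromatic_number_neq_3: "chromatic_number Y \<noteq> 3"
proof
  assume chi: "chromatic_number Y = 3"
  have "colourable Y 3"
    using LeastI[of "colourable Y", OF colourable_card] chi by (simp add: chromatic_number_def)
  then obtain col where col: "col \<in> pverts Y \<rightarrow> {..<3 :: nat}" "\<forall>(u, v)\<in>parcs Y. col u \<noteq> col v"
    unfolding colourable_def by (elim exE conjE)
  obtain y where y: "y \<in> pverts Y" using nonempty by blast
  have "(y, y) \<notin> parcs Y ^^ k" if "odd k" for k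
    using that col by (intro no_odd_closed_walk_if_3_colouring[of col]) auto
  from bipartite_if_no_odd_closed_walk[OF y this]
  obtain c :: "'a \<Rightarrow> bool" where c: "\<forall>(v, w)\<in>parcs Y. c v \<noteq> c w" ..
  have "colourable Y 2"
    unfolding colourable_def
    by (intro exI[of _ "\<lambda>v. if c v then 1 else 0"]) (use c in auto)
  then have "chromatic_number Y \<le> 2" unfolding chromatic_number_def by (rule Least_le)
  then show False using chi by simp
qed

end

section \<open>Walking in the directions of a cube\<close>

text \<open>
  The set \<open>A\<close> stands for the vertex of the cube with support \<open>A\<close>; toggling one direction follows an
  arc of \<open>Y\<close>.
\<close>

locale cube_walk = simple_graph Y
  for Y :: "'a pair_pre_digraph" +
  fixes d :: nat and walk :: "nat set \<Rightarrow> 'a"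
  assumes walk_in_verts: "walk A \<in> pverts Y"
    and walk_arc: "A \<subseteq> {..<d} \<Longrightarrow> j < d \<Longrightarrow> (walk A, walk (sym_diff A {j})) \<in> parcs Y"
begin

lemma walk_relpow:
  assumes "A \<subseteq> {..<d}" "S \<subseteq> {..<d}"
  shows "(walk A, walk (sym_diff A S)) \<in> parcs Y ^^ card S"
proof -
  have "finite S" using assms(2) by (rule finite_subset) simp
  then show ?thesis using assms(2)
  proof (induction S)
    case (insert j S)
    then have "(walk A, walk (sym_diff A S)) \<in> parcs Y ^^ card S" by simp
    moreover have "(walk (sym_diff A S), walk (sym_diff (sym_diff A S) {j})) \<in> parcs Y"
      using insert.prems assms(1) by (intro walk_arc sym_diff_subset) simp_all
    ultimately have "(walk A, walk (sym_diff (sym_diff A S) {j})) \<in> parcs Y ^^ Suc (card S)"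
      by (rule relpow_Suc_I)
    then show ?case by (simp only: sym_diff_insert[OF insert.hyps(2)] card_insert_disjoint[OF insert.hyps])
  qed simp
qed

end

text \<open>
  The map is constant on pairs of antipodal vertices, so it factors through the folded cube, and \<open>Y\<close>
  has no odd closed walk that is shorter than the \<open>d\<close> steps between antipodes.
\<close>

locale antipodal_cube_walk = cube_walk +
  assumes odd_dim: "odd d"
    and antipodal: "A \<subseteq> {..<d} \<Longrightarrow> walk (sym_diff A {..<d}) = walk A"
    and shortest: "odd k \<Longrightarrow> (u, u) \<in> parcs Y ^^ k \<Longrightarrow> d \<le> k"
begin

text \<open>
  Either the directions in which \<open>A\<close> and \<open>B\<close> differ are toggled, or all others, which leads from
  \<open>A\<close> to the antipode of \<open>B\<close>. As \<open>d\<close> is odd, one of these two routes is odd.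
\<close>

lemma walk_both_ways:
  assumes "A \<subseteq> {..<d}" "B \<subseteq> {..<d}"
  shows "(walk A, walk B) \<in> parcs Y ^^ card (sym_diff A B)"
    and "(walk A, walk B) \<in> parcs Y ^^ (d - card (sym_diff A B))"
proof -
  let ?S = "sym_diff A B"
  have S: "?S \<subseteq> {..<d}" using assms by (rule sym_diff_subset)
  show "(walk A, walk B) \<in> parcs Y ^^ card ?S"
    using walk_relpow[OF assms(1) S] by (simp only: sym_diff_cancel_left)
  have "sym_diff A ({..<d} - ?S) = sym_diff B {..<d}" using assms by blast
  moreover have "card ({..<d} - ?S) = d - card ?S"
    using card_Diff_subset[OF finite_subset[OF S] S] by (simp only: card_lessThan finite_lessThan)
  ultimately show "(walk A, walk B) \<in> parcs Y ^^ (d - card ?S)"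
    using walk_relpow[OF assms(1), of "{..<d} - ?S"] antipodal[OF assms(2)] by simp
qed

lemma walk_eq:
  assumes "A \<subseteq> {..<d}" "B \<subseteq> {..<d}" "walk A = walk B"
  shows "sym_diff A B = {} \<or> sym_diff A B = {..<d}"
proof -
  let ?S = "sym_diff A B"
  have S: "?S \<subseteq> {..<d}" using assms(1,2) by (rule sym_diff_subset)
  have le: "card ?S \<le> d" using card_mono[OF _ S] by simp
  note both = walk_both_ways[OF assms(1,2), folded assms(3)]
  show ?thesis
  proof (cases "even (card ?S)")
    case True
    then have "odd (d - card ?S)" using odd_dim le by simp
    with shortest[OF _ both(2)] have "d \<le> d - card ?S" by simp
    moreover have "d > 0" using odd_dim by (rule odd_pos)
    ultimately have "card ?S = 0" using le by linarith
    then show ?thesis using finite_subset[OF S] by simp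
  next
    case False
    then have "d \<le> card ?S" using shortest[OF _ both(1)] by simp
    then show ?thesis using card_seteq[OF _ S] by simp
  qed
qed

text \<open>
  The arc from \<open>walk B\<close> back to \<open>walk A\<close> closes the even one of the two routes to an odd closed walk,
  so that this route has length at least \<open>d - 1\<close>.
\<close>

lemma walk_adjacent:
  assumes "A \<subseteq> {..<d}" "B \<subseteq> {..<d}" "(walk A, walk B) \<in> parcs Y"
  shows "card (sym_diff A B) = 1 \<or> card (sym_diff A B) = d - 1"
proof -
  let ?S = "sym_diff A B"
  have S: "?S \<subseteq> {..<d}" using assms(1,2) by (rule sym_diff_subset)
  have le: "card ?S \<le> d" using card_mono[OF _ S] by simp
  note both = walk_both_ways[OF assms(1,2)]
  have close: "(walk A, walk A) \<in> parcs Y ^^ Suc k" if "(walk A, walk B) \<in> parcs Y ^^ k" for k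
    using relpow_Suc_I[OF that arcs_sym[OF assms(3)]] .
  show ?thesis
  proof (cases "even (card ?S)")
    case True
    then have "d \<le> Suc (card ?S)" using shortest[OF _ close[OF both(1)]] by simp
    moreover have "card ?S \<noteq> d" using True odd_dim by metis
    ultimately show ?thesis using le by linarith
  next
    case False
    then have "d \<le> Suc (d - card ?S)" using odd_dim le shortest[OF _ close[OF both(2)]] by simp
    moreover have "card ?S \<noteq> 0" using False by (metis even_zero)
    moreover have "d > 0" using odd_dim by (rule odd_pos)
    ultimately have "card ?S = 1" using le by linarith
    then show ?thesis ..
  qed
qed

text \<open>
  The folded cube uses the coordinates below \<open>d - 1\<close>, which selects from each pair of antipodes the
  set that does not contain \<open>d - 1\<close>.
\<close>

lemma walk_supp_inj: "inj_on (\<lambda>x. walk (supp x)) (pverts (folded_cube d))"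
proof (rule inj_onI)
  fix x y assume "x \<in> pverts (folded_cube d)" "y \<in> pverts (folded_cube d)"
    and eq: "walk (supp x) = walk (supp y)"
  then have xy: "x \<in> carrier_vec (d - 1)" "y \<in> carrier_vec (d - 1)" by simp_all
  note sub = supp_subset[OF xy(1)] supp_subset[OF xy(2)]
  have pos: "d > 0" using odd_dim by (rule odd_pos)
  have "{..<d - 1} \<subseteq> {..<d}" by simp
  with sub have "sym_diff (supp x) (supp y) = {} \<or> sym_diff (supp x) (supp y) = {..<d}"
    by (intro walk_eq eq) (rule order_trans, assumption, assumption)+
  moreover have "sym_diff (supp x) (supp y) \<noteq> {..<d}"
  proof
    assume "sym_diff (supp x) (supp y) = {..<d}"
    then have "d - 1 \<in> sym_diff (supp x) (supp y)" using pos by simp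
    then show False using sub by auto
  qed
  ultimately have "supp x = supp y" by blast
  then show "x = y" using supp_inject[OF xy] by simp
qed

lemma walk_supp_arcs:
  assumes "x \<in> pverts (folded_cube d)" "y \<in> pverts (folded_cube d)"
  shows "(x, y) \<in> parcs (folded_cube d) \<longleftrightarrow> (walk (supp x), walk (supp y)) \<in> parcs Y"
proof -
  have xy: "x \<in> carrier_vec (d - 1)" "y \<in> carrier_vec (d - 1)" using assms by simp_all
  let ?A = "supp x" and ?B = "supp y"
  let ?S = "sym_diff ?A ?B"
  have pos: "d > 0" using odd_dim by (rule odd_pos)
  have sub': "{..<d - 1} \<subseteq> {..<d}" by simp
  note sub = order_trans[OF supp_subset[OF xy(1)] sub'] order_trans[OF supp_subset[OF xy(2)] sub']
  have S: "?S \<subseteq> {..<d - 1}" using supp_subset[OF xy(1)] supp_subset[OF xy(2)] by (rule sym_diff_subset)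
  show ?thesis unfolding arcs_folded_cube[OF xy]
  proof
    assume "(\<exists>j<d - 1. ?S = {j}) \<or> ?S = {..<d - 1}"
    then show "(walk ?A, walk ?B) \<in> parcs Y"
    proof
      assume "\<exists>j<d - 1. ?S = {j}"
      then obtain j where j: "j < d - 1" "?S = {j}" by (elim exE conjE)
      have "?B = sym_diff ?A {j}" unfolding j(2)[symmetric] by (rule sym_diff_cancel_left[symmetric])
      then show ?thesis using walk_arc[OF sub(1), of j] j(1) by simp
    next
      assume S: "?S = {..<d - 1}"
      have B: "?B = sym_diff ?A {..<d - 1}" unfolding S[symmetric] by (rule sym_diff_cancel_left[symmetric])
      \<comment> \<open>Toggling all directions below \<open>d - 1\<close> amounts to toggling the direction \<open>d - 1\<close>, up to antipodes.\<close>
      have "{..<d} = insert (d - 1) {..<d - 1}" using pos by auto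
      then have "sym_diff ?B {d - 1} = sym_diff ?A {..<d}"
        unfolding B by (simp only: sym_diff_insert[of "d - 1" "{..<d - 1}"] lessThan_iff less_irrefl not_False_eq_True)
      then have "walk (sym_diff ?B {d - 1}) = walk ?A" using antipodal[OF sub(1)] by simp
      then have "(walk ?B, walk ?A) \<in> parcs Y" using walk_arc[OF sub(2), of "d - 1"] pos by simp
      then show ?thesis by (rule arcs_sym)
    qed
  next
    assume "(walk ?A, walk ?B) \<in> parcs Y"
    from walk_adjacent[OF sub this] show "(\<exists>j<d - 1. ?S = {j}) \<or> ?S = {..<d - 1}"
    proof
      assume "card ?S = 1"
      then obtain j where "?S = {j}" by (rule card_1_singletonE)
      then show ?thesis using S by auto
    next
      assume "card ?S = d - 1"
      then show ?thesis using card_seteq[OF _ S] by simp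
    qed
  qed
qed

lemma folded_cube_induced: "is_induced_subgraph (folded_cube d) Y"
proof (rule is_induced_subgraphI[OF wf_folded_cube wf walk_supp_inj _ walk_supp_arcs])
  show "(\<lambda>x. walk (supp x)) ` pverts (folded_cube d) \<subseteq> pverts Y"
    using walk_in_verts by blast
qed

end

subsection \<open>Shortest odd closed walks\<close>

definition arc_list :: "(nat \<Rightarrow> 'a) \<Rightarrow> nat \<Rightarrow> nat \<Rightarrow> ('a \<times> 'a) list" where
  "arc_list f a n = map (\<lambda>i. (f i, f (Suc i))) [a..<a + n]"

lemma arc_list_Suc: "arc_list f a (Suc n) = (f a, f (Suc a)) # arc_list f (Suc a) n"
  unfolding arc_list_def by (subst upt_conv_Cons) simp_all

lemma pcas_arc_list: "pcas (f a) (arc_list f a n) (f (a + n))"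
proof (induction n arbitrary: a)
  case (Suc n)
  from Suc.IH[of "Suc a"] show ?case by (simp add: arc_list_Suc)
qed (simp add: arc_list_def)

lemma pawalk_verts_arc_list: "pawalk_verts (f a) (arc_list f a n) = map f [a..<Suc (a + n)]"
proof (induction n arbitrary: a)
  case (Suc n)
  have "[a..<Suc (a + Suc n)] = a # [Suc a..<Suc (Suc a + n)]" by (subst upt_conv_Cons) simp_all
  with Suc.IH[of "Suc a"] show ?case by (simp add: arc_list_Suc)
qed (simp add: arc_list_def)

lemma relpow_if_pcas: "pcas u p v \<Longrightarrow> set p \<subseteq> R \<Longrightarrow> (u, v) \<in> R ^^ length p"
proof (induction p arbitrary: u)
  case (Cons e p)
  then have "(u, snd e) \<in> R" "(snd e, v) \<in> R ^^ length p" by auto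
  then show ?case by (simp only: list.size(4) add_0_right One_nat_def add_Suc_right relpow_Suc_I2)
qed simp

lemma relpow_funI: "(\<And>i. a \<le> i \<Longrightarrow> i < a + n \<Longrightarrow> (f i, f (Suc i)) \<in> R) \<Longrightarrow> (f a, f (a + n)) \<in> R ^^ n"
proof (induction n)
  case (Suc n)
  then have "(f a, f (a + n)) \<in> R ^^ n" "(f (a + n), f (Suc (a + n))) \<in> R" by simp_all
  then show ?case by (simp only: add_Suc_right relpow_Suc_I)
qed simp

context simple_graph begin

text \<open>
  A repeated vertex would split the walk into two shorter closed walks, one of which is odd.
\<close>

lemma odd_cycle_if_shortest_odd_closed_walk:
  assumes "odd k" and uu: "(u, u) \<in> parcs G ^^ k"
    and shortest: "\<And>v l. odd l \<Longrightarrow> (v, v) \<in> parcs G ^^ l \<Longrightarrow> k \<le> l"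
  shows "\<exists>p. pre_digraph.cycle (with_proj G) p \<and> length p = k"
proof -
  from uu obtain f where f: "f 0 = u" "f k = u" "\<And>i. i < k \<Longrightarrow> (f i, f (Suc i)) \<in> parcs G"
    unfolding relpow_fun_conv by blast
  let ?p = "arc_list f 0 k"
  have pos: "k > 0" using assms(1) by (rule odd_pos)
  have arcs: "set ?p \<subseteq> parcs G" using f(3) by (auto simp: arc_list_def)
  have "u \<in> pverts G" using arc_verts[OF f(3)[OF pos]] f(1) by simp
  have no_repeat: False if ij: "0 < i" "i < j" "j \<le> k" "f i = f j" for i j
  proof -
    have "(f i, f (i + (j - i))) \<in> parcs G ^^ (j - i)"
      using ij f(3) by (intro relpow_funI) simp
    then have inner: "(f i, f i) \<in> parcs G ^^ (j - i)" using ij by simp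
    have "(f 0, f (0 + i)) \<in> parcs G ^^ i" using ij f(3) by (intro relpow_funI) simp
    moreover have "(f j, f (j + (k - j))) \<in> parcs G ^^ (k - j)" using ij f(3) by (intro relpow_funI) simp
    ultimately have "(f 0, f i) \<in> parcs G ^^ i" "(f i, f k) \<in> parcs G ^^ (k - j)" using ij by simp_all
    from relpow_trans[OF this] have outer: "(u, u) \<in> parcs G ^^ (i + (k - j))" using f(1,2) by simp
    have "odd (j - i) \<or> odd (i + (k - j))" using assms(1) ij(1-3) by presburger
    then show False
      using shortest[OF _ inner] shortest[OF _ outer] ij(1-3) by (elim disjE) linarith+
  qed
  have "inj_on f {Suc 0..<Suc k}"
  proof (rule inj_onI, rule ccontr)
    fix i j assume ij: "i \<in> {Suc 0..<Suc k}" "j \<in> {Suc 0..<Suc k}" "f i = f j" "i \<noteq> j"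
    then consider "i < j" | "j < i" by linarith
    then show False using ij no_repeat[of i j] no_repeat[of j i] by cases simp_all
  qed
  moreover have "tl (pawalk_verts u ?p) = map f [Suc 0..<Suc k]"
  proof -
    have "pawalk_verts u ?p = map f [0..<Suc k]" using pawalk_verts_arc_list[of f 0 k] f(1) by simp
    also have "[0..<Suc k] = 0 # [Suc 0..<Suc k]" by (subst upt_conv_Cons) simp_all
    finally show ?thesis by simp
  qed
  ultimately have "distinct (tl (pawalk_verts u ?p))" 
    by (simp only: distinct_map distinct_upt set_upt simp_thms)
  moreover have "pcas u ?p u" using pcas_arc_list[of f 0 k] f(1,2) by simp
  moreover have "length ?p = k" by (simp add: arc_list_def)
  moreover from this have "?p \<noteq> []" using pos by auto
  ultimately show ?thesis using arcs \<open>u \<in> pverts G\<close>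
    by (intro exI[of _ ?p])
      (auto simp: pre_digraph.cycle_def pre_digraph.awalk_def cas_with_proj_eq awalk_verts_with_proj_eq)
qed

text \<open>
  Odd closed walks are easier to transport along homomorphisms than odd cycles. The least length
  is the same for both.
\<close>

lemma odd_girth_walks:
  assumes "odd_girth G = enat g"
  shows "odd g" "\<exists>u. (u, u) \<in> parcs G ^^ g"
    and "\<And>u k. odd k \<Longrightarrow> (u, u) \<in> parcs G ^^ k \<Longrightarrow> g \<le> k"
proof -
  let ?C = "{p. pre_digraph.cycle (with_proj G) p \<and> odd (length p)}"
  let ?L = "(\<lambda>p. enat (length p)) ` ?C"
  have Inf: "Inf ?L = enat g" using assms by (simp add: odd_girth_def)
  have "?L \<noteq> {}"
  proof
    assume "?L = {}"
    then have "Inf ?L = \<infinity>" by (simp only: Inf_enat_def simp_thms if_True)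
    then show False unfolding Inf by simp
  qed
  then have "Inf ?L \<in> ?L" unfolding Inf_enat_def by (auto intro: LeastI)
  then have "enat g \<in> ?L" unfolding Inf .
  then obtain p where p: "pre_digraph.cycle (with_proj G) p" "odd (length p)" "length p = g" by auto
  then show g: "odd g" by simp
  from p(1) obtain u where u: "pcas u p u" "set p \<subseteq> parcs G"
    by (auto simp: pre_digraph.cycle_def pre_digraph.awalk_def cas_with_proj_eq)
  from relpow_if_pcas[OF this] show walk: "\<exists>u. (u, u) \<in> parcs G ^^ g" unfolding p(3) ..
  let ?P = "\<lambda>k. odd k \<and> (\<exists>u. (u, u) \<in> parcs G ^^ k)"
  \<comment> \<open>A shortest odd closed walk is a cycle, so its length \<open>m\<close> takes part in the infimum.\<close>
  define m where "m = (LEAST k. ?P k)"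
  have "?P g" using g walk ..
  then have m: "?P m" unfolding m_def by (rule LeastI)
  then obtain w where w: "(w, w) \<in> parcs G ^^ m" by (elim conjE exE)
  have least: "m \<le> k" if "odd k" "(v, v) \<in> parcs G ^^ k" for k v
    unfolding m_def using that by (intro Least_le conjI exI)
  have "\<exists>q. pre_digraph.cycle (with_proj G) q \<and> length q = m"
    using conjunct1[OF m] w by (rule odd_cycle_if_shortest_odd_closed_walk) (rule least)
  then obtain q where q: "pre_digraph.cycle (with_proj G) q" "length q = m" by (elim exE conjE)
  then have "enat m \<in> ?L" using m by auto
  then have "Inf ?L \<le> enat m" by (rule Inf_lower)
  then have "g \<le> m" unfolding Inf by simp
  then show "g \<le> k" if "odd k" "(v, v) \<in> parcs G ^^ k" for v k using least[OF that] by simp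
qed

end

context cubelike_retract begin

lemma sum_gen_walk:
  assumes "\<And>i. i < g \<Longrightarrow> (f i, f (Suc i)) \<in> parcs Y" "n \<le> g"
  shows "(\<Sum>i<n. emb (f i) + emb (f (Suc i))) = emb (f 0) + emb (f n)"
proof (induction n)
  case (Suc n)
  have "emb (f 0) + emb (f n) + (emb (f n) + emb (f (Suc n))) = emb (f 0) + emb (f (Suc n))"
    by (simp only: add.assoc char2_cancel)
  with Suc.IH show ?case by (simp only: sum.lessThan_Suc)
qed (simp add: char2)

text \<open>
  The directions of the cube are the connection vectors of the edges of a shortest odd closed walk.
  They add up to zero, so antipodal sets have the same sum.
\<close>

lemma folded_cube_of_odd_girth:
  assumes "odd_girth Y = enat g"
  shows "is_induced_subgraph (folded_cube g) Y"
proof -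
  from odd_girth_walks(2)[OF assms] obtain u where "(u, u) \<in> parcs Y ^^ g" ..
  then obtain f where f: "f 0 = u" "f g = u" "\<And>i. i < g \<Longrightarrow> (f i, f (Suc i)) \<in> parcs Y"
    unfolding relpow_fun_conv by blast
  define gen where "gen i = emb (f i) + emb (f (Suc i))" for i
  define walk where "walk A = retr (sum gen (A \<inter> {..<g}))" for A
  have gen: "gen j \<in> conn" if "j < g" for j unfolding gen_def using f(3)[OF that] by (rule connI)
  have walk: "walk (sym_diff A B) = retr (sum gen A + sum gen B)" if "A \<subseteq> {..<g}" "B \<subseteq> {..<g}" for A B
  proof -
    have "sym_diff A B \<inter> {..<g} = sym_diff A B" using that by blast
    moreover have "finite A" "finite B" using that finite_subset by blast+
    note sum_sym_diff[OF char2 this, of gen]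
    ultimately show ?thesis by (simp only: walk_def)
  qed
  have walk1: "walk A = retr (sum gen A)" if "A \<subseteq> {..<g}" for A
    using that by (simp only: walk_def Int_absorb2)
  have total: "sum gen {..<g} = 0"
    using sum_gen_walk[of g f g] f by (simp add: gen_def char2)
  interpret antipodal_cube_walk Y g walk
  proof
    show "walk A \<in> pverts Y" for A unfolding walk_def by (rule retr_in_verts)
    show "(walk A, walk (sym_diff A {j})) \<in> parcs Y" if "A \<subseteq> {..<g}" "j < g" for A j
      using retr_conn[OF gen[OF that(2)], of "sum gen A"] walk[OF that(1), of "{j}"] walk1[OF that(1)] that(2)
      by simp
    show "walk (sym_diff A {..<g}) = walk A" if "A \<subseteq> {..<g}" for A
      using walk[OF that order_refl] walk1[OF that] total by simp
  qed (use odd_girth_walks[OF assms] in auto)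
  show ?thesis by (rule folded_cube_induced)
qed

end

section \<open>Graphs covered by a cube\<close>

text \<open>
  Bijectivity on neighbourhoods lets walks be lifted, and with connectedness this makes \<open>walk\<close> a
  covering map; its surjectivity is \<open>walk_surj\<close>.
\<close>

locale cube_cover = cube_walk +
  assumes walk_nbrs: "A \<subseteq> {..<d} \<Longrightarrow>
      bij_betw (\<lambda>j. walk (sym_diff A {j})) {..<d} {w. (walk A, w) \<in> parcs Y}"
    and reachable: "u \<in> pverts Y \<Longrightarrow> v \<in> pverts Y \<Longrightarrow> (u, v) \<in> (parcs Y)\<^sup>*"
begin

lemma nbr_cases:
  assumes "A \<subseteq> {..<d}" "(walk A, w) \<in> parcs Y"
  obtains j where "j < d" "w = walk (sym_diff A {j})"
proof -
  have "w \<in> (\<lambda>j. walk (sym_diff A {j})) ` {..<d}"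
    using assms bij_betw_imp_surj_on[OF walk_nbrs[OF assms(1)]] by simp
  then show ?thesis using that by auto
qed

lemma nbr_inj:
  assumes "A \<subseteq> {..<d}" "j < d" "k < d" "walk (sym_diff A {j}) = walk (sym_diff A {k})"
  shows "j = k"
  using inj_onD[OF bij_betw_imp_inj_on[OF walk_nbrs[OF assms(1)]] assms(4)] assms(2,3) by simp

text \<open>
  Walks in \<open>Y\<close> lift to the cube. A walk of \<open>k\<close> steps there moves by at most \<open>k\<close> directions, and by
  a number of the same parity.
\<close>

lemma lift_walk:
  assumes "A \<subseteq> {..<d}" "(walk A, v) \<in> parcs Y ^^ k"
  shows "\<exists>S\<subseteq>{..<d}. v = walk (sym_diff A S) \<and> card S \<le> k \<and> (even (card S) \<longleftrightarrow> even k)"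
  using assms(2)
proof (induction k arbitrary: v)
  case 0
  then show ?case by (intro exI[of _ "{}"]) auto
next
  case (Suc k)
  then obtain w where w: "(walk A, w) \<in> parcs Y ^^ k" "(w, v) \<in> parcs Y" by auto
  from Suc.IH[OF w(1)] obtain S where S: "S \<subseteq> {..<d}" "w = walk (sym_diff A S)" "card S \<le> k"
    "even (card S) \<longleftrightarrow> even k" by (elim exE conjE)
  obtain j where j: "j < d" "v = walk (sym_diff (sym_diff A S) {j})"
    using nbr_cases[OF sym_diff_subset[OF assms(1) S(1)]] w(2) S(2) by metis
  have fin: "finite S" using S(1) by (rule finite_subset) simp
  have "sym_diff S {j} \<subseteq> {..<d}" using S(1) j(1) by (intro sym_diff_subset) simp_all
  moreover have "v = walk (sym_diff A (sym_diff S {j}))" using j(2) by (simp only: sym_diff_assoc)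
  moreover have "card (sym_diff S {j}) \<le> Suc k" using card_sym_diff[OF fin, of "{j}"] S(3) by simp
  moreover have "even (card (sym_diff S {j})) \<longleftrightarrow> even (Suc k)"
    using even_card_sym_diff[OF fin, of "{j}"] S(4) by simp
  ultimately show ?case by (intro exI[of _ "sym_diff S {j}"] conjI)
qed

lemma walk_surj:
  assumes "v \<in> pverts Y"
  obtains A where "A \<subseteq> {..<d}" "v = walk A"
proof -
  obtain k where "(walk {}, v) \<in> parcs Y ^^ k"
    using rtrancl_imp_relpow[OF reachable[OF walk_in_verts[of "{}"] assms]] by (elim exE)
  from lift_walk[OF empty_subsetI this] obtain S where "S \<subseteq> {..<d}" "v = walk (sym_diff {} S)"
    by (elim exE conjE)
  then show ?thesis using that[of S] by simp
qed

lemma covering_cube: "covering_map (\<lambda>x. walk (supp x)) (cube d) Y"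
  unfolding covering_map_def
proof (intro conjI ballI)
  let ?\<phi> = "\<lambda>x. walk (supp x)"
  show "graph_hom ?\<phi> (cube d) Y"
  proof (rule graph_homI)
    fix x y assume "(x, y) \<in> parcs (cube d)"
    then show "(?\<phi> x, ?\<phi> y) \<in> parcs Y"
    proof (rule arc_cubeE)
      fix j assume x: "x \<in> carrier_vec d" and "j < d" and y: "supp y = sym_diff (supp x) {j}"
      show ?thesis unfolding y using supp_subset[OF x] \<open>j < d\<close> by (rule walk_arc)
    qed
  qed (rule walk_in_verts)
  show "?\<phi> ` pverts (cube d) = pverts Y"
  proof (intro equalityI subsetI)
    fix v assume "v \<in> pverts Y"
    then obtain A where A: "A \<subseteq> {..<d}" "v = walk A" by (rule walk_surj)
    then have "A \<in> supp ` carrier_vec d" using bij_betw_supp[of d] by (simp add: bij_betw_def)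
    then show "v \<in> ?\<phi> ` pverts (cube d)" unfolding A(2) pverts_cube by (metis imageE imageI)
  next
    fix v assume "v \<in> ?\<phi> ` pverts (cube d)"
    then show "v \<in> pverts Y" using walk_in_verts by blast
  qed
  fix x assume "x \<in> pverts (cube d)"
  then have x: "x \<in> carrier_vec d" by simp
  let ?N = "{y. (x, y) \<in> parcs (cube d)}" and ?u = "\<lambda>j. x + unit_vec d j"
  have supp: "supp (?u j) = sym_diff (supp x) {j}" if "j < d" for j
    using supp_add[OF x] that by (simp add: supp_unit_vec)
  have u: "bij_betw ?u {..<d} ?N"
  proof (rule bij_betw_imageI)
    show "inj_on ?u {..<d}"
    proof (rule inj_onI)
      fix j k assume "j \<in> {..<d}" "k \<in> {..<d}" "?u j = ?u k"
      then have "sym_diff (supp x) {j} = sym_diff (supp x) {k}" using supp[of j] supp[of k] by simp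
      then show "j = k" by (metis sym_diff_cancel_left singleton_inject)
    qed
    show "?u ` {..<d} = ?N"
    proof (intro equalityI image_subsetI subsetI)
      fix j assume "j \<in> {..<d}"
      then have jd: "j < d" by simp
      have "sym_diff (supp x) (supp (?u j)) = {j}" unfolding supp[OF jd] by (rule sym_diff_cancel_left)
      then show "?u j \<in> ?N" using x jd arcs_cube[of x d "?u j"] by auto
    next
      fix y assume "y \<in> ?N"
      then have "(x, y) \<in> parcs (cube d)" by simp
      then show "y \<in> ?u ` {..<d}"
      proof (rule arc_cubeE)
        fix j assume y: "y \<in> carrier_vec d" and jd: "j < d" and "supp y = sym_diff (supp x) {j}"
        then have "supp y = supp (?u j)" using supp[OF jd] by simp
        then have "y = ?u j" using supp_inject[OF y, of "?u j"] x by simp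
        then show ?thesis using jd by simp
      qed
    qed
  qed
  have "bij_betw (?\<phi> \<circ> ?u) {..<d} {w. (?\<phi> x, w) \<in> parcs Y}"
    using walk_nbrs[OF supp_subset[OF x]]
    by (rule bij_betw_cong[THEN iffD1, rotated]) (simp add: supp)
  then show "bij_betw ?\<phi> ?N {w. (?\<phi> x, w) \<in> parcs Y}"
    unfolding bij_betw_comp_iff[OF u, symmetric] .
qed

lemma card_verts_le: "card (pverts Y) \<le> 2 ^ d"
proof -
  have "pverts Y \<subseteq> walk ` Pow {..<d}"
    using walk_surj by (metis (no_types, lifting) PowI image_eqI subsetI)
  then have "card (pverts Y) \<le> card (Pow {..<d})" by (intro surj_card_le) simp_all
  then show ?thesis by (simp add: card_Pow)
qed

end

subsection \<open>Non-bipartite quotients of the cube\<close>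

text \<open>
  The shortest odd closed walks at all vertices have the same length \<open>g\<close>, as in a
  vertex-transitive graph that is not bipartite.
\<close>

locale odd_cube_cover = cube_cover +
  fixes g :: nat
  assumes odd_g: "odd g"
    and closed_walk: "u \<in> pverts Y \<Longrightarrow> (u, u) \<in> parcs Y ^^ g"
    and shortest: "odd k \<Longrightarrow> (u, u) \<in> parcs Y ^^ k \<Longrightarrow> g \<le> k"
begin

text \<open>
  Lift an odd closed walk.
\<close>

lemma odd_returns:
  assumes "A \<subseteq> {..<d}"
  obtains T where "T \<subseteq> {..<d}" "odd (card T)" "walk (sym_diff A T) = walk A"
  using lift_walk[OF assms closed_walk[OF walk_in_verts]] odd_g by metis

lemma card_odd_return:
  assumes "A \<subseteq> {..<d}" "T \<subseteq> {..<d}" "odd (card T)" "walk (sym_diff A T) = walk A"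
  shows "g \<le> card T"
  using walk_relpow[OF assms(1,2)] assms(3) shortest unfolding assms(4) by blast

text \<open>
  By \<open>odd_returns\<close> each fibre meets both parity classes, so already one of them, half of the
  cube, covers \<open>Y\<close>.
\<close>

lemma parity_surj:
  assumes "v \<in> pverts Y"
  obtains A where "A \<subseteq> {..<d}" "even (card A) \<longleftrightarrow> b" "v = walk A"
proof -
  obtain A where A: "A \<subseteq> {..<d}" "v = walk A" using assms by (rule walk_surj)
  obtain T where T: "T \<subseteq> {..<d}" "odd (card T)" "walk (sym_diff A T) = walk A"
    using A(1) by (rule odd_returns)
  have "even (card (sym_diff A T)) \<longleftrightarrow> odd (card A)"
    using even_card_sym_diff[of A T] finite_subset[OF A(1)] finite_subset[OF T(1)] T(2) by simp
  moreover have "sym_diff A T \<subseteq> {..<d}" using A(1) T(1) by (rule sym_diff_subset)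
  ultimately show ?thesis using that[OF A(1) _ A(2)] that[of "sym_diff A T"] T(3) A(2) by metis
qed

abbreviation parity_class :: "bool \<Rightarrow> nat set set" where
  "parity_class b \<equiv> {A. A \<subseteq> {..<d} \<and> (even (card A) \<longleftrightarrow> b)}"

lemma finite_parity_class: "finite (parity_class b)"
  by (rule finite_subset[of _ "Pow {..<d}"]) auto

lemma parity_class_image: "walk ` parity_class b = pverts Y"
proof (intro equalityI subsetI)
  fix v assume "v \<in> pverts Y"
  then obtain A where "A \<subseteq> {..<d}" "even (card A) \<longleftrightarrow> b" "v = walk A" by (rule parity_surj)
  then show "v \<in> walk ` parity_class b" by simp
qed (use walk_in_verts in blast)

lemma card_parity_class: "d > 0 \<Longrightarrow> card (parity_class b) = 2 ^ (d - 1)"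
  using card_even_subsets[of d] by (cases b) simp_all

lemma card_verts_le_half:
  assumes "d > 0"
  shows "card (pverts Y) \<le> 2 ^ (d - 1)"
  using card_image_le[OF finite_parity_class, of walk True]
  by (simp only: parity_class_image card_parity_class[OF assms])

end

subsection \<open>Quotients of the cube with fibres of size two\<close>

text \<open>
  Each fibre now consists of one even and one odd set, and exchanging them is the nontrivial
  deck transformation \<open>A \<mapsto> sym_diff A (return A)\<close>. The aim is that \<open>return A\<close> does not depend on
  \<open>A\<close>.
\<close>

locale half_cube_cover = odd_cube_cover +
  assumes d_pos: "d > 0" and card_verts: "card (pverts Y) = 2 ^ (d - 1)"
begin

lemma parity_inj:
  assumes "A \<subseteq> {..<d}" "B \<subseteq> {..<d}" "even (card A) \<longleftrightarrow> even (card B)" "walk A = walk B"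
  shows "A = B"
proof -
  let ?P = "parity_class (even (card B))"
  have "inj_on walk ?P"
    by (intro eq_card_imp_inj_on finite_parity_class)
      (simp only: parity_class_image card_verts card_parity_class[OF d_pos])
  then show ?thesis using assms by (intro inj_onD[of walk ?P]) simp_all
qed

definition return :: "nat set \<Rightarrow> nat set" where
  "return A = (SOME T. T \<subseteq> {..<d} \<and> odd (card T) \<and> walk (sym_diff A T) = walk A)"

lemma return:
  assumes "A \<subseteq> {..<d}"
  shows "return A \<subseteq> {..<d}" "odd (card (return A))" "walk (sym_diff A (return A)) = walk A"
proof -
  have "\<exists>T. T \<subseteq> {..<d} \<and> odd (card T) \<and> walk (sym_diff A T) = walk A"
    using odd_returns[OF assms] by metis
  from someI_ex[OF this] show "return A \<subseteq> {..<d}" "odd (card (return A))"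
    "walk (sym_diff A (return A)) = walk A" unfolding return_def by blast+
qed

lemma finite_sub: "A \<subseteq> {..<d} \<Longrightarrow> finite A"
  by (rule finite_subset[OF _ finite_lessThan])

lemma return_unique:
  assumes "A \<subseteq> {..<d}" "T \<subseteq> {..<d}" "odd (card T)" "walk (sym_diff A T) = walk A"
  shows "T = return A"
proof -
  note r = return[OF assms(1)]
  have "even (card (sym_diff A T)) \<longleftrightarrow> even (card (sym_diff A (return A)))"
    using even_card_sym_diff[OF finite_sub finite_sub, of A T]
      even_card_sym_diff[OF finite_sub finite_sub, of A "return A"] assms(1-3) r(1,2) by simp
  then have "sym_diff A T = sym_diff A (return A)"
    using assms r by (intro parity_inj sym_diff_subset) simp_all
  then show ?thesis by (metis sym_diff_cancel_left)
qed

text \<open>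
  The lift of a closed walk of length \<open>g\<close> ends within distance \<open>g\<close>, and toggling fewer than \<open>g\<close>
  directions cannot give an odd closed walk.
\<close>

lemma card_return:
  assumes "A \<subseteq> {..<d}"
  shows "card (return A) = g"
proof -
  obtain T where T: "T \<subseteq> {..<d}" "walk A = walk (sym_diff A T)" "card T \<le> g" "even (card T) \<longleftrightarrow> even g"
    using lift_walk[OF assms closed_walk[OF walk_in_verts]] by (elim exE conjE)
  then have "T = return A" using odd_g by (intro return_unique assms) simp_all
  moreover have "g \<le> card T" using T odd_g by (intro card_odd_return[OF assms]) simp_all
  ultimately show ?thesis using T(3) by simp
qed

lemma walk_eq_cases:
  assumes "A \<subseteq> {..<d}" "B \<subseteq> {..<d}" "walk A = walk B"
  shows "B = A \<or> B = sym_diff A (return A)"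
proof (cases "even (card A) \<longleftrightarrow> even (card B)")
  case True
  then show ?thesis using parity_inj[OF assms(1,2) _ assms(3)] by simp
next
  case False
  then have "odd (card (sym_diff A B))"
    using even_card_sym_diff[OF finite_sub[OF assms(1)] finite_sub[OF assms(2)]] by simp
  moreover have "walk (sym_diff A (sym_diff A B)) = walk A" unfolding assms(3) sym_diff_cancel_left ..
  ultimately have "sym_diff A B = return A"
    by (rule return_unique[OF assms(1) sym_diff_subset[OF assms(1,2)]])
  then show ?thesis by (metis sym_diff_cancel_left)
qed

text \<open>
  The deck transformation sends the edge at \<open>A\<close> in direction \<open>j\<close> to an edge in direction \<open>flip A j\<close>.
\<close>

definition flip :: "nat set \<Rightarrow> nat \<Rightarrow> nat" where
  "flip A j = (SOME k. k < d \<and> walk (sym_diff A {j}) = walk (sym_diff (sym_diff A (return A)) {k}))"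

lemma flip:
  assumes "A \<subseteq> {..<d}" "j < d"
  shows "flip A j < d" "walk (sym_diff (sym_diff A (return A)) {flip A j}) = walk (sym_diff A {j})"
proof -
  note r = return[OF assms(1)]
  have "(walk (sym_diff A (return A)), walk (sym_diff A {j})) \<in> parcs Y"
    unfolding r(3) using assms by (rule walk_arc)
  with sym_diff_subset[OF assms(1) r(1)]
  obtain k where "k < d" "walk (sym_diff A {j}) = walk (sym_diff (sym_diff A (return A)) {k})"
    by (rule nbr_cases)
  then have "\<exists>k. k < d \<and> walk (sym_diff A {j}) = walk (sym_diff (sym_diff A (return A)) {k})" by blast
  from someI_ex[OF this] show "flip A j < d"
    "walk (sym_diff (sym_diff A (return A)) {flip A j}) = walk (sym_diff A {j})"
    unfolding flip_def by simp_all
qed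

lemma return_step:
  assumes "A \<subseteq> {..<d}" "j < d"
  shows "return (sym_diff A {j}) = sym_diff (sym_diff (return A) {j}) {flip A j}"
proof (rule return_unique[symmetric])
  note r = return[OF assms(1)] and f = flip[OF assms]
  have j: "{j} \<subseteq> {..<d}" "{flip A j} \<subseteq> {..<d}" using assms(2) f(1) by simp_all
  show "sym_diff A {j} \<subseteq> {..<d}" using assms(1) j(1) by (rule sym_diff_subset)
  show sub: "sym_diff (sym_diff (return A) {j}) {flip A j} \<subseteq> {..<d}"
    using r(1) j by (intro sym_diff_subset)
  show "odd (card (sym_diff (sym_diff (return A) {j}) {flip A j}))"
    using r(2) even_card_sym_diff[of "return A" "{j}"]
      even_card_sym_diff[of "sym_diff (return A) {j}" "{flip A j}"] finite_sub[OF r(1)] by simp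
  have "sym_diff (sym_diff A {j}) (sym_diff (sym_diff (return A) {j}) {flip A j})
      = sym_diff (sym_diff A (return A)) {flip A j}" by blast
  then show "walk (sym_diff (sym_diff A {j}) (sym_diff (sym_diff (return A) {j}) {flip A j}))
      = walk (sym_diff A {j})" using f(2) by (simp only:)
qed

lemma flip_inj:
  assumes "A \<subseteq> {..<d}" "j < d" "m < d" "flip A j = flip A m"
  shows "j = m"
  using flip(2)[OF assms(1,2)] flip(2)[OF assms(1,3)] assms(4) nbr_inj[OF assms(1-3)] by simp

text \<open>
  Otherwise, after toggling \<open>j\<close> and \<open>m\<close> the deck transformation would be back at the image of \<open>A\<close>,
  although toggling both leads to another set of the same parity.
\<close>

lemma flip_step_neq:
  assumes "A \<subseteq> {..<d}" "j < d" "m < d" "j \<noteq> m"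
  shows "flip (sym_diff A {j}) m \<noteq> flip A j"
proof
  let ?Aj = "sym_diff A {j}"
  let ?B = "sym_diff ?Aj {m}"
  assume eq: "flip ?Aj m = flip A j"
  have Aj: "?Aj \<subseteq> {..<d}" using assms by (intro sym_diff_subset) simp_all
  have B: "?B \<subseteq> {..<d}" using assms(3) by (intro sym_diff_subset[OF Aj]) simp
  have "return ?B = sym_diff (sym_diff (sym_diff (sym_diff (return A) {j}) {flip A j}) {m}) {flip A j}"
    by (simp only: return_step[OF Aj assms(3)] return_step[OF assms(1,2)] eq)
  then have "sym_diff ?B (return ?B) = sym_diff A (return A)" by blast
  then have "walk ?B = walk A" using return(3)[OF B] return(3)[OF assms(1)] by (simp only:)
  moreover have "even (card ?B) \<longleftrightarrow> even (card A)"
    using even_card_sym_diff[of A "{j}"] even_card_sym_diff[of ?Aj "{m}"] finite_sub[OF assms(1)] by simp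
  ultimately have "?B = A" using parity_inj[OF B assms(1)] by blast
  then show False using assms(4) by blast
qed

text \<open>
  The two ways around the square with the directions \<open>j\<close> and \<open>m\<close> have the same end, whose image can
  be computed in both ways. On either side two distinct directions have been flipped, and comparison
  matches opposite sides of the image square.
\<close>

lemma flip_step:
  assumes "A \<subseteq> {..<d}" "j < d" "m < d"
  shows "flip (sym_diff A {m}) j = flip A j"
proof -
  have step: "return (sym_diff (sym_diff A {a}) {b})
      = sym_diff (sym_diff (sym_diff (sym_diff (return A) {a}) {flip A a}) {b}) {flip (sym_diff A {a}) b}"
    if "a < d" "b < d" for a b
  proof -
    have "{a} \<subseteq> {..<d}" using that(1) by simp
    note Aa = sym_diff_subset[OF assms(1) this]
    show ?thesis unfolding return_step[OF Aa that(2)] return_step[OF assms(1) that(1)] ..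
  qed
  show ?thesis
  proof (cases "j = m")
    case True
    have "sym_diff (sym_diff A {j}) {j} = A" by (rule sym_diff_cancel)
    with step[OF assms(2,2)] have
      "return A = sym_diff (sym_diff (sym_diff (sym_diff (return A) {j}) {flip A j}) {j}) {flip (sym_diff A {j}) j}"
      by (simp only:)
    also have "\<dots> = sym_diff (return A) (sym_diff {flip A j} {flip (sym_diff A {j}) j})"
      by (rule sym_diff_twice)
    finally have "sym_diff {flip A j} {flip (sym_diff A {j}) j} = sym_diff (return A) (return A)"
      by (metis sym_diff_cancel_left)
    moreover have "sym_diff (return A) (return A) = {}" by blast
    ultimately have "flip A j = flip (sym_diff A {j}) j" by (metis sym_diff_empty_iff singleton_inject)
    then show ?thesis using True by (simp only:)
  next
    case False
    have "sym_diff (sym_diff A {j}) {m} = sym_diff (sym_diff A {m}) {j}" by blast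
    with step[OF assms(2,3)] step[OF assms(3,2)] have
      "sym_diff (sym_diff (sym_diff (sym_diff (return A) {j}) {flip A j}) {m}) {flip (sym_diff A {j}) m}
      = sym_diff (sym_diff (sym_diff (sym_diff (return A) {m}) {flip A m}) {j}) {flip (sym_diff A {m}) j}"
      by (simp only:)
    then have "sym_diff {flip A j} {flip (sym_diff A {j}) m} = sym_diff {flip A m} {flip (sym_diff A {m}) j}"
      by (rule sym_diff_cancel_common)
    moreover have "flip A j \<in> sym_diff {flip A j} {flip (sym_diff A {j}) m}"
      using flip_step_neq[OF assms False] by simp
    ultimately have "flip A j \<in> sym_diff {flip A m} {flip (sym_diff A {m}) j}" by (simp only:)
    moreover have "flip A j \<noteq> flip A m" using False by (rule contrapos_nn) (rule flip_inj[OF assms])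
    ultimately show ?thesis by (simp only: Un_iff Diff_iff singleton_iff simp_thms)
  qed
qed

lemma flip_const:
  assumes "A \<subseteq> {..<d}" "j < d"
  shows "flip A j = flip {} j"
  using finite_sub[OF assms(1)] assms(1)
proof (induction A)
  case (insert m A)
  have "flip (sym_diff A {m}) j = flip A j" using insert.prems assms(2) by (intro flip_step) simp_all
  moreover have "sym_diff A {m} = insert m A" using insert.hyps(2) by blast
  ultimately show ?case using insert by simp
qed simp

text \<open>
  Since \<open>flip\<close> does not depend on the set, the deck transformation permutes coordinates by \<open>flip {}\<close> and
  then translates.
\<close>

lemma return_sym_diff:
  assumes "A \<subseteq> {..<d}" "S \<subseteq> {..<d}"
  shows "return (sym_diff A S) = sym_diff (sym_diff (return A) S) (flip {} ` S)"
  using finite_sub[OF assms(2)] assms(2)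
proof (induction S)
  case (insert j S)
  then have j: "j < d" and S: "S \<subseteq> {..<d}" by simp_all
  have AS: "sym_diff A S \<subseteq> {..<d}" using assms(1) S by (rule sym_diff_subset)
  have "flip {} j \<notin> flip {} ` S"
    using flip_inj[of "{}" j] j S insert.hyps(2) by (metis (no_types, lifting) empty_subsetI imageE lessThan_iff subsetD)
  then have img: "sym_diff (flip {} ` S) {flip {} j} = flip {} ` insert j S" by blast
  have "return (sym_diff A (insert j S)) = sym_diff (sym_diff (return (sym_diff A S)) {j}) {flip {} j}"
    by (simp only: sym_diff_insert[OF insert.hyps(2)] return_step[OF AS j] flip_const[OF AS j])
  also have "\<dots> = sym_diff (sym_diff (return A) (sym_diff S {j})) (sym_diff (flip {} ` S) {flip {} j})"
    unfolding insert.IH[OF S] by blast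
  also have "sym_diff S {j} = insert j S" using insert.hyps(2) by blast
  finally show ?case unfolding img .
qed simp

text \<open>
  Both members of the fibre of \<open>{}\<close> have the same return set, and \<open>return_sym_diff\<close> applied to the
  step from one to the other says that this set is permuted by \<open>flip {}\<close>.
\<close>

lemma flip_image_return: "flip {} ` return {} = return {}"
proof -
  let ?T = "return {}"
  have e: "{} \<subseteq> {..<d}" by simp
  note r = return[OF e]
  have w: "walk ?T = walk {}" using r(3) by simp
  have "?T = return ?T"
    using r w by (intro return_unique) simp_all
  also have "\<dots> = return (sym_diff {} ?T)" by simp
  also have "\<dots> = flip {} ` ?T" unfolding return_sym_diff[OF e r(1)] by blast
  finally show ?thesis by (rule sym)
qed

text \<open>
  By \<open>flip_image_return\<close>, the directions \<open>j\<close> and \<open>flip {} j\<close> both belong to \<open>return {}\<close> or both do not.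
  If they were distinct, toggling both would change its size by two, but \<open>return {j}\<close> has the same
  size \<open>g\<close>.
\<close>

lemma flip_id:
  assumes "j < d"
  shows "flip {} j = j"
proof (rule ccontr)
  let ?T = "return {}" and ?k = "flip {} j"
  assume neq: "?k \<noteq> j"
  have e: "{} \<subseteq> {..<d}" by simp
  note r = return[OF e]
  have mem: "?k \<in> ?T \<longleftrightarrow> j \<in> ?T"
  proof
    assume "?k \<in> ?T"
    then have "?k \<in> flip {} ` ?T" by (simp only: flip_image_return)
    then obtain m where m: "m \<in> ?T" "?k = flip {} m" by (elim imageE)
    then have "j = m" using flip_inj[OF e assms] r(1) by blast
    then show "j \<in> ?T" using m(1) by simp
  next
    assume "j \<in> ?T"
    then have "?k \<in> flip {} ` ?T" by (rule imageI)
    then show "?k \<in> ?T" by (simp only: flip_image_return)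
  qed
  have fin: "finite ?T" using finite_sub[OF r(1)] .
  have sub: "{j} \<subseteq> {..<d}" using assms by simp
  have "sym_diff {} {j} = {j}" by simp
  then have "return {j} = sym_diff (sym_diff ?T {j}) {?k}" using return_step[OF e assms] by (simp only:)
  also have "\<dots> = sym_diff ?T {?k, j}" using neq by (intro sym_diff_insert[symmetric]) simp
  finally have "card (sym_diff ?T {?k, j}) = card ?T"
    using card_return[OF sub] card_return[OF e] by (simp only:)
  moreover have "card {?k, j} = 2" using neq by simp
  ultimately have card: "2 * card (?T \<inter> {?k, j}) = 2"
    using card_sym_diff[OF fin, of "{?k, j}"] by simp
  show False
  proof (cases "j \<in> ?T")
    case True
    then have "?T \<inter> {?k, j} = {?k, j}" using mem by simp
    then show False using card \<open>card {?k, j} = 2\<close> by (simp only:)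
  next
    case False
    then have "?T \<inter> {?k, j} = {}" using mem by simp
    then show False using card by simp
  qed
qed

lemma return_const:
  assumes "A \<subseteq> {..<d}"
  shows "return A = return {}"
proof -
  have "flip {} ` A = (\<lambda>j. j) ` A" using assms by (intro image_cong refl flip_id) blast
  then have "return (sym_diff {} A) = sym_diff (sym_diff (return {}) A) A"
    using return_sym_diff[OF empty_subsetI assms] by (simp only: image_ident)
  moreover have "sym_diff {} A = A" by blast
  ultimately show ?thesis by (simp only: sym_diff_cancel)
qed

lemma walk_antipodal: "A \<subseteq> {..<d} \<Longrightarrow> walk (sym_diff A (return {})) = walk A"
  using return(3)[of A] return_const[of A] by simp

text \<open>
  Suppose that the translation by \<open>T = return {}\<close> leaves the coordinate \<open>j\<close> alone, and let \<open>l \<in> T\<close>. The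
  linear map that sends \<open>e\<^sub>j\<close> to \<open>e\<^sub>l\<close> and fixes the other basis vectors fixes \<open>T\<close>, so it induces an
  endomorphism of \<open>Y\<close>. It identifies the neighbours of \<open>walk {}\<close> in directions \<open>j\<close> and \<open>l\<close>, which is
  impossible in a core.
\<close>

lemma return_full_if_core:
  assumes core: "is_core Y"
  shows "return {} = {..<d}"
proof (rule ccontr)
  let ?T = "return {}"
  have e: "{} \<subseteq> {..<d}" by simp
  note r = return[OF e]
  assume "?T \<noteq> {..<d}"
  with r(1) have "?T \<subset> {..<d}" by (rule psubsetI)
  then obtain j where "j \<in> {..<d} - ?T" using psubset_imp_ex_mem by metis
  then have j: "j < d" "j \<notin> ?T" by simp_all
  have "?T \<noteq> {}" using r(2) by (metis card.empty even_zero)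
  then obtain l where l: "l \<in> ?T" by (metis all_not_in_conv)
  with r(1) have "l \<in> {..<d}" by (rule subsetD)
  then have ld: "l < d" by simp
  define ind where "ind A = (if j \<in> A then {l} else {})" for A
  define L where "L A = sym_diff (A - {j}) (ind A)" for A
  have L_sub: "L A \<subseteq> {..<d}" if "A \<subseteq> {..<d}" for A
    unfolding L_def
  proof (rule sym_diff_subset)
    show "A - {j} \<subseteq> {..<d}" using that by blast
    show "ind A \<subseteq> {..<d}" unfolding ind_def using ld by simp
  qed
  have L_linear: "L (sym_diff A B) = sym_diff (L A) (L B)" for A B
  proof -
    have "sym_diff A B - {j} = sym_diff (A - {j}) (B - {j})" by blast
    moreover have "ind (sym_diff A B) = sym_diff (ind A) (ind B)"
      by (cases "j \<in> A"; cases "j \<in> B"; simp add: ind_def)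
    ultimately show ?thesis unfolding L_def by (simp only: sym_diff_interchange)
  qed
  have "L {m} = {if m = j then l else m}" for m
  proof (cases "m = j")
    case False
    then have "{m} - {j} = {m}" by simp
    then show ?thesis using False by (simp add: L_def ind_def)
  qed (simp add: L_def ind_def)
  then have L_step: "L (sym_diff A {m}) = sym_diff (L A) {if m = j then l else m}" for A m
    by (simp only: L_linear)
  have "L ?T = ?T" using j(2) by (simp add: L_def ind_def)
  then have L_T: "L (sym_diff A ?T) = sym_diff (L A) ?T" for A by (simp only: L_linear)
  \<comment> \<open>The choice of \<open>pick v\<close> in the fibre does not matter, because \<open>L\<close> commutes with the translation by \<open>T\<close>.\<close>
  define pick where "pick v = (SOME A. A \<subseteq> {..<d} \<and> walk A = v)" for v
  define f where "f v = walk (L (pick v))" for v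
  have f: "f (walk A) = walk (L A)" if A: "A \<subseteq> {..<d}" for A
  proof -
    have "\<exists>B. B \<subseteq> {..<d} \<and> walk B = walk A" by (intro exI[of _ A] conjI A refl)
    note some = someI_ex[OF this, folded pick_def]
    note p = conjunct1[OF some] conjunct2[OF some]
    from walk_eq_cases[OF A p(1) p(2)[symmetric]] show ?thesis
    proof
      assume "pick (walk A) = A"
      then show ?thesis by (simp only: f_def)
    next
      assume "pick (walk A) = sym_diff A (return A)"
      then show ?thesis by (simp only: f_def return_const[OF A] L_T walk_antipodal[OF L_sub[OF A]])
    qed
  qed
  have "graph_hom f Y Y"
  proof (rule graph_homI)
    fix u v assume uv: "(u, v) \<in> parcs Y"
    have "u \<in> pverts Y" using arc_verts[OF uv] by simp
    then obtain A where A: "A \<subseteq> {..<d}" "u = walk A" by (rule walk_surj)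
    obtain m where m: "m < d" "v = walk (sym_diff A {m})"
      using A(1) uv[unfolded A(2)] by (rule nbr_cases)
    have sub: "sym_diff A {m} \<subseteq> {..<d}" using A(1) m(1) by (intro sym_diff_subset) simp_all
    have less: "(if m = j then l else m) < d" using m(1) ld by simp
    have "f v = walk (sym_diff (L A) {if m = j then l else m})"
      unfolding m(2) f[OF sub] L_step ..
    then show "(f u, f v) \<in> parcs Y"
      using walk_arc[OF L_sub[OF A(1)] less] unfolding A(2) f[OF A(1)] by (simp only:)
  qed (simp add: f_def walk_in_verts)
  with core have "bij_betw f (pverts Y) (pverts Y)" unfolding is_core_def by blast
  then have inj: "inj_on f (pverts Y)" by (rule bij_betw_imp_inj_on)
  have eq: "f (walk {j}) = f (walk {l})"
  proof -
    have "j \<noteq> l" using j(2) l by metis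
    then have "L {j} = {l}" "L {l} = {l}" by (simp_all add: L_def ind_def)
    then show ?thesis using f[of "{j}"] f[of "{l}"] j(1) ld by simp
  qed
  have "walk {j} = walk {l}" by (rule inj_onD[OF inj eq walk_in_verts walk_in_verts])
  then have "j = l" using nbr_inj[OF e j(1) ld] by simp
  then show False using j(2) l by simp
qed

text \<open>
  By \<open>return_full_if_core\<close> antipodal sets are identified and \<open>g = d\<close>, so the folded cube embeds into \<open>Y\<close>.
  It has as many vertices as \<open>Y\<close>.
\<close>

lemma folded_cube_if_core:
  assumes "is_core Y"
  shows "odd d \<and> digraph_iso (with_proj Y) (with_proj (folded_cube d))"
proof
  note full = return_full_if_core[OF assms]
  have g: "g = d" using card_return[of "{}"] full by simp
  show "odd d" using odd_g g by simp
  interpret A: antipodal_cube_walk Y d walk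
  proof
    show "odd d" by fact
    show "walk (sym_diff A {..<d}) = walk A" if "A \<subseteq> {..<d}" for A
      using walk_antipodal[OF that] full by simp
    show "d \<le> k" if "odd k" "(u, u) \<in> parcs Y ^^ k" for k u using shortest[OF that] g by simp
  qed
  let ?F = "folded_cube d" and ?h = "\<lambda>x. walk (supp x)"
  have surj: "?h ` pverts ?F = pverts Y"
  proof (rule card_seteq[OF finite_verts])
    show "?h ` pverts ?F \<subseteq> pverts Y" using walk_in_verts by blast
    have "card (pverts ?F) = 2 ^ (d - 1)"
      using bij_betw_same_card[OF bij_betw_supp[of "d - 1"]] by (simp add: card_Pow)
    then show "card (pverts Y) \<le> card (?h ` pverts ?F)"
      using card_image[OF A.walk_supp_inj] card_verts by simp
  qed
  let ?i = "inv_into (pverts ?F) ?h"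
  have i: "?i u \<in> pverts ?F" "?h (?i u) = u" if "u \<in> pverts Y" for u
    using that unfolding surj[symmetric] by (rule inv_into_into, rule f_inv_into_f)
  have ih: "?i (?h x) = x" if "x \<in> pverts ?F" for x
    using A.walk_supp_inj that by (rule inv_into_f_f)
  show "digraph_iso (with_proj Y) (with_proj ?F)"
  proof (rule digraph_isoI[OF wf])
    show "inj_on ?i (pverts Y)" by (rule inj_on_inverseI[where g = ?h]) (rule i(2))
    show "pverts ?F = ?i ` pverts Y"
      using i(1) ih surj by (metis (no_types, lifting) image_eqI image_subsetI subsetI subset_antisym)
    show "parcs ?F = map_prod ?i ?i ` parcs Y"
    proof (intro equalityI subsetI)
      fix e assume "e \<in> parcs ?F"
      then obtain x y where xy: "e = (x, y)" "(x, y) \<in> parcs ?F" by (cases e) simp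
      have V: "x \<in> pverts ?F" "y \<in> pverts ?F"
        using wf_digraph.tail_in_verts[OF wf_folded_cube, of "(x, y)" d]
          wf_digraph.head_in_verts[OF wf_folded_cube, of "(x, y)" d] xy(2) by simp_all
      have "(?h x, ?h y) \<in> parcs Y" using A.walk_supp_arcs[OF V] xy(2) by simp
      moreover have "e = map_prod ?i ?i (?h x, ?h y)" using ih[OF V(1)] ih[OF V(2)] xy(1) by simp
      ultimately show "e \<in> map_prod ?i ?i ` parcs Y" by (rule image_eqI[rotated])
    next
      fix e assume "e \<in> map_prod ?i ?i ` parcs Y"
      then obtain u v where uv: "(u, v) \<in> parcs Y" "e = (?i u, ?i v)" by auto
      have V: "u \<in> pverts Y" "v \<in> pverts Y" using arc_verts[OF uv(1)] by simp_all
      show "e \<in> parcs ?F"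
        unfolding uv(2) A.walk_supp_arcs[OF i(1)[OF V(1)] i(1)[OF V(2)]] i(2)[OF V(1)] i(2)[OF V(2)]
        by (rule uv(1))
    qed
  qed
qed

end

section \<open>The cube covers the retract\<close>

context connected_cubelike_retract begin

lemma closed_walk_everywhere:
  assumes "u \<in> pverts Y" "v \<in> pverts Y" "(u, u) \<in> parcs Y ^^ k"
  shows "(v, v) \<in> parcs Y ^^ k"
  using relpow_hom[where f = "translate (emb u + emb v)", OF graph_homD(2)[OF graph_hom_translate] assms(3)]
  by (simp only: translate_swap(1)[OF assms(1,2)])

lemma bij_betw_nbrs_translate:
  assumes "u \<in> pverts Y"
  shows "bij_betw (translate z) {w. (u, w) \<in> parcs Y} {w. (translate z u, w) \<in> parcs Y}"
proof (rule bij_betw_imageI)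
  have nbr: "w \<in> pverts Y" if "(v, w) \<in> parcs Y" for v w using arc_verts[OF that] by simp
  show "inj_on (translate z) {w. (u, w) \<in> parcs Y}"
    using retr_inj by (rule inj_on_subset) (use nbr in blast)
  show "translate z ` {w. (u, w) \<in> parcs Y} = {w. (translate z u, w) \<in> parcs Y}"
  proof (intro equalityI image_subsetI subsetI)
    fix w assume "w \<in> {w. (u, w) \<in> parcs Y}"
    then show "translate z w \<in> {w. (translate z u, w) \<in> parcs Y}" using retr_arc by simp
  next
    fix w assume "w \<in> {w. (translate z u, w) \<in> parcs Y}"
    then have w: "(translate z u, w) \<in> parcs Y" by simp
    have "w \<in> translate z ` pverts Y" unfolding translate_surj using nbr[OF w] .
    then obtain x where x: "x \<in> pverts Y" "w = translate z x" by (elim imageE)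
    have "(u, x) \<in> parcs Y"
      using assms x(1) w unfolding x(2) by (rule translate_reflects_arcs)
    then show "w \<in> translate z ` {w. (u, w) \<in> parcs Y}" unfolding x(2) by simp
  qed
qed

text \<open>
  The directions are the edges at one vertex \<open>root\<close>. The translation that moves \<open>root\<close> to \<open>walk A\<close> sends
  the neighbour in direction \<open>j\<close> to \<open>walk (sym_diff A {j})\<close>, so that the neighbours of \<open>root\<close>
  correspond bijectively to those of \<open>walk A\<close>.
\<close>

lemma cube_cover_exists:
  assumes valency: "\<And>v. v \<in> pverts Y \<Longrightarrow> card {w. (v, w) \<in> parcs Y} = d"
  obtains walk where "cube_cover Y d walk"
proof -
  obtain root where root: "root \<in> pverts Y" using nonempty by (metis all_not_in_conv)
  let ?N = "{w. (root, w) \<in> parcs Y}"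
  have "finite ?N" by (rule finite_subset[OF _ finite_verts]) (use arc_verts in auto)
  from ex_bij_betw_nat_finite[OF this] obtain nb where "bij_betw nb {0..<card ?N} ?N" ..
  then have nb: "bij_betw nb {..<d} ?N" by (simp only: valency[OF root] atLeast0LessThan)
  define gen where "gen j = emb root + emb (nb j)" for j
  define walk where "walk A = retr (sum gen (A \<inter> {..<d}) + emb root)" for A
  have nb_arc: "(root, nb j) \<in> parcs Y" if "j < d" for j
    using bij_betwE[OF nb] that by simp
  have walk: "walk A = translate (sum gen A) root" if "A \<subseteq> {..<d}" for A
    using that by (simp only: walk_def Int_absorb2)
  have walk_nbr: "walk (sym_diff A {j}) = translate (sum gen A) (nb j)"
    if A: "A \<subseteq> {..<d}" and j: "j < d" for A j
  proof -
    have "sym_diff A {j} \<subseteq> {..<d}" using A j by (intro sym_diff_subset) simp_all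
    moreover have "sum gen (sym_diff A {j}) = sum gen A + gen j"
      using sum_sym_diff[OF char2 finite_subset[OF A], of "{j}" gen] by simp
    moreover have "sum gen A + gen j + emb root = sum gen A + emb (nb j)"
      unfolding gen_def by (simp only: add.assoc add.commute[of "emb (nb j)"] char2_cancel(1))
    ultimately show ?thesis by (simp only: walk)
  qed
  have "cube_cover Y d walk"
  proof
    show "walk A \<in> pverts Y" for A unfolding walk_def by (rule retr_in_verts)
    show "(walk A, walk (sym_diff A {j})) \<in> parcs Y" if "A \<subseteq> {..<d}" "j < d" for A j
      unfolding walk[OF that(1)] walk_nbr[OF that] using nb_arc[OF that(2)] by (rule retr_arc)
    show "bij_betw (\<lambda>j. walk (sym_diff A {j})) {..<d} {w. (walk A, w) \<in> parcs Y}"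
      if A: "A \<subseteq> {..<d}" for A
    proof -
      have "bij_betw (translate (sum gen A) \<circ> nb) {..<d} {w. (walk A, w) \<in> parcs Y}"
        unfolding walk[OF A] using nb bij_betw_nbrs_translate[OF root] by (rule bij_betw_trans)
      then show ?thesis by (rule bij_betw_cong[THEN iffD1, rotated]) (simp add: walk_nbr[OF A])
    qed
  qed (rule reachable)
  then show ?thesis by (rule that)
qed

text \<open>
  A bipartite graph folds onto any of its edges.
\<close>

lemma bipartite_core_is_K2:
  assumes core: "is_core Y" and ab: "(a, b) \<in> parcs Y"
    and c: "\<forall>(v, w)\<in>parcs Y. c v \<noteq> (c w :: bool)"
  shows "complete_digraph 2 (with_proj Y)"
proof -
  have c: "c v \<noteq> c w" if "(v, w) \<in> parcs Y" for v w using bspec[OF c that] by simp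
  let ?f = "\<lambda>v. if c v = c a then a else b"
  have V: "a \<in> pverts Y" "b \<in> pverts Y" using arc_verts[OF ab] by simp_all
  have "graph_hom ?f Y Y"
  proof (rule graph_homI)
    fix v w assume "(v, w) \<in> parcs Y"
    then have "c v \<noteq> c w" by (rule c)
    then show "(?f v, ?f w) \<in> parcs Y" using ab arcs_sym[OF ab] by (cases "c v = c a") simp_all
  qed (simp add: V)
  with core have "bij_betw ?f (pverts Y) (pverts Y)" unfolding is_core_def by blast
  then have "pverts Y = ?f ` pverts Y" by (rule bij_betw_imp_surj_on[symmetric])
  also have "\<dots> \<subseteq> {a, b}" by auto
  finally have verts: "pverts Y = {a, b}" using V by (intro equalityI) simp_all
  have neq: "a \<noteq> b" using ab no_loop by metis
  have "parcs Y = {(u, v). (u, v) \<in> pverts Y \<times> pverts Y \<and> u \<noteq> v}"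
  proof (intro equalityI subsetI)
    fix e assume e: "e \<in> parcs Y"
    obtain u v where uv: "e = (u, v)" by (cases e)
    then have "u \<noteq> v" using e no_loop by metis
    then show "e \<in> {(u, v). (u, v) \<in> pverts Y \<times> pverts Y \<and> u \<noteq> v}"
      using arc_verts e uv by simp
  next
    fix e assume "e \<in> {(u, v). (u, v) \<in> pverts Y \<times> pverts Y \<and> u \<noteq> v}"
    then have "e = (a, b) \<or> e = (b, a)" unfolding verts by auto
    then show "e \<in> parcs Y" using ab arcs_sym[OF ab] by (elim disjE) simp_all
  qed
  then show ?thesis using neq by (simp add: complete_digraph_pair_def verts)
qed

text \<open>
  The core has an odd closed walk since it is not \<open>K\<^sub>2\<close>. By transitivity a shortest one exists at every
  vertex, and the results on non-bipartite quotients of the cube apply.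
\<close>

lemma core_bound:
  assumes valency: "\<And>v. v \<in> pverts Y \<Longrightarrow> card {w. (v, w) \<in> parcs Y} = d"
    and pos: "0 < d" and core: "is_core Y" and not_K2: "\<not> complete_digraph 2 (with_proj Y)"
  shows "card (pverts Y) \<le> 2 ^ (d - 1)"
    and "card (pverts Y) = 2 ^ (d - 1) \<longleftrightarrow>
      odd d \<and> digraph_iso (with_proj Y) (with_proj (folded_cube d))"
proof -
  obtain walk where cov: "cube_cover Y d walk" using valency by (rule cube_cover_exists)
  obtain a where a: "a \<in> pverts Y" using nonempty by (metis all_not_in_conv)
  have "card {w. (a, w) \<in> parcs Y} \<noteq> 0" using valency[OF a] pos by simp
  then have "{w. (a, w) \<in> parcs Y} \<noteq> {}" by (metis card.empty)
  then obtain b where ab: "(a, b) \<in> parcs Y" by auto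
  let ?P = "\<lambda>k. odd k \<and> (a, a) \<in> parcs Y ^^ k"
  have "\<exists>k. ?P k"
  proof (rule ccontr)
    assume "\<nexists>k. ?P k"
    then have "(a, a) \<notin> parcs Y ^^ k" if "odd k" for k using that by blast
    from bipartite_if_no_odd_closed_walk[OF a this]
    obtain c :: "'a \<Rightarrow> bool" where "\<forall>(v, w)\<in>parcs Y. c v \<noteq> c w" ..
    from bipartite_core_is_K2[OF core ab this] not_K2 show False by simp
  qed
  then have g: "?P (LEAST k. ?P k)" by (rule LeastI_ex)
  define g where "g = (LEAST k. ?P k)"
  have odd: "odd g" and aa: "(a, a) \<in> parcs Y ^^ g" using g unfolding g_def by simp_all
  have "g \<le> k" if "odd k" "(u, u) \<in> parcs Y ^^ k" for k u
  proof -
    have "k \<noteq> 0" using that(1) by (metis even_zero)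
    then obtain k' where "k = Suc k'" by (rule not0_implies_Suc[elim_format]) (elim exE)
    then have "u \<in> pverts Y" using relpow_Suc_D2[of u u k' "parcs Y"] that(2) arc_verts by auto
    then show ?thesis
      using closed_walk_everywhere[OF _ a that(2)] that(1) unfolding g_def by (intro Least_le conjI)
  qed
  with cov odd aa have odd_cov: "odd_cube_cover Y d walk g"
    unfolding odd_cube_cover_def odd_cube_cover_axioms_def
    using closed_walk_everywhere[OF a] by blast
  then interpret odd_cube_cover Y d walk g .
  show "card (pverts Y) \<le> 2 ^ (d - 1)" using pos by (rule card_verts_le_half)
  show "card (pverts Y) = 2 ^ (d - 1) \<longleftrightarrow>
      odd d \<and> digraph_iso (with_proj Y) (with_proj (folded_cube d))"
  proof
    assume "card (pverts Y) = 2 ^ (d - 1)"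
    with odd_cov pos have "half_cube_cover Y d walk g"
      by (simp only: half_cube_cover_def half_cube_cover_axioms_def simp_thms)
    then show "odd d \<and> digraph_iso (with_proj Y) (with_proj (folded_cube d))"
      using core by (rule half_cube_cover.folded_cube_if_core)
  next
    assume "odd d \<and> digraph_iso (with_proj Y) (with_proj (folded_cube d))"
    then obtain f where f: "pre_digraph.digraph_isomorphism (with_proj Y) f"
      and F: "with_proj (folded_cube d) = app_iso f (with_proj Y)"
      unfolding digraph_iso_def by (elim conjE exE)
    have "inj_on (iso_verts f) (pverts Y)"
      using f by (simp add: pre_digraph.digraph_isomorphism_def)
    moreover have "pverts (folded_cube d) = iso_verts f ` pverts Y"
      using arg_cong[OF F, of verts] by (simp only: with_proj_simps verts_app_iso)
    ultimately have "card (pverts Y) = card (pverts (folded_cube d))" by (metis card_image)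
    then show "card (pverts Y) = 2 ^ (d - 1)"
      using bij_betw_same_card[OF bij_betw_supp[of "d - 1"]] by (simp add: card_Pow)
  qed
qed

end

section \<open>Eigenvalues of covered graphs\<close>

text \<open>
  Indexing the rows and columns by vertices turns matrix products into sums over vertex sets.
\<close>

definition kernel_mat :: "'a list \<Rightarrow> 'b list \<Rightarrow> ('a \<Rightarrow> 'b \<Rightarrow> complex) \<Rightarrow> complex mat" where
  "kernel_mat us vs K = mat (length us) (length vs) (\<lambda>(i, j). K (us ! i) (vs ! j))"

lemma kernel_mat_carrier [simp]: "kernel_mat us vs K \<in> carrier_mat (length us) (length vs)"
  by (simp add: kernel_mat_def)

lemma kernel_mat_cong:
  assumes "\<And>u v. u \<in> set us \<Longrightarrow> v \<in> set vs \<Longrightarrow> K u v = L u v"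
  shows "kernel_mat us vs K = kernel_mat us vs L"
  unfolding kernel_mat_def by (rule eq_matI) (simp_all add: assms)

lemma kernel_mat_add:
  "kernel_mat us vs K + kernel_mat us vs L = kernel_mat us vs (\<lambda>u v. K u v + L u v)"
  unfolding kernel_mat_def by (rule eq_matI) simp_all

lemma sum_nth_distinct:
  assumes "distinct vs"
  shows "(\<Sum>k<length vs. f (vs ! k)) = sum f (set vs)"
  by (rule sum.reindex_bij_betw[OF bij_betw_nth[OF assms refl refl]])

lemma kernel_mat_mult:
  assumes "distinct vs"
  shows "kernel_mat us vs K * kernel_mat vs ws L = kernel_mat us ws (\<lambda>u w. \<Sum>v\<in>set vs. K u v * L v w)"
proof (rule eq_matI)
  fix i j assume "i < dim_row (kernel_mat us ws (\<lambda>u w. \<Sum>v\<in>set vs. K u v * L v w))"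
    and "j < dim_col (kernel_mat us ws (\<lambda>u w. \<Sum>v\<in>set vs. K u v * L v w))"
  then have ij: "i < length us" "j < length ws" by (simp_all add: kernel_mat_def)
  then have "(kernel_mat us vs K * kernel_mat vs ws L) $$ (i, j)
      = (\<Sum>k<length vs. K (us ! i) (vs ! k) * L (vs ! k) (ws ! j))"
    by (simp add: kernel_mat_def scalar_prod_def atLeast0LessThan)
  also have "\<dots> = (\<Sum>v\<in>set vs. K (us ! i) v * L v (ws ! j))"
    using sum_nth_distinct[OF assms, of "\<lambda>v. K (us ! i) v * L v (ws ! j)"] .
  finally show "(kernel_mat us vs K * kernel_mat vs ws L) $$ (i, j)
      = kernel_mat us ws (\<lambda>u w. \<Sum>v\<in>set vs. K u v * L v w) $$ (i, j)"
    using ij by (simp add: kernel_mat_def)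
qed (simp_all add: kernel_mat_def)

lemma kernel_mat_one:
  assumes "distinct vs"
  shows "kernel_mat vs vs (\<lambda>u v. of_bool (u = v)) = 1\<^sub>m (length vs)"
  unfolding kernel_mat_def by (rule eq_matI) (simp_all add: nth_eq_iff_index_eq[OF assms])

lemma kernel_mat_append:
  "kernel_mat (us @ vs) (us @ vs) K
    = four_block_mat (kernel_mat us us K) (kernel_mat us vs K) (kernel_mat vs us K) (kernel_mat vs vs K)"
  unfolding kernel_mat_def by (rule eq_matI) (simp_all add: nth_append)

lemma adj_matrix_kernel_mat:
  "adj_matrix G vs = kernel_mat vs vs (\<lambda>u v. of_bool ((u, v) \<in> parcs G))"
  unfolding adj_matrix_def kernel_mat_def by (rule eq_matI) simp_all

lemma sum_of_bool_eq_left: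
  fixes f :: "'a \<Rightarrow> complex"
  assumes "finite A" "a \<in> A"
  shows "(\<Sum>x\<in>A. of_bool (a = x) * f x) = f a"
  using assms by (subst sum.remove[OF assms]) (simp_all add: sum.neutral)

lemma sum_of_bool_eq_right:
  fixes f :: "'a \<Rightarrow> complex"
  assumes "finite A" "a \<in> A"
  shows "(\<Sum>x\<in>A. f x * of_bool (x = a)) = f a"
  using assms by (subst sum.remove[OF assms]) (simp_all add: sum.neutral)

text \<open>
  The conjugating matrix is the permutation matrix between the two orders.
\<close>

lemma similar_adj_matrix:
  assumes "distinct us" "distinct vs" "set us = set vs"
  shows "similar_mat (adj_matrix G us) (adj_matrix G vs)"
proof -
  let ?I = "\<lambda>u v. of_bool (u = v) :: complex" and ?A = "\<lambda>u v. of_bool ((u, v) \<in> parcs G) :: complex"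
  have len: "length us = length vs" using assms by (metis distinct_card)
  have inv: "kernel_mat us' vs' ?I * kernel_mat vs' us' ?I = 1\<^sub>m (length us')"
    if "distinct us'" "distinct vs'" "set us' = set vs'" for us' vs' :: "'a list"
  proof -
    have "kernel_mat us' vs' ?I * kernel_mat vs' us' ?I
        = kernel_mat us' us' (\<lambda>u w. \<Sum>v\<in>set vs'. ?I u v * ?I v w)"
      by (rule kernel_mat_mult[OF that(2)])
    also have "\<dots> = kernel_mat us' us' ?I"
      using that(3) by (intro kernel_mat_cong sum_of_bool_eq_left) simp_all
    finally show ?thesis by (simp only: kernel_mat_one[OF that(1)])
  qed
  have "kernel_mat us vs ?I * kernel_mat vs vs ?A = kernel_mat us vs ?A"
    unfolding kernel_mat_mult[OF assms(2)]
    using assms(3) by (intro kernel_mat_cong sum_of_bool_eq_left) simp_all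
  moreover have "kernel_mat us vs ?A * kernel_mat vs us ?I = kernel_mat us us ?A"
    unfolding kernel_mat_mult[OF assms(2)]
    using assms(3) by (intro kernel_mat_cong sum_of_bool_eq_right) simp_all
  ultimately have "kernel_mat us us ?A = kernel_mat us vs ?I * kernel_mat vs vs ?A * kernel_mat vs us ?I"
    by (simp only:)
  moreover have "{kernel_mat us us ?A, kernel_mat vs vs ?A, kernel_mat us vs ?I, kernel_mat vs us ?I}
      \<subseteq> carrier_mat (length vs) (length vs)"
    using kernel_mat_carrier[of us us ?A] kernel_mat_carrier[of us vs ?I]
      kernel_mat_carrier[of vs us ?I] kernel_mat_carrier[of vs vs ?A] unfolding len by simp
  ultimately show ?thesis
    unfolding adj_matrix_kernel_mat
    using inv[OF assms] inv[OF assms(2,1) assms(3)[symmetric]] len by (intro similar_matI) simp_all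
qed

lemma eigenvalues_eq:
  assumes "distinct vs" "set vs = pverts G"
  shows "eigenvalues G = proots (char_poly (adj_matrix G vs))"
proof -
  let ?us = "SOME us. distinct us \<and> set us = pverts G"
  have "\<exists>us. distinct us \<and> set us = pverts G" using assms by (intro exI[of _ vs] conjI)
  from someI_ex[OF this] have us: "distinct ?us" "set ?us = set vs" using assms(2) by simp_all
  show ?thesis
    unfolding eigenvalues_def char_poly_similar[OF similar_adj_matrix[OF us(1) assms(1) us(2)]] ..
qed

lemma char_poly_upper_block:
  fixes B C D :: "'a :: idom mat"
  assumes "B \<in> carrier_mat m m" "C \<in> carrier_mat m n" "D \<in> carrier_mat n n"
  shows "char_poly (four_block_mat B C (0\<^sub>m n m) D) = char_poly B * char_poly D"
proof -
  let ?cm = "\<lambda>A. [:0, 1:] \<cdot>\<^sub>m 1\<^sub>m (dim_row A) + map_mat (\<lambda>a. [:- a:]) A"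
  let ?M = "four_block_mat B C (0\<^sub>m n m) D"
  have "?cm ?M = four_block_mat (?cm B) (map_mat (\<lambda>a. [:- a:]) C) (0\<^sub>m n m) (?cm D)"
    using assms by (intro eq_matI) (auto simp: one_poly_def)
  moreover have "det \<dots> = det (?cm B) * det (?cm D)"
    using assms by (intro det_four_block_mat_lower_left_zero[of _ m _ n]) auto
  ultimately show ?thesis unfolding char_poly_defs by (simp only:)
qed

text \<open>
  The columns of \<open>1\<close> above \<open>F\<close> span a subspace on which the block matrix acts as \<open>B\<close>. Conjugation by
  the unitriangular matrix that completes these columns makes it block upper triangular with \<open>B\<close> in the
  upper left corner.
\<close>

lemma char_poly_dvd_if_invariant_graph:
  fixes A11 A12 A21 A22 B F :: "complex mat"
  assumes carr: "A11 \<in> carrier_mat m m" "A12 \<in> carrier_mat m n" "A21 \<in> carrier_mat n m"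
      "A22 \<in> carrier_mat n n" "B \<in> carrier_mat m m" "F \<in> carrier_mat n m"
    and top: "A11 + A12 * F = B" and bottom: "A21 + A22 * F = F * B"
  shows "char_poly B dvd char_poly (four_block_mat A11 A12 A21 A22)"
proof -
  let ?A = "four_block_mat A11 A12 A21 A22"
  define W where "W = A22 - F * A12"
  define N where "N = - F"
  let ?T = "four_block_mat B A12 (0\<^sub>m n m) W"
  let ?P = "four_block_mat (1\<^sub>m m) (0\<^sub>m m n) F (1\<^sub>m n)"
  let ?Q = "four_block_mat (1\<^sub>m m) (0\<^sub>m m n) N (1\<^sub>m n)"
  have FA: "F * A12 \<in> carrier_mat n n" "F * B \<in> carrier_mat n m" "A12 * F \<in> carrier_mat m m"
    "A22 * F \<in> carrier_mat n m" using carr by (auto intro: mult_carrier_mat)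
  have W: "W \<in> carrier_mat n n" unfolding W_def using FA(1) by (rule minus_carrier_mat)
  have N: "N \<in> carrier_mat n m" unfolding N_def using carr(6) by simp
  note I = one_carrier_mat[of m] one_carrier_mat[of n] zero_carrier_mat[of m n] zero_carrier_mat[of n m]
  have cancel: "X + - Y = Z" if "X = Z + Y" "Y \<in> carrier_mat a b" "Z \<in> carrier_mat a b"
    for X Y Z :: "complex mat" and a b
    unfolding that(1) using that(2,3) by (intro eq_matI) simp_all
  have cancel_minus: "Y + (X - Y) = X" if "X \<in> carrier_mat a b" "Y \<in> carrier_mat a b"
    for X Y :: "complex mat" and a b
    using that by (intro eq_matI) simp_all
  have block_mult: "four_block_mat A' B' C' D' * four_block_mat A'' B'' C'' D'' = four_block_mat
      (A' * A'' + B' * C'') (A' * B'' + B' * D'') (C' * A'' + D' * C'') (C' * B'' + D' * D'')"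
    if "A' \<in> carrier_mat m m" "B' \<in> carrier_mat m n" "C' \<in> carrier_mat n m" "D' \<in> carrier_mat n n"
      "A'' \<in> carrier_mat m m" "B'' \<in> carrier_mat m n" "C'' \<in> carrier_mat n m" "D'' \<in> carrier_mat n n"
    for A' B' C' D' A'' B'' C'' D'' :: "complex mat"
    using that by (rule mult_four_block_mat)
  have "F + N = 0\<^sub>m n m" "N + F = 0\<^sub>m n m" unfolding N_def using carr(6) by (intro eq_matI; simp)+
  then have inv: "?P * ?Q = 1\<^sub>m (m + n)" "?Q * ?P = 1\<^sub>m (m + n)"
    unfolding block_mult[OF I(1,3) carr(6) I(2) I(1,3) N I(2)] block_mult[OF I(1,3) N I(2) I(1,3) carr(6) I(2)]
    using carr(6) N by simp_all
  have "?P * ?T = four_block_mat B A12 (F * B) (F * A12 + W)"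
    unfolding block_mult[OF I(1,3) carr(6) I(2) carr(5,2) I(4) W]
    unfolding left_mult_one_mat[OF carr(5)] left_mult_one_mat[OF carr(2)] left_mult_one_mat[OF W]
      left_mult_zero_mat[OF I(4)] left_mult_zero_mat[OF W] right_mult_zero_mat[OF I(2)]
      right_add_zero_mat[OF carr(5)] right_add_zero_mat[OF carr(2)] right_add_zero_mat[OF FA(2)] ..
  also have "F * A12 + W = A22"
    unfolding W_def using carr(4) FA(1) by (rule cancel_minus)
  finally have PT: "?P * ?T = four_block_mat B A12 (F * B) A22" .
  have "?P * ?T * ?Q = four_block_mat (B + A12 * N) A12 (F * B + A22 * N) A22"
    unfolding PT block_mult[OF carr(5,2) FA(2) carr(4) I(1,3) N I(2)]
    using carr FA N by (simp only: right_mult_one_mat right_mult_zero_mat left_add_zero_mat)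
  also have "A12 * N = - (A12 * F)"
    unfolding N_def using carr(2,6) by (intro eq_matI) simp_all
  also have "B + - (A12 * F) = A11"
    using top[symmetric] FA(3) carr(1) by (rule cancel)
  also have "A22 * N = - (A22 * F)"
    unfolding N_def using carr(4,6) by (intro eq_matI) simp_all
  also have "F * B + - (A22 * F) = A21"
    using bottom[symmetric] FA(4) carr(3) by (rule cancel)
  finally have "?A = ?P * ?T * ?Q" by (rule sym)
  moreover have "{?A, ?T, ?P, ?Q} \<subseteq> carrier_mat (m + n) (m + n)" using carr W by simp
  ultimately have "similar_mat ?A ?T" using inv by (intro similar_matI)
  then have "char_poly ?A = char_poly B * char_poly W"
    using char_poly_similar char_poly_upper_block[OF carr(5,2) W] by metis
  then show ?thesis by simp
qed

text \<open>
  Functions on \<open>H\<close> pulled back along \<open>\<phi>\<close> form a subspace that the adjacency matrix of \<open>G\<close> leaves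
  invariant and on which it acts as that of \<open>H\<close>, because \<open>\<phi>\<close> is bijective on neighbourhoods. To
  see the blocks, the vertices of \<open>G\<close> are listed with a transversal \<open>S\<close> of the fibres first.
\<close>

lemma eigenvalues_covering_map:
  assumes cov: "covering_map \<phi> G H" and fin: "finite (pverts G)"
    and arcs: "\<And>u v. (u, v) \<in> parcs G \<Longrightarrow> v \<in> pverts G"
  shows "eigenvalues H \<subseteq># eigenvalues G"
proof -
  have surj: "\<phi> ` pverts G = pverts H" and hom: "graph_hom \<phi> G H"
    and bij: "\<And>u. u \<in> pverts G \<Longrightarrow> bij_betw \<phi> {v. (u, v) \<in> parcs G} {w. (\<phi> u, w) \<in> parcs H}"
    using cov by (simp_all add: covering_map_def)
  obtain S where S: "S \<subseteq> pverts G" "inj_on \<phi> S" "\<phi> ` S = pverts H"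
    using subset_image_inj[of "pverts H" \<phi> "pverts G"] surj by auto
  obtain us where us: "set us = S" "distinct us"
    using finite_distinct_list[OF finite_subset[OF S(1) fin]] by metis
  obtain vs where vs: "set vs = pverts G - S" "distinct vs"
    using finite_distinct_list[OF finite_Diff[OF fin]] by metis
  let ?A = "\<lambda>u v. of_bool ((u, v) \<in> parcs G) :: complex"
  let ?B = "\<lambda>u v. of_bool ((\<phi> u, \<phi> v) \<in> parcs H) :: complex"
  let ?F = "\<lambda>u v. of_bool (\<phi> u = \<phi> v) :: complex"
  have H: "adj_matrix H (map \<phi> us) = kernel_mat us us ?B"
    unfolding adj_matrix_def kernel_mat_def by (rule eq_matI) simp_all
  have count: "?A u w + (\<Sum>v\<in>set vs. ?A u v * ?F v w) = ?B u w"
    if u: "u \<in> pverts G" and w: "w \<in> S" for u w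
  proof -
    have "(\<Sum>v\<in>S. ?A u v * ?F v w) = (\<Sum>v\<in>S. ?A u v * of_bool (v = w))"
      using S(2) w by (intro sum.cong refl) (simp add: inj_on_eq_iff)
    also have "\<dots> = ?A u w" using finite_subset[OF S(1) fin] w by (rule sum_of_bool_eq_right)
    finally have "?A u w + (\<Sum>v\<in>set vs. ?A u v * ?F v w) = (\<Sum>v\<in>pverts G. ?A u v * ?F v w)"
      using sum.subset_diff[OF S(1) fin, of "\<lambda>v. ?A u v * ?F v w"] by (simp add: vs(1))
    also have "\<dots> = (\<Sum>v\<in>{v. (u, v) \<in> parcs G}. of_bool (\<phi> v = \<phi> w))"
      using arcs fin by (intro sum.mono_neutral_cong_right) auto
    also have "\<dots> = (\<Sum>x\<in>{x. (\<phi> u, x) \<in> parcs H}. of_bool (x = \<phi> w))"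
      by (rule sum.reindex_bij_betw[OF bij[OF u]])
    also have "\<dots> = ?B u w"
    proof -
      have "finite {v. (u, v) \<in> parcs G}" by (rule finite_subset[OF _ fin]) (use arcs in auto)
      then have "finite {x. (\<phi> u, x) \<in> parcs H}" using bij_betw_finite[OF bij[OF u]] by simp
      then show ?thesis by (simp add: of_bool_def)
    qed
    finally show ?thesis .
  qed
  have pick: "(\<Sum>v\<in>set us. ?F u v * ?B v w) = ?B u w" if u: "u \<in> pverts G" for u w
  proof -
    have "\<phi> u \<in> \<phi> ` S" using u surj S(3) by auto
    then obtain s where s: "s \<in> S" "\<phi> u = \<phi> s" by (elim imageE)
    have "(\<Sum>v\<in>S. ?F u v * ?B v w) = (\<Sum>v\<in>S. of_bool (s = v) * ?B v w)"
      using S(2) s(1) unfolding s(2) by (intro sum.cong refl) (simp add: inj_on_eq_iff)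
    also have "\<dots> = ?B s w" using finite_subset[OF S(1) fin] s(1) by (rule sum_of_bool_eq_left)
    finally show ?thesis unfolding us(1) s(2) .
  qed
  have "char_poly (kernel_mat us us ?B) dvd char_poly (four_block_mat
      (kernel_mat us us ?A) (kernel_mat us vs ?A) (kernel_mat vs us ?A) (kernel_mat vs vs ?A))"
  proof (rule char_poly_dvd_if_invariant_graph)
    show "kernel_mat us us ?A + kernel_mat us vs ?A * kernel_mat vs us ?F = kernel_mat us us ?B"
      unfolding kernel_mat_mult[OF vs(2)] kernel_mat_add
      using S(1) us(1) by (intro kernel_mat_cong count) auto
    have "kernel_mat vs us ?A + kernel_mat vs vs ?A * kernel_mat vs us ?F = kernel_mat vs us ?B"
      unfolding kernel_mat_mult[OF vs(2)] kernel_mat_add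
      using us(1) vs(1) by (intro kernel_mat_cong count) auto
    moreover have "kernel_mat vs us ?F * kernel_mat us us ?B = kernel_mat vs us ?B"
      unfolding kernel_mat_mult[OF us(2)]
      using us(1) vs(1) by (intro kernel_mat_cong pick) auto
    ultimately show "kernel_mat vs us ?A + kernel_mat vs vs ?A * kernel_mat vs us ?F
        = kernel_mat vs us ?F * kernel_mat us us ?B" by (simp only:)
  qed (rule kernel_mat_carrier)+
  then have "char_poly (adj_matrix H (map \<phi> us)) dvd char_poly (adj_matrix G (us @ vs))"
    unfolding H adj_matrix_kernel_mat[of G] kernel_mat_append .
  then obtain q where q: "char_poly (adj_matrix G (us @ vs)) = char_poly (adj_matrix H (map \<phi> us)) * q"
    by (elim dvdE)
  have "char_poly (adj_matrix G (us @ vs)) \<noteq> 0"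
    using degree_monic_char_poly[of "adj_matrix G (us @ vs)" "length (us @ vs)"]
    by (auto simp: adj_matrix_def)
  then have nz: "char_poly (adj_matrix H (map \<phi> us)) \<noteq> 0" "q \<noteq> 0" unfolding q by simp_all
  have "eigenvalues G = proots (char_poly (adj_matrix G (us @ vs)))"
    using us vs S(1) by (intro eigenvalues_eq) auto
  also have "\<dots> = proots (char_poly (adj_matrix H (map \<phi> us))) + proots q"
    unfolding q using nz by (rule proots_mult)
  also have "proots (char_poly (adj_matrix H (map \<phi> us))) = eigenvalues H"
    using us S by (intro eigenvalues_eq[symmetric]) (simp_all add: distinct_map)
  finally show ?thesis by simp
qed

subsection \<open>The eigenvalues of the cube are integers\<close>

text \<open>
  Toggling one direction is an involution that commutes with the adjacency operator, and these
  involutions commute with each other. If \<open>F\<close> is not negated by toggling \<open>k\<close>, then adding to \<open>F\<close> its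
  image under the involution gives a nonzero eigenfunction invariant under it.
\<close>

lemma cube_eigenfunction_with_signs:
  fixes F :: "nat set \<Rightarrow> complex"
  assumes "\<exists>A\<subseteq>{..<d}. F A \<noteq> 0"
    and "\<forall>A\<subseteq>{..<d}. (\<Sum>j<d. F (sym_diff A {j})) = l * F A" and "k \<le> d"
  shows "\<exists>F. (\<exists>A\<subseteq>{..<d}. F A \<noteq> 0) \<and> (\<forall>A\<subseteq>{..<d}. (\<Sum>j<d. F (sym_diff A {j})) = l * F A) \<and>
    (\<forall>j<k. \<exists>s\<in>{1, - 1}. \<forall>A\<subseteq>{..<d}. F (sym_diff A {j}) = s * (F A :: complex))"
  using assms(3)
proof (induction k)
  case 0
  show ?case using assms(1,2) by (intro exI[of _ F] conjI allI impI) simp_all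
next
  case (Suc k)
  then obtain F where nz: "\<exists>A\<subseteq>{..<d}. F A \<noteq> 0"
    and eig: "\<forall>A\<subseteq>{..<d}. (\<Sum>j<d. F (sym_diff A {j})) = l * F A"
    and signs: "\<forall>j<k. \<exists>s\<in>{1, - 1}. \<forall>A\<subseteq>{..<d}. F (sym_diff A {j}) = s * (F A :: complex)" by auto
  have k: "k < d" using Suc.prems by simp
  show ?case
  proof (cases "\<forall>A\<subseteq>{..<d}. F (sym_diff A {k}) = - 1 * F A")
    case True
    then have "\<forall>j<Suc k. \<exists>s\<in>{1, - 1}. \<forall>A\<subseteq>{..<d}. F (sym_diff A {j}) = s * F A"
      using signs by (metis insertCI less_Suc_eq)
    with nz eig show ?thesis by blast
  next
    case False
    define G where "G A = F A + F (sym_diff A {k})" for A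
    have sub: "sym_diff A {k} \<subseteq> {..<d}" if "A \<subseteq> {..<d}" for A
      using that k by (intro sym_diff_subset) simp_all
    have swap: "sym_diff (sym_diff A {j}) {k} = sym_diff (sym_diff A {k}) {j}" for A j by blast
    from False obtain A where "A \<subseteq> {..<d}" "F (sym_diff A {k}) \<noteq> - 1 * F A" by blast
    then have "\<exists>A\<subseteq>{..<d}. G A \<noteq> 0" unfolding G_def by (metis add.commute add_eq_0_iff mult_minus1)
    moreover have "(\<Sum>j<d. G (sym_diff A {j})) = l * G A" if A: "A \<subseteq> {..<d}" for A
    proof -
      have "(\<Sum>j<d. G (sym_diff A {j})) = (\<Sum>j<d. F (sym_diff A {j})) + (\<Sum>j<d. F (sym_diff (sym_diff A {k}) {j}))"
        unfolding G_def swap by (rule sum.distrib)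
      then show ?thesis using eig A sub[OF A] by (simp add: G_def distrib_left)
    qed
    moreover have "\<exists>s\<in>{1, - 1}. \<forall>A\<subseteq>{..<d}. G (sym_diff A {j}) = s * G A" if "j < Suc k" for j
    proof (cases "j = k")
      case True
      have "G (sym_diff A {j}) = 1 * G A" for A
        unfolding G_def True sym_diff_cancel by simp
      then show ?thesis by blast
    next
      case False
      with that have "j < k" by simp
      with signs obtain s where s: "s \<in> {1, - 1}" "\<forall>A\<subseteq>{..<d}. F (sym_diff A {j}) = s * F A" by blast
      have "G (sym_diff A {j}) = s * G A" if A: "A \<subseteq> {..<d}" for A
        using s(2) A sub[OF A] unfolding G_def swap by (simp add: distrib_left)
      with s(1) show ?thesis by blast
    qed
    ultimately show ?thesis by blast
  qed
qed

text \<open>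
  For a common eigenfunction of all involutions, the eigenvalue of their sum is a sum of signs.
\<close>

lemma cube_eigenfunction_integer:
  fixes F :: "nat set \<Rightarrow> complex"
  assumes "\<exists>A\<subseteq>{..<d}. F A \<noteq> 0"
    and "\<forall>A\<subseteq>{..<d}. (\<Sum>j<d. F (sym_diff A {j})) = l * F A"
  shows "l \<in> \<int>"
proof -
  from cube_eigenfunction_with_signs[OF assms order_refl] obtain F :: "nat set \<Rightarrow> complex"
    where nz: "\<exists>A\<subseteq>{..<d}. F A \<noteq> 0"
      and eig: "\<forall>A\<subseteq>{..<d}. (\<Sum>j<d. F (sym_diff A {j})) = l * F A"
      and signs: "\<forall>j<d. \<exists>s\<in>{1, - 1}. \<forall>A\<subseteq>{..<d}. F (sym_diff A {j}) = s * F A"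
    by blast
  from signs have "\<forall>j\<in>{..<d}. \<exists>s. s \<in> {1, - 1} \<and> (\<forall>A\<subseteq>{..<d}. F (sym_diff A {j}) = s * F A)" by blast
  from bchoice[OF this] obtain s
    where s: "\<forall>j\<in>{..<d}. s j \<in> {1, - 1} \<and> (\<forall>A\<subseteq>{..<d}. F (sym_diff A {j}) = s j * F A)" ..
  obtain A where A: "A \<subseteq> {..<d}" "F A \<noteq> 0" using nz by blast
  have "l * F A = (\<Sum>j<d. F (sym_diff A {j}))" using eig A(1) by simp
  also have "\<dots> = (\<Sum>j<d. s j * F A)" using s A(1) by (intro sum.cong refl) simp
  finally have "l * F A = (\<Sum>j<d. s j) * F A" by (simp only: sum_distrib_right)
  then have l: "l = (\<Sum>j<d. s j)" using A(2) by simp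
  have "s j \<in> \<int>" if "j \<in> {..<d}" for j
  proof -
    have "s j \<in> {1, - 1}" using s that by blast
    then show ?thesis by auto
  qed
  then have "(\<Sum>j<d. s j) \<in> \<int>" by (rule Ints_sum)
  then show ?thesis unfolding l .
qed

lemma finite_carrier_bit_vec: "finite (carrier_vec n :: bit vec set)"
  using bij_betw_finite[OF bij_betw_supp[of n]] by simp

text \<open>
  An eigenvector is read as a function on subsets. The index \<open>ix A\<close> of the vertex with support
  \<open>A\<close> translates between the two.
\<close>

lemma eigenvalues_cube_integer:
  assumes "l \<in># eigenvalues (cube d)"
  shows "l \<in> \<int>"
proof -
  obtain vs where vs: "set vs = (carrier_vec d :: bit vec set)" "distinct vs"
    using finite_distinct_list[OF finite_carrier_bit_vec] by metis
  let ?M = "adj_matrix (cube d) vs" and ?n = "length vs"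
  have M: "?M \<in> carrier_mat ?n ?n" by (simp add: adj_matrix_def)
  have "char_poly ?M \<noteq> 0" using degree_monic_char_poly[OF M] by auto
  moreover have "l \<in># proots (char_poly ?M)"
    using assms eigenvalues_eq[OF vs(2), of "cube d"] vs(1) by simp
  ultimately have "poly (char_poly ?M) l = 0" by simp
  then have "eigenvalue ?M l" using eigenvalue_root_char_poly[OF M] by simp
  then obtain v where v: "v \<in> carrier_vec ?n" "v \<noteq> 0\<^sub>v ?n" "?M *\<^sub>v v = l \<cdot>\<^sub>v v"
    using M unfolding eigenvalue_def eigenvector_def by auto
  define ix where "ix A = (THE i. i < ?n \<and> supp (vs ! i) = A)" for A
  have ix: "ix (supp (vs ! i)) = i" if "i < ?n" for i
    unfolding ix_def
  proof (rule the_equality)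
    fix k assume k: "k < ?n \<and> supp (vs ! k) = supp (vs ! i)"
    have "vs ! k \<in> carrier_vec d" "vs ! i \<in> carrier_vec d" using k that vs(1) nth_mem by metis+
    then have "vs ! k = vs ! i" using k supp_inject by metis
    then show "k = i" using k that nth_eq_iff_index_eq[OF vs(2)] by metis
  qed (simp add: that)
  define F where "F A = v $ ix A" for A
  have index: "\<exists>i<?n. A = supp (vs ! i)" if "A \<subseteq> {..<d}" for A
  proof -
    have "A \<in> supp ` set vs" unfolding vs(1) using bij_betw_imp_surj_on[OF bij_betw_supp[of d]] that by simp
    then show ?thesis by (auto simp: in_set_conv_nth)
  qed
  have nth: "vs ! i \<in> carrier_vec d" if "i < ?n" for i
    unfolding vs(1)[symmetric] using that by (rule nth_mem)
  note sub = supp_subset[OF nth]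
  show ?thesis
  proof (rule cube_eigenfunction_integer)
    have "\<exists>i<?n. v $ i \<noteq> 0"
    proof (rule ccontr)
      assume "\<not> (\<exists>i<?n. v $ i \<noteq> 0)"
      then have "v = 0\<^sub>v ?n" using v(1) by (intro eq_vecI) auto
      with v(2) show False by simp
    qed
    then obtain i where "i < ?n" "v $ i \<noteq> 0" by blast
    then show "\<exists>A\<subseteq>{..<d}. F A \<noteq> 0"
      using sub by (intro exI[of _ "supp (vs ! i)"]) (simp add: F_def ix)
    show "\<forall>A\<subseteq>{..<d}. (\<Sum>j<d. F (sym_diff A {j})) = l * F A"
    proof (intro allI impI)
      fix A assume A: "A \<subseteq> {..<d}"
      then obtain i where i: "i < ?n" "A = supp (vs ! i)" using index by blast
      have "l * F A = (?M *\<^sub>v v) $ i" using i v(1,3) by (simp add: F_def ix)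
      also have "\<dots> = (\<Sum>k\<in>{0..<?n}. row ?M i $ k * v $ k)"
        using i(1) v(1) M by (simp only: index_mult_mat_vec scalar_prod_def carrier_matD carrier_vecD)
      also have "\<dots> = (\<Sum>k\<in>{0..<?n}. of_bool ((vs ! i, vs ! k) \<in> parcs (cube d)) * F (supp (vs ! k)))"
        using i(1) by (intro sum.cong refl) (simp add: adj_matrix_def F_def ix)
      also have "\<dots> = (\<Sum>k<?n. of_bool ((vs ! i, vs ! k) \<in> parcs (cube d)) * F (supp (vs ! k)))"
        by (simp only: atLeast0LessThan)
      also have "\<dots> = (\<Sum>y\<in>carrier_vec d. of_bool ((vs ! i, y) \<in> parcs (cube d)) * F (supp y))"
        using sum_nth_distinct[OF vs(2), of "\<lambda>y. of_bool ((vs ! i, y) \<in> parcs (cube d)) * F (supp y)"]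
        by (simp only: vs(1))
      also have "\<dots> = (\<Sum>B\<in>Pow {..<d}. of_bool (\<exists>j<d. sym_diff A B = {j}) * F B)"
      proof -
        have "(\<Sum>y\<in>carrier_vec d. of_bool ((vs ! i, y) \<in> parcs (cube d)) * F (supp y))
            = (\<Sum>y\<in>carrier_vec d. of_bool (\<exists>j<d. sym_diff A (supp y) = {j}) * F (supp y))"
          unfolding i(2) by (intro sum.cong refl) (simp add: arcs_cube[OF nth[OF i(1)]])
        also have "\<dots> = (\<Sum>B\<in>Pow {..<d}. of_bool (\<exists>j<d. sym_diff A B = {j}) * F B)"
          by (rule sum.reindex_bij_betw[OF bij_betw_supp])
        finally show ?thesis .
      qed
      also have "\<dots> = (\<Sum>B\<in>(\<lambda>j. sym_diff A {j}) ` {..<d}. F B)"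
      proof (rule sum.mono_neutral_cong_right)
        show "(\<lambda>j. sym_diff A {j}) ` {..<d} \<subseteq> Pow {..<d}"
        proof (rule image_subsetI)
          fix j assume "j \<in> {..<d}"
          then show "sym_diff A {j} \<in> Pow {..<d}" using A by (intro PowI sym_diff_subset) simp_all
        qed
        have in_img: "B \<in> (\<lambda>j. sym_diff A {j}) ` {..<d} \<longleftrightarrow> (\<exists>j<d. sym_diff A B = {j})" for B
        proof
          assume "B \<in> (\<lambda>j. sym_diff A {j}) ` {..<d}"
          then obtain j where j: "j < d" "B = sym_diff A {j}" by auto
          have "sym_diff A B = {j}" unfolding j(2) by (rule sym_diff_cancel_left)
          with j(1) show "\<exists>j<d. sym_diff A B = {j}" by blast
        next
          assume "\<exists>j<d. sym_diff A B = {j}"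
          then obtain j where j: "j < d" "sym_diff A B = {j}" by (elim exE conjE)
          have "B = sym_diff A {j}" unfolding j(2)[symmetric] by (rule sym_diff_cancel_left[symmetric])
          with j(1) show "B \<in> (\<lambda>j. sym_diff A {j}) ` {..<d}" by simp
        qed
        show "\<forall>B\<in>Pow {..<d} - (\<lambda>j. sym_diff A {j}) ` {..<d}. of_bool (\<exists>j<d. sym_diff A B = {j}) * F B = 0"
        proof
          fix B assume "B \<in> Pow {..<d} - (\<lambda>j. sym_diff A {j}) ` {..<d}"
          then have "\<not> (\<exists>j<d. sym_diff A B = {j})" using in_img[of B] by simp
          then show "of_bool (\<exists>j<d. sym_diff A B = {j}) * F B = 0" by (simp only: of_bool_eq mult_zero_left)
        qed
        fix B assume "B \<in> (\<lambda>j. sym_diff A {j}) ` {..<d}"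
        then show "of_bool (\<exists>j<d. sym_diff A B = {j}) * F B = F B"
          unfolding in_img by (simp only: of_bool_eq mult_1_left)
      qed simp
      also have "\<dots> = (\<Sum>j<d. F (sym_diff A {j}))"
      proof (rule sum.reindex[unfolded comp_def])
        show "inj_on (\<lambda>j. sym_diff A {j}) {..<d}"
          by (rule inj_onI) (metis sym_diff_cancel_left singleton_inject)
      qed
      finally show "(\<Sum>j<d. F (sym_diff A {j})) = l * F A" by (rule sym)
    qed
  qed
qed

section \<open>Connected components\<close>

lemma rtrancl_on_restrict:
  assumes "(u, v) \<in> rtrancl_on S R"
  shows "(u, v) \<in> rtrancl_on S (R \<inter> S \<times> S)"
  using assms by (induction rule: rtrancl_on_induct) (auto intro: rtrancl_on_into_rtrancl_on)

text \<open>
  The graph induced on the vertices reachable from some \<open>u\<close> in \<open>Y\<close> is connected and contains \<open>Y\<close>, so it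
  equals \<open>Y\<close> by maximality.
\<close>

lemma (in simple_graph) connected_component_closure:
  assumes "connected_component_of Y G"
  obtains u where "u \<in> pverts G" "pverts Y = {v. (u, v) \<in> (parcs G)\<^sup>*}"
    "parcs Y = parcs G \<inter> pverts Y \<times> pverts Y"
proof -
  have sub: "subgraph (with_proj Y) (with_proj G)" and conn: "connected (with_proj Y)"
    and max: "\<And>H. subgraph (with_proj Y) H \<Longrightarrow> subgraph H (with_proj G) \<Longrightarrow> connected H \<Longrightarrow> H = with_proj Y"
    using assms unfolding connected_component_of_def pre_digraph.max_subgraph_def by blast+
  have "pverts Y \<noteq> {}" using conn by (auto simp: connected_def strongly_connected_def)
  then obtain u where u: "u \<in> pverts Y" by blast
  have YG: "pverts Y \<subseteq> pverts G" "parcs Y \<subseteq> parcs G" using sub by (auto simp: subgraph_def)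
  define S where "S = {v. (u, v) \<in> (parcs G)\<^sup>*}"
  have uG: "u \<in> pverts G" using u YG(1) by (rule subsetD[rotated])
  have step: "w \<in> S" if "v \<in> S" "(v, w) \<in> parcs G" for v w
    using that by (simp add: S_def)
  have SG: "S \<subseteq> pverts G"
  proof
    fix v assume "v \<in> S"
    then have "(u, v) \<in> (parcs G)\<^sup>*" by (simp add: S_def)
    then show "v \<in> pverts G" by (induction rule: rtrancl_induct) (simp_all add: uG arc_verts)
  qed
  define H where "H = \<lparr>pverts = S, parcs = parcs G \<inter> S \<times> S\<rparr>"
  have YS: "pverts Y \<subseteq> S"
  proof
    fix v assume v: "v \<in> pverts Y"
    have "(u, v) \<in> rtrancl_on (pverts Y) (parcs (mk_symmetric (with_proj Y)))"
      using conn u v by (simp add: connected_def strongly_connected_def reachable_def)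
    then have "(u, v) \<in> (parcs (mk_symmetric (with_proj Y)))\<^sup>*" by (rule rtrancl_on_rtranclI)
    moreover have "parcs (mk_symmetric (with_proj Y)) \<subseteq> parcs G"
    proof
      fix e assume "e \<in> parcs (mk_symmetric (with_proj Y))"
      then obtain a b where "(a, b) \<in> parcs Y" "e = (a, b) \<or> e = (b, a)"
        by (auto simp: parcs_mk_symmetric)
      then show "e \<in> parcs G" using YG(2) arcs_sym[of a b] by (elim disjE) auto
    qed
    ultimately show "v \<in> S" unfolding S_def using rtrancl_mono by blast
  qed
  have symH: "parcs (mk_symmetric (with_proj H)) = parcs G \<inter> S \<times> S"
    unfolding parcs_mk_symmetric H_def using arcs_sym by fastforce
  have "connected (with_proj H)"
    unfolding connected_def
  proof (rule strongly_connectedI)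
    show "verts (with_proj (mk_symmetric (with_proj H))) \<noteq> {}"
      using u YS by (auto simp: H_def)
    fix v w assume "v \<in> verts (with_proj (mk_symmetric (with_proj H)))"
      "w \<in> verts (with_proj (mk_symmetric (with_proj H)))"
    then have vw: "v \<in> S" "w \<in> S" by (simp_all add: H_def)
    then have "(u, v) \<in> (parcs G)\<^sup>*" "(u, w) \<in> (parcs G)\<^sup>*" by (simp_all add: S_def)
    moreover from this(1) have "(v, u) \<in> (parcs G)\<^sup>*" using sym_rtrancl[OF sym_parcs] by (rule symD[rotated])
    ultimately have "(v, w) \<in> (parcs G)\<^sup>*" by (metis rtrancl_trans)
    then have "(v, w) \<in> rtrancl_on S (parcs G)"
      using vw step by (rule rtrancl_consistent_rtrancl_on)
    then have "(v, w) \<in> rtrancl_on S (parcs G \<inter> S \<times> S)" by (rule rtrancl_on_restrict)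
    then show "v \<rightarrow>\<^sup>*\<^bsub>with_proj (mk_symmetric (with_proj H))\<^esub> w"
      unfolding reachable_def with_proj_simps symH by (simp add: H_def)
  qed
  moreover have "wf_digraph (with_proj H)" by (auto simp: wf_digraph_def H_def)
  moreover from this have "subgraph (with_proj H) (with_proj G)"
    using SG wf by (auto simp: subgraph_def H_def)
  moreover have "subgraph (with_proj Y) (with_proj H)"
  proof -
    have "wf_digraph (with_proj Y)" using sub by (simp add: subgraph_def)
    moreover have "parcs Y \<subseteq> parcs G \<inter> S \<times> S"
    proof
      fix e assume e: "e \<in> parcs Y"
      have "fst e \<in> S" "snd e \<in> S"
        using wf_digraph.tail_in_verts[OF \<open>wf_digraph (with_proj Y)\<close>, of e]
          wf_digraph.head_in_verts[OF \<open>wf_digraph (with_proj Y)\<close>, of e] e YS by auto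
      then show "e \<in> parcs G \<inter> S \<times> S" using e YG(2) by (cases e) auto
    qed
    ultimately show ?thesis
      using \<open>wf_digraph (with_proj H)\<close> YS by (auto simp: subgraph_def H_def)
  qed
  ultimately have eq: "with_proj H = with_proj Y" using max by metis
  have "pverts H = pverts Y" "parcs H = parcs Y"
    using arg_cong[OF eq, of verts] arg_cong[OF eq, of arcs] by (simp_all only: with_proj_simps)
  then have "pverts Y = S" "parcs Y = parcs G \<inter> S \<times> S" by (simp_all add: H_def)
  then show ?thesis using that[OF uG] by (simp add: S_def)
qed

context cubelike_retract begin

definition conn_span :: "'v set" where
  "conn_span = {sum_list xs | xs. set xs \<subseteq> conn}"

lemma conn_span_0: "0 \<in> conn_span"
  unfolding conn_span_def by (intro CollectI exI[of _ "[]"]) simp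

lemma conn_span_add:
  assumes "x \<in> conn_span" "y \<in> conn_span"
  shows "x + y \<in> conn_span"
proof -
  obtain xs ys where "x = sum_list xs" "set xs \<subseteq> conn" "y = sum_list ys" "set ys \<subseteq> conn"
    using assms by (auto simp: conn_span_def)
  then show ?thesis unfolding conn_span_def by (intro CollectI exI[of _ "xs @ ys"]) simp
qed

lemma emb_add_in_conn_span:
  assumes "(u, v) \<in> (parcs Y)\<^sup>*"
  shows "emb u + emb v \<in> conn_span"
proof -
  from assms obtain k where "(u, v) \<in> parcs Y ^^ k" using rtrancl_imp_relpow by blast
  then obtain xs where "set xs \<subseteq> conn" "sum_list xs = emb u + emb v" by (rule walk_of_conn_list)
  then show ?thesis unfolding conn_span_def by (intro CollectI exI[of _ xs]) simp
qed

lemma retr_add_conn_span: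
  assumes "k \<in> conn_span"
  shows "(retr z, retr (z + k)) \<in> (parcs Y)\<^sup>*"
proof -
  obtain xs where xs: "k = sum_list xs" "set xs \<subseteq> conn" using assms by (auto simp: conn_span_def)
  show ?thesis unfolding xs(1) using xs(2)
  proof (induction xs arbitrary: z)
    case (Cons c xs)
    then have "(retr z, retr (z + c)) \<in> parcs Y" "(retr (z + c), retr (z + c + sum_list xs)) \<in> (parcs Y)\<^sup>*"
      using retr_conn by simp_all
    then show ?case by (simp add: add.assoc)
  qed simp
qed

text \<open>
  Moving by a vector of \<open>conn_span\<close> does not leave a component, so the retraction sends every coset
  of \<open>conn_span\<close> into one component. Correcting \<open>z\<close> by a vector \<open>rep z\<close> that depends only on the coset
  of \<open>z\<close>, and adding \<open>emb u0\<close>, makes all cosets lead to the component of \<open>u0\<close>.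
\<close>

lemma component_retract:
  assumes u0: "u0 \<in> pverts Y" and verts: "pverts X = {v. (u0, v) \<in> (parcs Y)\<^sup>*}"
    and arcs: "parcs X = parcs Y \<inter> pverts X \<times> pverts X"
  shows "\<exists>(emb' :: 'a \<Rightarrow> 'v) retr'. connected_cubelike_retract X emb' retr'"
proof -
  define rep where "rep z = (SOME w. z + w \<in> conn_span)" for z
  have rep: "z + rep z \<in> conn_span" for z
    unfolding rep_def by (rule someI[of _ z]) (simp only: char2 conn_span_0)
  have rep_eq: "rep (z + k) = rep z" if k: "k \<in> conn_span" for z k
  proof -
    have "z + k + w \<in> conn_span \<longleftrightarrow> z + w \<in> conn_span" for w
    proof
      assume "z + k + w \<in> conn_span"
      from conn_span_add[OF k this] show "z + w \<in> conn_span"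
        by (simp only: add.assoc add.left_commute[of k z] char2_cancel(1))
    next
      assume "z + w \<in> conn_span"
      from conn_span_add[OF k this] show "z + k + w \<in> conn_span" by (simp add: add_ac)
    qed
    then show ?thesis unfolding rep_def by (simp only:)
  qed
  \<comment> \<open>The summand \<open>rep 0\<close> undoes the correction on the trivial coset, so that \<open>retr' (emb' y) = y\<close>.\<close>
  define emb' where "emb' y = emb y + (emb u0 + rep 0)" for y
  define retr' where "retr' z = retr (emb u0 + (z + rep z))" for z
  have in_X: "y \<in> pverts Y" if "y \<in> pverts X" for y
  proof -
    have "(u0, y) \<in> (parcs Y)\<^sup>*" using that verts by simp
    then show ?thesis by (induction rule: rtrancl_induct) (simp_all add: u0 arc_verts)
  qed
  have emb'_span: "emb' y \<in> conn_span" if "y \<in> pverts X" for y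
  proof -
    have "emb u0 + emb y \<in> conn_span" using that verts by (intro emb_add_in_conn_span) simp
    from conn_span_add[OF this rep[of 0]] show ?thesis by (simp add: emb'_def add_ac)
  qed
  have retr': "retr' (z + emb' y) = translate (z + rep z + rep 0) y" if "y \<in> pverts X" for z y
  proof -
    have "emb u0 + (z + emb' y + rep z) = z + rep z + rep 0 + emb y"
      by (simp add: emb'_def add_ac char2_cancel)
    then show ?thesis unfolding retr'_def rep_eq[OF emb'_span[OF that]] by (simp only:)
  qed
  have retr'_in: "retr' z \<in> pverts X" for z
    using retr_add_conn_span[OF rep[of z], of "emb u0"] u0 by (simp add: retr'_def verts retr_emb)
  have "connected_cubelike_retract X emb' retr'"
  proof
    show "finite (pverts X)" using finite_verts by (rule finite_subset[rotated]) (use in_X in blast)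
    show "u \<in> pverts X \<and> v \<in> pverts X" if "(u, v) \<in> parcs X" for u v
      using that arcs by blast
    show "(v, u) \<in> parcs X" if "(u, v) \<in> parcs X" for u v
      using that arcs_sym[of u v] by (simp add: arcs)
    show "(u, u) \<notin> parcs X" for u using no_loop by (simp add: arcs)
    show "x + x = 0" for x :: 'v by (rule char2)
    show "retr' z \<in> pverts X" for z by (rule retr'_in)
    show "retr' (emb' y) = y" if "y \<in> pverts X" for y
      using retr'[OF that, of 0] in_X[OF that] by (simp add: char2 retr_emb)
    show "(retr' (z + emb' u), retr' (z + emb' v)) \<in> parcs X" if uv: "(u, v) \<in> parcs X" for u v z
    proof -
      have V: "u \<in> pverts X" "v \<in> pverts X" "(u, v) \<in> parcs Y"
        using uv unfolding arcs by simp_all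
      then have "(retr' (z + emb' u), retr' (z + emb' v)) \<in> parcs Y"
        unfolding retr'[OF V(1)] retr'[OF V(2)] by (intro retr_arc)
      then show ?thesis unfolding arcs using retr'_in by simp
    qed
    show "inj_on (\<lambda>u. retr' (z + emb' u)) (pverts X)" for z
    proof (rule inj_onI)
      fix u v assume u: "u \<in> pverts X" and v: "v \<in> pverts X" and eq: "retr' (z + emb' u) = retr' (z + emb' v)"
      show "u = v"
        by (rule inj_onD[OF retr_inj _ in_X[OF u] in_X[OF v], of "z + rep z + rep 0"])
          (use eq retr'[OF u] retr'[OF v] in simp)
    qed
    show "(u, v) \<in> (parcs X)\<^sup>*" if u: "u \<in> pverts X" and v: "v \<in> pverts X" for u v
    proof -
      have from_u0: "(u0, w) \<in> (parcs X)\<^sup>*" if "(u0, w) \<in> (parcs Y)\<^sup>*" for w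
        using that
      proof (induction rule: rtrancl_induct)
        case (step y w)
        then have "(y, w) \<in> parcs X"
          unfolding arcs verts by (auto intro: rtrancl_into_rtrancl)
        with step.IH show ?case by (rule rtrancl_into_rtrancl)
      qed simp
      have "sym (parcs X)" using arcs_sym unfolding arcs by (auto simp: sym_def)
      then have "sym ((parcs X)\<^sup>*)" by (rule sym_rtrancl)
      moreover have "(u0, u) \<in> (parcs X)\<^sup>*" "(u0, v) \<in> (parcs X)\<^sup>*" using u v verts from_u0 by simp_all
      ultimately show ?thesis by (metis symD rtrancl_trans)
    qed
    show "pverts X \<noteq> {}" using verts by auto
  qed
  then show ?thesis by blast
qed

end

section \<open>Cores of cubelike graphs\<close>

text \<open>
  The composition \<open>e\<close> of the homomorphisms \<open>X \<rightarrow> Z \<rightarrow> X\<close> is an automorphism of the core \<open>X\<close>; following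
  it by its inverse \<open>h\<close> makes \<open>Z \<rightarrow> X\<close> a retraction. The space \<open>\<int>\<^sub>2\<^sup>n\<close> is regarded as the first \<open>n\<close> coordinates
  of the functions from \<open>nat\<close> to \<open>bit\<close>, which form a group as a type.
\<close>

lemma core_of_cubelike_retract:
  assumes Z: "cubelike Z" and core: "core_of X Z"
  obtains emb :: "'a \<Rightarrow> nat \<Rightarrow> bit" and retr where "cubelike_retract X emb retr"
proof -
  obtain n C where Zeq: "Z = cayley_graph (Z2_group n) C" using Z unfolding cubelike_def by (elim exE conjE)
  have "simple_graph X" and K: "is_core X" and "homomorphic X Z" "homomorphic Z X"
    using core by (simp_all add: core_of_def hom_equivalent_def simple_graphI)
  then interpret X: simple_graph X by simp
  from \<open>homomorphic X Z\<close> obtain i where i: "graph_hom i X Z" unfolding homomorphic_def ..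
  from \<open>homomorphic Z X\<close> obtain s where s: "graph_hom s Z X" unfolding homomorphic_def ..
  have endo: "bij_betw f (pverts X) (pverts X)" if "graph_hom f X X" for f
    using K that unfolding is_core_def by blast
  define e where "e = (\<lambda>x. s (i x))"
  have e: "graph_hom e X X" unfolding e_def using i s by (rule graph_hom_comp)
  note eb = endo[OF e]
  define h where "h = inv_into (pverts X) e"
  have h_in: "h u \<in> pverts X" "e (h u) = u" if "u \<in> pverts X" for u
    using bij_betw_imp_surj_on[OF eb] that unfolding h_def by (metis inv_into_into, metis f_inv_into_f)
  have h_e: "h (e u) = u" if "u \<in> pverts X" for u
    unfolding h_def using bij_betw_imp_inj_on[OF eb] that by (rule inv_into_f_f)
  have h: "graph_hom h X X"
  proof (rule graph_homI)
    fix u v assume uv: "(u, v) \<in> parcs X"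
    then have V: "u \<in> pverts X" "v \<in> pverts X" using X.arc_verts by simp_all
    have "(e (h u), e (h v)) \<in> parcs X" using uv h_in V by simp
    then show "(h u, h v) \<in> parcs X"
      by (rule bijective_endo_reflects_arcs[OF X.simple_graph_axioms e bij_betw_imp_inj_on[OF eb] h_in(1)[OF V(1)] h_in(1)[OF V(2)]])
  qed (rule h_in(1))
  define r where "r = (\<lambda>z. h (s z))"
  have r: "graph_hom r Z X" unfolding r_def using s h by (rule graph_hom_comp)
  have i_in: "i u \<in> carrier_vec n" if "u \<in> pverts X" for u
    using graph_homD(1)[OF i that] by (simp add: Zeq)
  have shift: "graph_hom (\<lambda>u. r (w + i u)) X X" if w: "w \<in> carrier_vec n" for w
  proof (rule graph_homI)
    show "r (w + i u) \<in> pverts X" if "u \<in> pverts X" for u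
      using w i_in[OF that] by (intro graph_homD(1)[OF r]) (simp add: Zeq)
    fix u v assume uv: "(u, v) \<in> parcs X"
    have V: "i u \<in> carrier_vec n" "i v \<in> carrier_vec n" using X.arc_verts[OF uv] i_in by simp_all
    have cancel: "a + b + (a + c) = b + c" for a b c :: bit by (cases a; cases b; cases c) simp_all
    have "w + i u + (w + i v) = i u + i v"
    proof (rule eq_vecI)
      fix k assume "k < dim_vec (i u + i v)"
      then have k: "k < n" using V by simp
      have "(w + i u + (w + i v)) $ k = w $ k + i u $ k + (w $ k + i v $ k)"
        using w V k by (simp only: index_add_vec carrier_vecD)
      also have "\<dots> = (i u + i v) $ k" using V k by (simp only: cancel index_add_vec carrier_vecD)
      finally show "(w + i u + (w + i v)) $ k = (i u + i v) $ k" .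
    qed (use w V in simp)
    moreover have "i u + i v \<in> C" using graph_homD(2)[OF i uv] by (simp add: Zeq parcs_cayley_graph_Z2_group)
    ultimately have "(w + i u, w + i v) \<in> parcs Z" using w V by (simp add: Zeq parcs_cayley_graph_Z2_group)
    then show "(r (w + i u), r (w + i v)) \<in> parcs X" by (rule graph_homD(2)[OF r])
  qed
  define emb where "emb u = (\<lambda>k. if k < n then i u $ k else 0)" for u
  define retr where "retr z = r (vec n z)" for z
  have vec_add: "vec n (z + emb u) = vec n z + i u" if "u \<in> pverts X" for z u
    using i_in[OF that] by (intro eq_vecI) (simp_all add: emb_def)
  have translate: "retr (z + emb u) = r (vec n z + i u)" if "u \<in> pverts X" for z u
    unfolding retr_def vec_add[OF that] ..
  have "cubelike_retract X emb retr"
  proof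
    show "x + x = 0" for x :: "nat \<Rightarrow> bit" by (rule ext) (simp add: zero_fun_def plus_fun_def)
    show "retr z \<in> pverts X" for z
      unfolding retr_def by (rule graph_homD(1)[OF r]) (simp add: Zeq)
    show "retr (emb y) = y" if y: "y \<in> pverts X" for y
    proof -
      have "vec n (emb y) = i y" using i_in[OF y] by (intro eq_vecI) (simp_all add: emb_def)
      then show ?thesis using h_e[OF y] by (simp add: retr_def r_def e_def)
    qed
    show "(retr (z + emb u), retr (z + emb v)) \<in> parcs X" if uv: "(u, v) \<in> parcs X" for u v z
      using graph_homD(2)[OF shift[of "vec n z"] uv] X.arc_verts[OF uv] translate by simp
    show "inj_on (\<lambda>u. retr (z + emb u)) (pverts X)" for z
    proof -
      have "inj_on (\<lambda>u. r (vec n z + i u)) (pverts X)"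
        by (rule bij_betw_imp_inj_on[OF endo[OF shift]]) simp
      then show ?thesis by (rule inj_on_cong[THEN iffD1, rotated]) (simp add: translate)
    qed
  qed
  then show ?thesis by (rule that)
qed

section \<open>Orbital graphs\<close>

lemma orbital_digraph_arc_cases:
  assumes D: "orbital_digraph X D" and uv: "(u, v) \<in> parcs D"
  obtains a b \<tau> where "a \<in> pverts X" "b \<in> pverts X" "a \<noteq> b" "\<tau> \<in> carrier (Aut X)" "u = \<tau> a" "v = \<tau> b"
    "\<And>\<sigma>. \<sigma> \<in> carrier (Aut X) \<Longrightarrow> (\<sigma> a, \<sigma> b) \<in> parcs D"
proof -
  let ?act = "\<lambda>\<sigma>. \<lambda>(u, v)\<in>pverts X \<times> pverts X. (\<sigma> u, \<sigma> v)"
  from D obtain R where R: "R \<subseteq> {A \<in> orbitals X. \<not> A \<subseteq> Id}" and arcs: "parcs D = \<Union> R"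
    unfolding orbital_digraph_def by (elim conjE exE)
  from uv obtain A where A: "A \<in> R" "(u, v) \<in> A" unfolding arcs by (elim UnionE)
  with R have "A \<in> orbitals X" and not_Id: "\<not> A \<subseteq> Id" by auto
  then obtain p where p: "p \<in> pverts X \<times> pverts X" and Ap: "A = orbit (Aut X) ?act p"
    unfolding orbitals_def orbits_def by auto
  obtain a b where ab: "p = (a, b)" "a \<in> pverts X" "b \<in> pverts X" using p by (elim SigmaE) simp
  have A_eq: "A = {(\<sigma> a, \<sigma> b) | \<sigma>. \<sigma> \<in> carrier (Aut X)}" using p unfolding Ap ab(1) orbit_def by simp
  have "a \<noteq> b"
  proof
    assume "a = b"
    then have "A \<subseteq> Id" unfolding A_eq by auto
    with not_Id show False by simp
  qed
  moreover obtain \<tau> where \<tau>: "\<tau> \<in> carrier (Aut X)" "u = \<tau> a" "v = \<tau> b"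
    using A(2) unfolding A_eq by auto
  moreover have "(\<sigma> a, \<sigma> b) \<in> parcs D" if "\<sigma> \<in> carrier (Aut X)" for \<sigma>
  proof -
    have "(\<sigma> a, \<sigma> b) \<in> A" unfolding A_eq using that by auto
    then show ?thesis unfolding arcs using A(1) by (intro UnionI)
  qed
  ultimately show ?thesis using ab(2,3) by (intro that)
qed

text \<open>
  The translations of \<open>X\<close> are automorphisms, so they preserve every orbital. A non-diagonal orbital
  contains no loop, since automorphisms are injective.
\<close>

lemma orbital_graph_retract:
  assumes retr: "cubelike_retract X emb retr" and D: "orbital_graph X D"
  shows "cubelike_retract D emb retr"
proof -
  interpret X: cubelike_retract X emb retr by fact
  have D': "orbital_digraph X D" and V: "pverts D = pverts X" and sym: "sym (parcs D)"
    using D by (simp_all add: orbital_graph_def orbital_digraph_def)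
  show ?thesis
  proof
    show "finite (pverts D)" using X.finite_verts V by simp
    show "u \<in> pverts D \<and> v \<in> pverts D" if "(u, v) \<in> parcs D" for u v
      by (rule orbital_digraph_arc_cases[OF D' that]) (simp add: Aut_in_verts V)
    show "(v, u) \<in> parcs D" if "(u, v) \<in> parcs D" for u v using sym that by (rule symD)
    show "(u, u) \<notin> parcs D" for u
    proof
      assume "(u, u) \<in> parcs D"
      with D' obtain a b \<tau> where ab: "a \<in> pverts X" "b \<in> pverts X" "a \<noteq> b"
        and \<tau>: "\<tau> \<in> carrier (Aut X)" "u = \<tau> a" "u = \<tau> b" by (rule orbital_digraph_arc_cases)
      have "inj_on \<tau> (pverts X)" using \<tau>(1) by (auto simp: carrier_Aut Bij_def bij_betw_def)
      then show False using ab \<tau>(2,3) by (metis inj_onD)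
    qed
    show "x + x = 0" for x :: 'b by (rule X.char2)
    show "retr z \<in> pverts D" for z unfolding V by (rule X.retr_in_verts)
    show "retr (emb y) = y" if "y \<in> pverts D" for y using that unfolding V by (rule X.retr_emb)
    show "inj_on (\<lambda>u. retr (z + emb u)) (pverts D)" for z unfolding V by (rule X.retr_inj)
    show "(retr (z + emb u), retr (z + emb v)) \<in> parcs D" if uv: "(u, v) \<in> parcs D" for u v z
    proof -
      let ?\<sigma> = "restrict (X.translate z) (pverts X)"
      from D' uv show ?thesis
      proof (rule orbital_digraph_arc_cases)
        fix a b \<tau> assume ab: "a \<in> pverts X" "b \<in> pverts X"
          and \<tau>: "\<tau> \<in> carrier (Aut X)" "u = \<tau> a" "v = \<tau> b"
          and orb: "\<And>\<sigma>. \<sigma> \<in> carrier (Aut X) \<Longrightarrow> (\<sigma> a, \<sigma> b) \<in> parcs D"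
        have "(compose (pverts X) ?\<sigma> \<tau> a, compose (pverts X) ?\<sigma> \<tau> b) \<in> parcs D"
          using X.translate_in_Aut \<tau>(1) by (intro orb compose_Aut)
        then show ?thesis
          using ab Aut_in_verts[OF \<tau>(1)] unfolding \<tau>(2,3) by (simp add: compose_eq)
      qed
    qed
  qed
qed

lemma component_of_core_orbital:
  assumes "cubelike Z" "core_of X Z" "orbital_graph X D" "has_valency D d" "connected_component_of Y D"
  obtains emb :: "'a \<Rightarrow> nat \<Rightarrow> bit" and retr where "connected_cubelike_retract Y emb retr"
    "\<And>v. v \<in> pverts Y \<Longrightarrow> card {w. (v, w) \<in> parcs Y} = d"
proof -
  obtain emb :: "'a \<Rightarrow> nat \<Rightarrow> bit" and retr where "cubelike_retract X emb retr"
    using assms(1,2) by (rule core_of_cubelike_retract)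
  then have "cubelike_retract D emb retr" using assms(3) by (rule orbital_graph_retract)
  then interpret D: cubelike_retract D emb retr .
  obtain u where u: "u \<in> pverts D" and V: "pverts Y = {v. (u, v) \<in> (parcs D)\<^sup>*}"
    and A: "parcs Y = parcs D \<inter> pverts Y \<times> pverts Y"
    using assms(5) by (rule D.connected_component_closure)
  have deg: "card {w. (v, w) \<in> parcs Y} = d" if v: "v \<in> pverts Y" for v
  proof -
    have "(u, v) \<in> (parcs D)\<^sup>*" using v V by simp
    then have vD: "v \<in> pverts D" by (induction rule: rtrancl_induct) (simp_all add: u D.arc_verts)
    have "{w. (v, w) \<in> parcs Y} = {w. (v, w) \<in> parcs D}"
      using v unfolding A V by (auto intro: rtrancl_into_rtrancl)
    moreover have "out_arcs (with_proj D) v = Pair v ` {w. (v, w) \<in> parcs D}"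
      by (auto simp: out_arcs_def)
    then have "out_degree (with_proj D) v = card {w. (v, w) \<in> parcs D}"
      by (simp add: out_degree_def card_image inj_on_def)
    ultimately show ?thesis using assms(4) vD by (simp add: has_valency_def)
  qed
  from D.component_retract[OF u V A] obtain emb' :: "'a \<Rightarrow> nat \<Rightarrow> bit" and retr'
    where "connected_cubelike_retract Y emb' retr'" by blast
  then show ?thesis using deg by (rule that)
qed

theorem theorem9p1:
  fixes X D Y :: "'a pair_pre_digraph" and Z :: "bit vec pair_pre_digraph" and d :: nat
  assumes "cubelike Z" and "core_of X Z"
    and "orbital_graph X D" and "has_valency D d"
    and "connected_component_of Y D"
  shows
    "((\<exists>Z'. cubelike Z' \<and> hom_equivalent Y Z') \<and>
        clique_number Y \<noteq> 3 \<and> chromatic_number Y \<noteq> 3) \<and>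
     generously_transitive Y \<and>
     ((\<exists>\<phi>. covering_map \<phi> (cube d) Y) \<and> card (pverts Y) \<le> 2 ^ d) \<and>
     (0 < d \<and> is_core Y \<and> \<not> complete_digraph 2 (with_proj Y) \<longrightarrow>
        card (pverts Y) \<le> 2 ^ (d - 1) \<and>
        (card (pverts Y) = 2 ^ (d - 1) \<longleftrightarrow>
           odd d \<and> digraph_iso (with_proj Y) (with_proj (folded_cube d)))) \<and>
     (eigenvalues Y \<subseteq># eigenvalues (cube d) \<and> (\<forall>x\<in>#eigenvalues Y. x \<in> \<int>)) \<and>
     (independence_number Y * clique_number Y = card (pverts Y) \<longrightarrow>
        (\<forall>K :: 'k pair_pre_digraph. core_of K Y \<longrightarrow> (\<exists>n. complete_digraph n (with_proj K)))) \<and>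
     (hom_idempotent Y \<and>
        (is_core Y \<longrightarrow> (hom_idempotent Y \<longleftrightarrow> is_subgraph Y (shift_graph Y)))) \<and>
     (\<forall>W :: 'w pair_pre_digraph. pair_graph W \<and> homomorphic W Y \<longrightarrow>
        homomorphic (cubelike_hull W) Y) \<and>
     (\<forall>g :: nat. odd_girth Y = enat g \<longrightarrow> is_induced_subgraph (folded_cube g) Y)"
proof -
  obtain emb :: "'a \<Rightarrow> nat \<Rightarrow> bit" and retr where "connected_cubelike_retract Y emb retr"
    and valency: "\<And>v. v \<in> pverts Y \<Longrightarrow> card {w. (v, w) \<in> parcs Y} = d"
    using component_of_core_orbital[OF assms] by blast
  then interpret connected_cubelike_retract Y emb retr by simp
  obtain walk where "cube_cover Y d walk" using valency by (rule cube_cover_exists)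
  then interpret cov: cube_cover Y d walk .
  have "v \<in> pverts (cube d)" if "(u, v) \<in> parcs (cube d)" for u v
    using that by (rule arc_cubeE) simp
  then have eigenvalues: "eigenvalues Y \<subseteq># eigenvalues (cube d)"
    by (intro eigenvalues_covering_map[OF cov.covering_cube])
      (simp_all add: finite_carrier_bit_vec)
  show ?thesis
  proof (intro conjI allI impI ballI)
    show "\<exists>Z'. cubelike Z' \<and> hom_equivalent Y Z'" by (rule cubelike_equivalent)
    show "clique_number Y \<noteq> 3" by (rule clique_number_neq_3)
    show "chromatic_number Y \<noteq> 3" by (rule chromatic_number_neq_3)
    show "generously_transitive Y" by (rule generously_transitive)
    show "\<exists>\<phi>. covering_map \<phi> (cube d) Y" using cov.covering_cube by blast
    show "card (pverts Y) \<le> 2 ^ d" by (rule cov.card_verts_le)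
    assume "0 < d \<and> is_core Y \<and> \<not> complete_digraph 2 (with_proj Y)"
    then have *: "0 < d" "is_core Y" "\<not> complete_digraph 2 (with_proj Y)" by simp_all
    show "card (pverts Y) \<le> 2 ^ (d - 1)"
      using valency * by (rule core_bound(1))
    show "card (pverts Y) = 2 ^ (d - 1) \<longleftrightarrow>
        odd d \<and> digraph_iso (with_proj Y) (with_proj (folded_cube d))"
      using valency * by (rule core_bound(2))
  next
    show "eigenvalues Y \<subseteq># eigenvalues (cube d)" by (rule eigenvalues)
    fix x assume "x \<in># eigenvalues Y"
    then have "x \<in># eigenvalues (cube d)" by (rule mset_subset_eqD[OF eigenvalues])
    then show "x \<in> \<int>" by (rule eigenvalues_cube_integer)
  next
    fix K :: "'k pair_pre_digraph"
    assume "independence_number Y * clique_number Y = card (pverts Y)" and K: "core_of K Y"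
    then obtain f C where "graph_hom f Y Y" "is_clique Y C" "f ` pverts Y \<subseteq> C"
      by (elim hom_to_maximum_clique)
    then show "\<exists>n. complete_digraph n (with_proj K)"
      using K by (rule core_complete_if_hom_to_clique)
  next
    show "hom_idempotent Y" by (rule hom_idempotent)
    show "hom_idempotent Y \<longleftrightarrow> is_subgraph Y (shift_graph Y)"
      using hom_idempotent subgraph_shift_graph by simp
  next
    fix W :: "'w pair_pre_digraph" assume W: "pair_graph W \<and> homomorphic W Y"
    then obtain f where "graph_hom f W Y" unfolding homomorphic_def by (elim conjE exE)
    then show "homomorphic (cubelike_hull W) Y" using W by (intro hom_cubelike_hull) simp_all
  next
    fix g assume "odd_girth Y = enat g"
    then show "is_induced_subgraph (folded_cube g) Y" by (rule folded_cube_of_odd_girth)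
  qed
qed

end
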